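(* The following relations hold for any infinite Tychonoff space $X$. (1) $|\mathscr D_X|=\beth_2(|X|)$, i.e. $|\mathscr D_X|=2^{2^{|X|}}$. (2) $\max\left\{2^{|X|},2^{|\mathrm{RO}(X)|}\right\}\le|\mathscr U_X|\le 2^{o(X)}$, where $o(X)$ is the number of open subsets of $X$.
   Context: $\mathrm{RO}(X)$ is the collection of all regular open subsets of $X$. For a Tychonoff (completely regular Hausdorff) space $X$, $C(X)$ is the set of all continuous functions $X\to\mathbb R$. A nonempty family of sets $\alpha$ is directed if for any $A,B\in\alpha$ there is $E\in\alpha$ with $A\cup B\subseteq E$. $\mathscr D_X$ is the collection of all directed families $\alpha\subseteq\mathscr P(X)$. For $\alpha\in\mathscr D_X$, $C_\alpha(X)$ denotes the topology on $C(X)$ in which $U\subseteq C(X)$ is open iff for each $f\in U$ there are $A\in\alpha$ and a real $\varepsilon>0$ with $\{g\in C(X):\forall x\in A\ (|f(x)-g(x)|<\varepsilon)\}\subseteq U$. $\mathscr U_X:=\{C_\alpha(X):\alpha\in\mathscr D_X\}$ (a set of topologies on $C(X)$). *)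

theory Defs
  imports "HOL-Analysis.Analysis"
begin

unbundle cardinal_syntax

definition regular_opens :: "'a topology \<Rightarrow> 'a set set" where
  "regular_opens X = {U. U \<subseteq> topspace X \<and> X interior_of (X closure_of U) = U}"

definition directed_families :: "'a topology \<Rightarrow> 'a set set set" where
  "directed_families X =
     {\<alpha>. \<alpha> \<noteq> {} \<and> \<alpha> \<subseteq> Pow (topspace X) \<and> (\<forall>A\<in>\<alpha>. \<forall>B\<in>\<alpha>. \<exists>E\<in>\<alpha>. A \<union> B \<subseteq> E)}"

text \<open>Functions on the carrier are represented extensionally (constantly \<^term>\<open>undefined\<close> off
  \<^term>\<open>topspace X\<close>), so that distinct elements differ on \<^term>\<open>topspace X\<close>.\<close>
definition cont_funs :: "'a topology \<Rightarrow> ('a \<Rightarrow> real) set" where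
  "cont_funs X = {f \<in> extensional (topspace X). continuous_map X euclideanreal f}"

text \<open>Directedness is what makes the displayed predicate a topology; see \<open>openin_C_alpha\<close>.\<close>
definition C_alpha :: "'a topology \<Rightarrow> 'a set set \<Rightarrow> ('a \<Rightarrow> real) topology" where
  "C_alpha X \<alpha> = topology (\<lambda>U. U \<subseteq> cont_funs X \<and>
     (\<forall>f\<in>U. \<exists>A\<in>\<alpha>. \<exists>\<epsilon>>0. {g \<in> cont_funs X. \<forall>x\<in>A. \<bar>f x - g x\<bar> < \<epsilon>} \<subseteq> U))"

definition uniform_topologies :: "'a topology \<Rightarrow> ('a \<Rightarrow> real) topology set" where
  "uniform_topologies X = C_alpha X ` directed_families X"

lemma openin_C_alpha:
  assumes "\<alpha> \<in> directed_families X"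
  shows "openin (C_alpha X \<alpha>) U \<longleftrightarrow> U \<subseteq> cont_funs X \<and>
     (\<forall>f\<in>U. \<exists>A\<in>\<alpha>. \<exists>\<epsilon>>0. {g \<in> cont_funs X. \<forall>x\<in>A. \<bar>f x - g x\<bar> < \<epsilon>} \<subseteq> U)"
proof -
  let ?N = "\<lambda>f A \<epsilon>. {g \<in> cont_funs X. \<forall>x\<in>A. \<bar>f x - g x\<bar> < \<epsilon>}"
  let ?P = "\<lambda>U. U \<subseteq> cont_funs X \<and> (\<forall>f\<in>U. \<exists>A\<in>\<alpha>. \<exists>\<epsilon>>0. ?N f A \<epsilon> \<subseteq> U)"
  have "?P (S \<inter> T)" if S: "?P S" and T: "?P T" for S T
  proof (intro conjI ballI)
    show "S \<inter> T \<subseteq> cont_funs X" using S by blast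
    fix f assume f: "f \<in> S \<inter> T"
    obtain A d where A: "A \<in> \<alpha>" "d > 0" "?N f A d \<subseteq> S" using S f by blast
    obtain B e where B: "B \<in> \<alpha>" "e > 0" "?N f B e \<subseteq> T" using T f by blast
    obtain E where E: "E \<in> \<alpha>" "A \<union> B \<subseteq> E"
      using assms A B unfolding directed_families_def by blast
    have "?N f E (min d e) \<subseteq> ?N f A d \<inter> ?N f B e" using E by auto
    then have "?N f E (min d e) \<subseteq> S \<inter> T" using A(3) B(3) by blast
    moreover have "min d e > 0" using A B by simp
    ultimately show "\<exists>A\<in>\<alpha>. \<exists>\<epsilon>>0. ?N f A \<epsilon> \<subseteq> S \<inter> T" using E(1) by blast
  qed
  moreover have "?P (\<Union>K)" if K: "\<forall>S\<in>K. ?P S" for K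
  proof (intro conjI ballI)
    show "\<Union>K \<subseteq> cont_funs X" using K by blast
    fix f assume "f \<in> \<Union>K"
    then obtain S where S: "S \<in> K" "f \<in> S" by blast
    then obtain A e where "A \<in> \<alpha>" "e > 0" "?N f A e \<subseteq> S" using K by blast
    moreover have "S \<subseteq> \<Union>K" using S by blast
    ultimately show "\<exists>A\<in>\<alpha>. \<exists>\<epsilon>>0. ?N f A \<epsilon> \<subseteq> \<Union>K" by (meson subset_trans)
  qed
  ultimately have "istopology ?P" unfolding istopology_def by presburger
  then show ?thesis unfolding C_alpha_def by simp
qed

end

theory Submission
  imports Defs "HOL-Algebra.Free_Abelian_Groups"
begin

text \<open>
  Adding \<open>topspace X\<close> to an arbitrary family of subsets makes it directed, which gives (1). For (2),
  if \<open>C_alpha X \<alpha> = C_alpha X \<beta>\<close> then complete regularity shows that every \<open>A \<in> \<alpha>\<close> lies in the closure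
  of some \<open>B \<in> \<beta>\<close>. Hence \<open>C_alpha X \<alpha>\<close> depends only on the closures of the members of \<open>\<alpha>\<close> (upper
  bound), and any family of sets none of which lies in the closure of a union of finitely many
  others produces as many topologies as it has subfamilies. Singletons give \<open>2^|X|\<close>.

  For \<open>2^|RO(X)|\<close> one needs such a family of \<open>|RO(X)|\<close> open sets. This is the part of the
  Balcar--Franek theorem on independent families in complete Boolean algebras that is relevant here.
  On a piece where \<open>|RO|\<close> and the sizes of antichains do not drop when passing to smaller open sets,
  take antichains \<open>z j\<close> of all possible sizes that are independent of each other, and a maximal family
  \<open>U\<close> of regular open sets independent over them. By Vladimirov's lemma the complete subalgebra
  generated by \<open>U\<close> and the \<open>z j\<close> contains all regular open subsets of one of its nonempty members, so
  \<open>|RO|\<close> is at most the sum of the cardinals \<open>|U + \<omega>| ^ |z j|\<close>, and a family of that size is obtained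
  by gluing members of \<open>U\<close> along the antichains. The space is finally decomposed into such pieces,
  and the families on the pieces are combined in the same way.
\<close>

subsection \<open>Cardinalities\<close>

text \<open>The obstacle is the saturation of the algebra, the least cardinal
  \<open>|\<Theta>|\<close> that is not the size of a disjoint family of nonempty open sets. The
  generated subalgebra is reached in \<open>|\<Theta>|\<close> stages, each of which takes
  complements of suprema of fewer than \<open>|\<Theta>|\<close> elements, so the bound has to
  absorb all exponents below \<open>|\<Theta>|\<close>. If these exponents have a maximum, one
  antichain of that size is enough. If they have none, no single antichain is long enough, which is
  why a whole system of antichains appears; their mutual independence allows the families built on
  different antichains to be put side by side. The witness asked of a family is one-sided: a
  nonempty open part of one member that misses finitely many others. Such a witness can be confined
  to a single cell of a disjoint family, so families on the cells combine to one indexed by the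
  product of their index sets. This device serves inside a homogeneous piece, where all factors are
  equal, and again for the decomposition, where their sizes differ.\<close>

lemma lepoll_iff_ordLeq: "A \<lesssim> B \<longleftrightarrow> |A| \<le>o |B|"
  by (simp add: lepoll_def card_of_ordLeq)

lemma not_lepoll_iff_ordLess: "\<not> A \<lesssim> B \<longleftrightarrow> |B| <o |A|"
  by (simp add: lepoll_iff_ordLeq)

lemma lepollE:
  assumes "E \<lesssim> A" obtains f where "inj_on f E" "f ` E \<subseteq> A"
  using assms by (auto simp: lepoll_def)

lemma lepoll_finite: "A \<lesssim> B \<Longrightarrow> finite B \<Longrightarrow> finite A"
  using card_of_ordLeq_finite by (auto simp: lepoll_iff_ordLeq)

lemma lepoll_total: "A \<lesssim> B \<or> B \<lesssim> A"
  using ordLeq_total[of "|A|" "|B|"] by (simp add: lepoll_iff_ordLeq)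

text \<open>Sets stand for cardinals throughout; this is the well-foundedness of cardinals in that
  language.\<close>

lemma exists_minimal_lepoll:
  assumes "A \<in> \<S>"
  obtains B where "B \<in> \<S>" "\<forall>C\<in>\<S>. B \<lesssim> C"
proof -
  have "wf (inv_image ordLess card_of)" by (simp add: wf_ordLess)
  then obtain B where "B \<in> \<S>" "\<And>C. |C| <o |B| \<Longrightarrow> C \<notin> \<S>"
    using assms unfolding wf_eq_minimal by (auto simp: inv_image_def)
  then show ?thesis
    using that not_lepoll_iff_ordLess by blast
qed

lemma times_lepoll_infinite:
  assumes "infinite C" "A \<lesssim> C" "B \<lesssim> C" shows "A \<times> B \<lesssim> C"
proof -
  have "A \<times> B \<lesssim> C \<times> C" using assms by (simp add: times_lepoll_mono)
  moreover have "C \<times> C \<lesssim> C"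
    using card_of_Times_same_infinite[OF assms(1)] by (simp add: lepoll_iff_ordLeq ordIso_imp_ordLeq)
  ultimately show ?thesis by (rule lepoll_trans)
qed

lemma Sigma_lepoll_infinite:
  assumes "infinite C" "I \<lesssim> C" "\<And>i. i \<in> I \<Longrightarrow> A i \<lesssim> C" shows "Sigma I A \<lesssim> C"
  using assms card_of_Sigma_ordLeq_infinite[of C I A] by (simp add: lepoll_iff_ordLeq)

lemma UN_lepoll_infinite:
  assumes "infinite C" "I \<lesssim> C" "\<And>i. i \<in> I \<Longrightarrow> A i \<lesssim> C" shows "(\<Union>i\<in>I. A i) \<lesssim> C"
  using assms card_of_UNION_ordLeq_infinite[of C I A] by (simp add: lepoll_iff_ordLeq)

lemma Un_lepoll_infinite:
  assumes "infinite C" "A \<lesssim> C" "B \<lesssim> C" shows "A \<union> B \<lesssim> C"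
  using UN_lepoll_infinite[OF assms(1), of "{True,False}" "\<lambda>b. if b then A else B"] assms
  by (simp add: finite_lepoll_infinite Un_commute)

lemma Fpow_lepoll_infinite:
  assumes "infinite C" "A \<lesssim> C" shows "Fpow A \<lesssim> C"
proof -
  obtain f where f: "inj_on f A" "f ` A \<subseteq> C" using assms(2) by (auto simp: lepoll_def)
  have "Fpow A \<lesssim> Fpow C" unfolding lepoll_def
    using f inj_on_image_Fpow image_Fpow_mono by meson
  also have "Fpow C \<lesssim> C" using assms(1) by (simp add: eqpoll_Fpow eqpoll_imp_lepoll)
  finally show ?thesis .
qed

lemma Func_eq_PiE: "Func A B = A \<rightarrow>\<^sub>E B"
  unfolding Func_def PiE_def Pi_def extensional_def by blast

lemma funcset_times_eqpoll: "A \<times> B \<rightarrow>\<^sub>E C \<approx> A \<rightarrow>\<^sub>E (B \<rightarrow>\<^sub>E C)"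
  using card_of_Func_Times[of A B C] by (simp only: eqpoll_iff_card_of_ordIso Func_eq_PiE)

lemma lepoll_funcset_self:
  assumes "a \<in> K" "b \<in> K" "a \<noteq> b" shows "M \<lesssim> M \<rightarrow>\<^sub>E K"
proof -
  let ?f = "\<lambda>m. \<lambda>x\<in>M. if x = m then a else b"
  have "m = n" if m: "m \<in> M" and eq: "?f m = ?f n" for m n
  proof (rule ccontr)
    assume "m \<noteq> n"
    then have "?f m m = a" "?f n m = b" using m by simp_all
    then show False using assms(3) eq by metis
  qed
  then have "inj_on ?f M" by (auto simp: inj_on_def)
  moreover have "?f ` M \<subseteq> M \<rightarrow>\<^sub>E K" using assms by auto
  ultimately show ?thesis by (auto simp: lepoll_def)
qed

lemma nonempty_subsets_lepoll: "{E. E \<subseteq> C \<and> E \<noteq> {} \<and> E \<lesssim> M} \<lesssim> M \<rightarrow>\<^sub>E C"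
proof -
  have "\<exists>x\<in>M \<rightarrow>\<^sub>E C. E = x ` M" if E: "E \<subseteq> C" "E \<noteq> {}" "E \<lesssim> M" for E
  proof -
    obtain g where g: "E \<subseteq> g ` M" using E(3) by (auto simp: lepoll_iff)
    obtain e where e: "e \<in> E" using E(2) by blast
    \<comment> \<open>Arguments that \<open>g\<close> sends outside \<open>E\<close> get the default
      value \<open>e\<close>, which makes the range exactly \<open>E\<close>. Hence the restriction
      to nonempty \<open>E\<close>.\<close>
    let ?h = "\<lambda>m\<in>M. if g m \<in> E then g m else e"
    have "E \<subseteq> ?h ` M"
    proof
      fix x assume x: "x \<in> E"
      then obtain m where m: "m \<in> M" "x = g m" using g by blast
      then have "x = ?h m" using x by simp
      then show "x \<in> ?h ` M" using m(1) by (rule image_eqI)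
    qed
    moreover have "?h ` M \<subseteq> E" using e by auto
    moreover have "?h \<in> M \<rightarrow>\<^sub>E C" using e E(1) by auto
    ultimately have "E = ?h ` M" "?h \<in> M \<rightarrow>\<^sub>E C" by (simp_all only: subset_antisym)
    then show ?thesis by (rule bexI)
  qed
  then have "{E. E \<subseteq> C \<and> E \<noteq> {} \<and> E \<lesssim> M} \<subseteq> (\<lambda>x. x ` M) ` (M \<rightarrow>\<^sub>E C)"
    unfolding subset_eq image_iff mem_Collect_eq by (intro ballI) simp
  then show ?thesis by (rule subset_image_lepoll)
qed

text \<open>Recursion along a well-ordering of \<open>Q\<close> of least length: fewer than \<open>|Q|\<close> values are
  used up at each step.\<close>
lemma injective_choice:
  assumes "\<And>q. q \<in> Q \<Longrightarrow> Q \<lesssim> G q"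
  obtains f where "inj_on f Q" "\<forall>q\<in>Q. f q \<in> G q"
proof -
  let ?r = "|Q|"
  have wo: "Well_order ?r" by (rule card_of_Well_order)
  have wf: "wf (?r - Id)" using wo by (simp add: well_order_on_def)
  let ?P = "\<lambda>f q x. q \<in> Q \<longrightarrow> x \<in> G q \<and> (\<forall>p. (p, q) \<in> ?r - Id \<longrightarrow> x \<noteq> f p)"
  have "\<exists>f. \<forall>q. ?P f q (f q)"
  proof (rule dependent_wf_choice[OF wf])
    fix q :: 'a and f :: "'a \<Rightarrow> 'b"
    show "\<exists>x. ?P f q x"
    proof (cases "q \<in> Q")
      case True
      let ?U = "underS ?r q"
      have "|?U| <o |Q|"
        using True card_of_underS[OF card_of_Card_order, of q Q] by (simp add: Field_card_of)
      then have "\<not> Q \<lesssim> f ` ?U"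
        by (metis image_lepoll lepoll_trans not_lepoll_iff_ordLess)
      then have "\<not> G q \<subseteq> f ` ?U"
        using assms[OF True] lepoll_trans subset_imp_lepoll by blast
      then obtain x where "x \<in> G q" "x \<notin> f ` ?U" by blast
      then show ?thesis by (auto simp: underS_def)
    qed auto
  qed auto
  then obtain f where f: "\<And>q. ?P f q (f q)" by blast
  have "Total ?r" using wo by (simp add: well_order_on_def linear_order_on_def)
  have "inj_on f Q"
  proof (rule inj_onI, rule ccontr)
    fix p q assume pq: "p \<in> Q" "q \<in> Q" "f p = f q" "p \<noteq> q"
    then have "(p, q) \<in> ?r - Id \<or> (q, p) \<in> ?r - Id"
      using \<open>Total ?r\<close> by (auto simp: total_on_def Field_card_of)
    then show False using f[of p] f[of q] pq by auto
  qed
  then show ?thesis using that f by blast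
qed

subsection \<open>Cellular and independent families\<close>

text \<open>An antichain of open sets, kept as an indexed family: disjoint nonempty members are
  distinct, so its size is that of \<open>I\<close>.\<close>

definition cellular :: "'a topology \<Rightarrow> ('i \<Rightarrow> 'a set) \<Rightarrow> 'i set \<Rightarrow> bool" where
  "cellular X a I \<longleftrightarrow> (\<forall>i\<in>I. openin X (a i) \<and> a i \<noteq> {}) \<and> disjoint_family_on a I"

text \<open>One positive member against finitely many negative ones is what separation by closures
  uses: the open set \<open>W\<close> misses the closure of the union of the others. The sets in
  \<open>D\<close> prescribe where \<open>W\<close> can be found, which leaves room to combine
  several families.\<close>

definition indep :: "'a topology \<Rightarrow> 'a set set \<Rightarrow> ('k \<Rightarrow> 'a set) \<Rightarrow> 'k set \<Rightarrow> bool" where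
  "indep X D s K \<longleftrightarrow> (\<forall>k\<in>K. openin X (s k)) \<and>
     (\<forall>k\<in>K. \<forall>F d. finite F \<longrightarrow> F \<subseteq> K - {k} \<longrightarrow> d \<in> D \<longrightarrow>
        (\<exists>W. openin X W \<and> W \<noteq> {} \<and> W \<subseteq> d \<inter> s k \<and> (\<forall>l\<in>F. W \<inter> s l = {})))"

lemma cellularI:
  assumes "\<And>i. i \<in> I \<Longrightarrow> openin X (a i)" "\<And>i. i \<in> I \<Longrightarrow> a i \<noteq> {}"
    "\<And>i j. i \<in> I \<Longrightarrow> j \<in> I \<Longrightarrow> i \<noteq> j \<Longrightarrow> a i \<inter> a j = {}"
  shows "cellular X a I"
  using assms unfolding cellular_def disjoint_family_on_def by blast+

lemma cellularD:
  assumes "cellular X a I"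
  shows "i \<in> I \<Longrightarrow> openin X (a i)" "i \<in> I \<Longrightarrow> a i \<noteq> {}"
    "i \<in> I \<Longrightarrow> j \<in> I \<Longrightarrow> i \<noteq> j \<Longrightarrow> a i \<inter> a j = {}"
  using assms unfolding cellular_def disjoint_family_on_def by blast+

lemma cellular_subset: "cellular X a I \<Longrightarrow> J \<subseteq> I \<Longrightarrow> cellular X a J"
  by (rule cellularI) (simp_all add: cellularD subset_iff)

lemma cellular_comp:
  assumes "cellular X a I" "inj_on f J" "f ` J \<subseteq> I"
  shows "cellular X (\<lambda>j. a (f j)) J"
proof (rule cellularI)
  fix i j assume ij: "i \<in> J" "j \<in> J" "i \<noteq> j"
  then have "f i \<noteq> f j" using assms(2) by (auto dest: inj_onD)
  then show "a (f i) \<inter> a (f j) = {}" using cellularD(3)[OF assms(1)] assms(3) ij by blast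
qed (use cellularD[OF assms(1)] assms(3) in blast)+

lemma indepI:
  assumes "\<And>k. k \<in> K \<Longrightarrow> openin X (s k)"
    and "\<And>k F d. k \<in> K \<Longrightarrow> finite F \<Longrightarrow> F \<subseteq> K - {k} \<Longrightarrow> d \<in> D \<Longrightarrow>
      \<exists>W. openin X W \<and> W \<noteq> {} \<and> W \<subseteq> d \<inter> s k \<and> (\<forall>l\<in>F. W \<inter> s l = {})"
  shows "indep X D s K"
  unfolding indep_def
proof (intro conjI ballI allI impI)
  fix k assume "k \<in> K" then show "openin X (s k)" by (rule assms(1))
next
  fix k F d assume "k \<in> K" "finite F" "F \<subseteq> K - {k}" "d \<in> D"
  then show "\<exists>W. openin X W \<and> W \<noteq> {} \<and> W \<subseteq> d \<inter> s k \<and> (\<forall>l\<in>F. W \<inter> s l = {})"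
    by (rule assms(2))
qed

lemma indepE:
  assumes "indep X D s K" "k \<in> K" "finite F" "F \<subseteq> K - {k}" "d \<in> D"
  obtains W where "openin X W" "W \<noteq> {}" "W \<subseteq> d" "W \<subseteq> s k" "\<forall>l\<in>F. W \<inter> s l = {}"
proof -
  have "\<exists>W. openin X W \<and> W \<noteq> {} \<and> W \<subseteq> d \<inter> s k \<and> (\<forall>l\<in>F. W \<inter> s l = {})"
    using assms(1)[unfolded indep_def, THEN conjunct2, rule_format, OF assms(2-5)] .
  then show ?thesis using that by blast
qed

lemma indep_openin: "indep X D s K \<Longrightarrow> k \<in> K \<Longrightarrow> openin X (s k)"
  by (simp add: indep_def)

lemma indep_comp:
  assumes s: "indep X D s K" and f: "inj_on f L" "f ` L \<subseteq> K"
  shows "indep X D (\<lambda>l. s (f l)) L"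
proof (rule indepI)
  fix k F d assume k: "k \<in> L" "finite F" "F \<subseteq> L - {k}" "d \<in> D"
  have "f l \<noteq> f k" if "l \<in> F" for l using inj_onD[OF f(1), of l k] that k(1,3) by blast
  then have fF: "f ` F \<subseteq> K - {f k}" using k(3) f(2) by (auto simp: image_subset_iff)
  have fk: "f k \<in> K" using f(2) k(1) by blast
  obtain W where "openin X W" "W \<noteq> {}" "W \<subseteq> d" "W \<subseteq> s (f k)" "\<forall>l\<in>f ` F. W \<inter> s l = {}"
    by (rule indepE[OF s fk finite_imageI[OF k(2)] fF k(4)])
  then show "\<exists>W. openin X W \<and> W \<noteq> {} \<and> W \<subseteq> d \<inter> s (f k) \<and> (\<forall>l\<in>F. W \<inter> s (f l) = {})"
    by (intro exI[of _ W]) auto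
next
  fix l assume "l \<in> L"
  then show "openin X (s (f l))" using indep_openin[OF s] f(2) by blast
qed

lemma indep_lepoll:
  assumes "indep X D s K" "\<And>k. k \<in> K \<Longrightarrow> s k \<subseteq> b" "L \<lesssim> K"
  obtains t where "indep X D t L" "\<forall>k\<in>L. t k \<subseteq> b"
proof -
  obtain f where f: "inj_on f L" "f ` L \<subseteq> K" using assms(3) by (auto simp: lepoll_def)
  show ?thesis
  proof (rule that[OF indep_comp[OF assms(1) f]])
    show "\<forall>k\<in>L. s (f k) \<subseteq> b" using assms(2) f(2) by blast
  qed
qed

lemma PiE_finite_lepoll:
  assumes "finite F" "infinite C" "\<And>i. i \<in> F \<Longrightarrow> K i \<lesssim> C"
  shows "PiE F K \<lesssim> C"
  using assms(1,3)
proof (induction F)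
  case empty
  then show ?case using assms(2) by (simp add: finite_lepoll_infinite)
next
  case (insert x F)
  have "PiE (insert x F) K \<lesssim> K x \<times> PiE F K"
    unfolding PiE_insert_eq by (rule image_lepoll)
  also have "\<dots> \<lesssim> C" using insert assms(2) by (intro times_lepoll_infinite) auto
  finally show ?case .
qed

lemma finite_lepoll_max:
  assumes "finite F" "F \<noteq> {}"
  obtains m where "m \<in> F" "\<And>i. i \<in> F \<Longrightarrow> K i \<lesssim> K m"
proof -
  have "\<exists>m\<in>F. \<forall>i\<in>F. K i \<lesssim> K m"
    using assms
  proof (induction F rule: finite_ne_induct)
    case (insert x F)
    then obtain m where m: "m \<in> F" "\<forall>i\<in>F. K i \<lesssim> K m" by blast
    show ?case
    proof (cases "K x \<lesssim> K m")
      case True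
      then show ?thesis using m by blast
    next
      case False
      then have "K m \<lesssim> K x" using lepoll_total by blast
      then have "K i \<lesssim> K x" if "i \<in> insert x F" for i using that m(2) lepoll_trans by blast
      then show ?thesis by blast
    qed
  qed auto
  then show ?thesis using that by blast
qed

text \<open>Two functions are separated by a single coordinate, so finitely many functions are separated
  from a given one by a finite set \<open>F\<close> of coordinates. The restriction of \<open>f\<close> to \<open>F\<close> is coded in a
  piece \<open>\<iota> F\<close> that is large enough to hold all such restrictions.\<close>
lemma indep_PiE_uniform:
  assumes cell: "cellular X a I" and inf: "infinite I"
    and s: "\<And>i. i \<in> I \<Longrightarrow> indep X D (s i) (K i)"
    and sub: "\<And>i k. i \<in> I \<Longrightarrow> k \<in> K i \<Longrightarrow> s i k \<subseteq> a i"
    and infK: "\<And>i. i \<in> I \<Longrightarrow> infinite (K i)"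
    and big: "\<And>i. i \<in> I \<Longrightarrow> I \<lesssim> {j \<in> I. K i \<lesssim> K j}"
  obtains t where "indep X D t (PiE I K)" "\<forall>f\<in>PiE I K. t f \<subseteq> \<Union>(a ` I)"
proof -
  define Q where "Q = Fpow I - {{}}"
  let ?G = "\<lambda>F. {j \<in> I. \<forall>i\<in>F. K i \<lesssim> K j}"
  have QI: "Q \<lesssim> I"
    unfolding Q_def using Fpow_lepoll_infinite[OF inf lepoll_refl] lepoll_trans subset_imp_lepoll
    by (metis Diff_subset)
  \<comment> \<open>A coordinate \<open>m\<close> of \<open>F\<close> with the largest factor
    decides: by \<open>big\<close> as many indices as there are in \<open>I\<close> dominate
    \<open>K m\<close>, and there are no more finite sets than that.\<close>
  have "Q \<lesssim> ?G F" if F: "F \<in> Q" for F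
  proof -
    have F': "finite F" "F \<noteq> {}" "F \<subseteq> I" using F by (auto simp: Q_def Fpow_def)
    obtain m where m: "m \<in> F" "\<And>i. i \<in> F \<Longrightarrow> K i \<lesssim> K m" using finite_lepoll_max[OF F'(1,2)] by metis
    then have sub: "{j \<in> I. K m \<lesssim> K j} \<subseteq> ?G F" using lepoll_trans by blast
    have "m \<in> I" using m(1) F'(3) by blast
    show ?thesis
      by (rule lepoll_trans[OF lepoll_trans[OF QI big[OF \<open>m \<in> I\<close>]] subset_imp_lepoll[OF sub]])
  qed
  then obtain \<iota> where \<iota>: "inj_on \<iota> Q" and \<iota>G: "\<forall>F\<in>Q. \<iota> F \<in> ?G F" by (rule injective_choice)
  have "\<exists>c. inj_on c (PiE F K) \<and> c ` PiE F K \<subseteq> K (\<iota> F)" if F: "F \<in> Q" for F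
    using PiE_finite_lepoll[of F "K (\<iota> F)" K] bspec[OF \<iota>G F] infK F by (auto simp: Q_def Fpow_def lepoll_def)
  then obtain c where c: "\<And>F. F \<in> Q \<Longrightarrow> inj_on (c F) (PiE F K)" "\<And>F. F \<in> Q \<Longrightarrow> c F ` PiE F K \<subseteq> K (\<iota> F)"
    by metis
  define t where "t f = (\<Union>F\<in>Q. s (\<iota> F) (c F (restrict f F)))" for f
  have I\<iota>: "\<iota> F \<in> I" if "F \<in> Q" for F using \<iota>G that by blast
  have res: "restrict f F \<in> PiE F K" if "f \<in> PiE I K" "F \<in> Q" for f F
    using that by (auto simp: Q_def Fpow_def)
  have cK: "c F (restrict f F) \<in> K (\<iota> F)" if "f \<in> PiE I K" "F \<in> Q" for f F
    using c(2)[OF that(2)] res[OF that] by blast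
  have piece: "s (\<iota> F) (c F (restrict f F)) \<subseteq> a (\<iota> F)" if "f \<in> PiE I K" "F \<in> Q" for f F
    using sub I\<iota> cK that by blast
  have "indep X D t (PiE I K)"
  proof (rule indepI)
    fix f assume f: "f \<in> PiE I K"
    have "openin X (s (\<iota> F) (c F (restrict f F)))" if "F \<in> Q" for F
      by (rule indep_openin[OF s[OF I\<iota>[OF that]] cK[OF f that]])
    then show "openin X (t f)" unfolding t_def by (intro openin_Union) auto
  next
    fix f \<F> d assume f: "f \<in> PiE I K" and \<F>: "finite \<F>" "\<F> \<subseteq> PiE I K - {f}" and d: "d \<in> D"
    have "\<exists>i\<in>I. f i \<noteq> g i" if "g \<in> \<F>" for g
    proof (rule ccontr)
      assume "\<not> (\<exists>i\<in>I. f i \<noteq> g i)"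
      then have "f = g" using PiE_ext[OF f, of g] \<F>(2) that by auto
      then show False using \<F>(2) that by auto
    qed
    then obtain sep where sep: "\<And>g. g \<in> \<F> \<Longrightarrow> sep g \<in> I \<and> f (sep g) \<noteq> g (sep g)" by metis
    \<comment> \<open>\<open>i0\<close> keeps \<open>F\<close> nonempty when \<open>\<F>\<close> is
      empty, as membership in \<open>Q\<close> demands.\<close>
    obtain i0 where i0: "i0 \<in> I" using inf by fastforce
    define F where "F = insert i0 (sep ` \<F>)"
    have F: "F \<in> Q" using sep i0 \<F>(1) by (auto simp: F_def Q_def Fpow_def)
    have ne: "c F (restrict f F) \<noteq> c F (restrict g F)" if "g \<in> \<F>" for g
    proof
      assume "c F (restrict f F) = c F (restrict g F)"
      moreover have "g \<in> PiE I K" using that \<F>(2) by blast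
      ultimately have "restrict f F = restrict g F"
        using inj_onD[OF c(1)[OF F]] res[OF _ F] f by simp
      moreover have "sep g \<in> F" using that by (simp add: F_def)
      ultimately have "f (sep g) = g (sep g)" by (metis restrict_apply')
      then show False using sep[OF that] by simp
    qed
    have "(\<lambda>g. c F (restrict g F)) ` \<F> \<subseteq> K (\<iota> F) - {c F (restrict f F)}"
    proof (rule image_subsetI)
      fix g assume g: "g \<in> \<F>"
      then have "g \<in> PiE I K" using \<F>(2) by blast
      then show "c F (restrict g F) \<in> K (\<iota> F) - {c F (restrict f F)}"
        using ne[OF g] cK[OF _ F] by simp
    qed
    then obtain W where W: "openin X W" "W \<noteq> {}" "W \<subseteq> d" "W \<subseteq> s (\<iota> F) (c F (restrict f F))"
      "\<forall>l\<in>(\<lambda>g. c F (restrict g F)) ` \<F>. W \<inter> s (\<iota> F) l = {}"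
      by (rule indepE[OF s[OF I\<iota>[OF F]] cK[OF f F] finite_imageI[OF \<F>(1)] _ d])
    have "W \<inter> t g = {}" if g: "g \<in> \<F>" for g
    proof -
      have gP: "g \<in> PiE I K" using g \<F>(2) by blast
      have "W \<inter> s (\<iota> F') (c F' (restrict g F')) = {}" if F': "F' \<in> Q" for F'
      proof (cases "F' = F")
        case True
        then show ?thesis using W(5) g by blast
      next
        case False
        \<comment> \<open>Pieces coded for other coordinate sets live in other cells and cannot meet
          \<open>W\<close>.\<close>
        then have "\<iota> F' \<noteq> \<iota> F" using inj_on_eq_iff[OF \<iota> F' F] by simp
        then have "a (\<iota> F') \<inter> a (\<iota> F) = {}" by (rule cellularD(3)[OF cell I\<iota>[OF F'] I\<iota>[OF F]])
        moreover have "W \<subseteq> a (\<iota> F)" using W(4) piece[OF f F] by blast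
        ultimately show ?thesis using piece[OF gP F'] by blast
      qed
      then show ?thesis by (auto simp: t_def)
    qed
    moreover have "W \<subseteq> t f" using W(4) F by (auto simp: t_def)
    ultimately show "\<exists>W. openin X W \<and> W \<noteq> {} \<and> W \<subseteq> d \<inter> t f \<and> (\<forall>g\<in>\<F>. W \<inter> t g = {})"
      using W by blast
  qed
  moreover have "t f \<subseteq> \<Union>(a ` I)" if "f \<in> PiE I K" for f
    unfolding t_def using piece[OF that] I\<iota> by blast
  ultimately show ?thesis using that by blast
qed

lemma Un_not_lepoll:
  assumes "infinite I" "\<not> I \<lesssim> A" "\<not> I \<lesssim> B" shows "\<not> I \<lesssim> A \<union> B"
  using assms card_of_Un_ordLess_infinite[of I A B] by (simp add: not_lepoll_iff_ordLess)

lemma infinite_PiE: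
  assumes "i \<in> I" "\<And>i. i \<in> I \<Longrightarrow> infinite (K i)" shows "infinite (PiE I K)"
proof -
  have "K j \<noteq> {}" if "j \<in> I" for j using assms(2)[OF that] by auto
  then have "PiE I K \<noteq> {}" by (auto simp: PiE_eq_empty_iff)
  then show ?thesis using assms by (auto simp: finite_PiE_iff)
qed

lemma PiE_split_lepoll:
  assumes "I = A \<union> B" shows "PiE I K \<lesssim> PiE A K \<times> PiE B K"
  unfolding lepoll_def
proof (intro exI conjI)
  show "inj_on (\<lambda>f. (restrict f A, restrict f B)) (PiE I K)"
  proof (rule inj_onI)
    fix f g assume f: "f \<in> PiE I K" "g \<in> PiE I K"
      and eq: "(restrict f A, restrict f B) = (restrict g A, restrict g B)"
    show "f = g"
    proof (rule PiE_ext[OF f])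
      fix i assume "i \<in> I"
      then show "f i = g i" using eq assms by (metis UnE prod.inject restrict_apply')
    qed
  qed
qed (use assms in auto)

text \<open>A product of two infinite cardinals is the larger one, so the family with the larger
  index set is kept and the other one is dropped.\<close>

lemma indep_Times:
  assumes K: "indep X D s K" "\<And>k. k \<in> K \<Longrightarrow> s k \<subseteq> b" "infinite K"
    and L: "indep X D t L" "\<And>l. l \<in> L \<Longrightarrow> t l \<subseteq> b" "infinite L"
    and M: "M \<lesssim> K \<times> L"
  obtains u where "indep X D u M" "\<forall>m\<in>M. u m \<subseteq> b"
proof (cases "K \<lesssim> L")
  case True
  then have "M \<lesssim> L" using times_lepoll_infinite[OF L(3) True lepoll_refl] M lepoll_trans by blast
  then show ?thesis using indep_lepoll[OF L(1,2)] that by metis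
next
  case False
  then have "L \<lesssim> K" using lepoll_total by blast
  then have "M \<lesssim> K" using times_lepoll_infinite[OF K(3) lepoll_refl] M lepoll_trans by blast
  then show ?thesis using indep_lepoll[OF K(1,2)] that by metis
qed

text \<open>The indices that have fewer than \<open>|I|\<close> indices above them form a set \<open>Big\<close> of smaller
  cardinality, to which induction applies; the other indices satisfy the hypothesis of
  \<open>indep_PiE_uniform\<close>.\<close>
lemma indep_PiE:
  assumes "cellular X a I" "I \<noteq> {}"
    and "\<And>i. i \<in> I \<Longrightarrow> indep X D (s i) (K i)"
    and "\<And>i k. i \<in> I \<Longrightarrow> k \<in> K i \<Longrightarrow> s i k \<subseteq> a i"
    and "\<And>i. i \<in> I \<Longrightarrow> infinite (K i)"
  shows "\<exists>t. indep X D t (PiE I K) \<and> (\<forall>f\<in>PiE I K. t f \<subseteq> \<Union>(a ` I))"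
  using assms
proof (induction I rule: wf_induct_rule[OF wf_inv_image[OF wf_ordLess, where f = card_of]])
  case (1 I)
  note cell = 1(2) and s = 1(4) and sub = 1(5) and infK = 1(6)
  have IH: "\<exists>t. indep X D t (PiE J K) \<and> (\<forall>f\<in>PiE J K. t f \<subseteq> \<Union>(a ` J))"
    if J: "J \<subseteq> I" "\<not> I \<lesssim> J" "J \<noteq> {}" for J
  proof (rule 1(1))
    show "(J, I) \<in> inv_image ordLess card_of" using J(2) by (simp add: not_lepoll_iff_ordLess)
    show "cellular X a J" by (rule cellular_subset[OF cell J(1)])
    show "s i k \<subseteq> a i" if "i \<in> J" "k \<in> K i" for i k using sub J(1) that by blast
  qed (use s infK J in auto)
  show ?case
  proof (cases "finite I")
    case True
    obtain m where m: "m \<in> I" "\<And>i. i \<in> I \<Longrightarrow> K i \<lesssim> K m"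
      using finite_lepoll_max[OF True 1(3)] by metis
    have "PiE I K \<lesssim> K m" by (rule PiE_finite_lepoll[OF True infK[OF m(1)] m(2)])
    then obtain t where "indep X D t (PiE I K)" "\<And>f. f \<in> PiE I K \<Longrightarrow> t f \<subseteq> a m"
      using indep_lepoll[OF s[OF m(1)] sub[OF m(1)]] by metis
    then show ?thesis using m(1) by blast
  next
    case inf: False
    let ?G = "\<lambda>i. {j \<in> I. K i \<lesssim> K j}"
    define Big where "Big = {i \<in> I. \<not> I \<lesssim> ?G i}"
    define Rest where "Rest = I - Big"
    \<comment> \<open>An index of \<open>Big\<close> with the least factor is dominated by all of
      \<open>Big\<close>, but by definition it is dominated by fewer than \<open>|I|\<close>
      indices.\<close>
    have Big: "\<not> I \<lesssim> Big"
    proof (cases "Big = {}")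
      case True
      then show ?thesis using inf by auto
    next
      case False
      then obtain i0 where "i0 \<in> Big" by blast
      obtain A where A: "A \<in> K ` Big" "\<forall>C\<in>K ` Big. A \<lesssim> C"
        by (rule exists_minimal_lepoll[OF imageI[OF \<open>i0 \<in> Big\<close>]])
      then obtain i where i: "i \<in> Big" "A = K i" by blast
      have "Big \<subseteq> ?G i" using A(2) i(2) by (auto simp: Big_def)
      moreover have "\<not> I \<lesssim> ?G i" using i(1) by (simp add: Big_def)
      ultimately show ?thesis using subset_imp_lepoll lepoll_trans by blast
    qed
    have infR: "infinite Rest"
    proof
      assume "finite Rest"
      then have "\<not> I \<lesssim> Rest" using inf lepoll_finite by blast
      then have "\<not> I \<lesssim> Rest \<union> Big" by (rule Un_not_lepoll[OF inf _ Big])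
      moreover have "Rest \<union> Big = I" by (auto simp: Rest_def Big_def)
      ultimately show False by simp
    qed
    \<comment> \<open>Removing fewer than \<open>|I|\<close> indices from a set of size
      \<open>|I|\<close> leaves \<open>|I|\<close> of them, so an index of \<open>Rest\<close> keeps
      enough indices above it within \<open>Rest\<close>.\<close>
    have R: "Rest \<lesssim> {j \<in> Rest. K i \<lesssim> K j}" if i: "i \<in> Rest" for i
    proof (rule ccontr)
      assume c: "\<not> ?thesis"
      have "\<not> I \<lesssim> {j \<in> Rest. K i \<lesssim> K j}"
        using c subset_imp_lepoll[of Rest I] lepoll_trans by (auto simp: Rest_def)
      then have "\<not> I \<lesssim> {j \<in> Rest. K i \<lesssim> K j} \<union> Big" by (rule Un_not_lepoll[OF inf _ Big])
      moreover have "?G i \<subseteq> {j \<in> Rest. K i \<lesssim> K j} \<union> Big" by (auto simp: Rest_def)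
      moreover have "I \<lesssim> ?G i" using i by (simp add: Rest_def Big_def)
      ultimately show False using subset_imp_lepoll lepoll_trans by blast
    qed
    have RI: "Rest \<subseteq> I" by (auto simp: Rest_def)
    obtain t where t: "indep X D t (PiE Rest K)" "\<forall>f\<in>PiE Rest K. t f \<subseteq> \<Union>(a ` Rest)"
    proof (rule indep_PiE_uniform[OF cellular_subset[OF cell RI] infR _ _ _ R])
      show "indep X D (s i) (K i)" if "i \<in> Rest" for i using s RI that by blast
      show "s i k \<subseteq> a i" if "i \<in> Rest" "k \<in> K i" for i k using sub RI that by blast
      show "infinite (K i)" if "i \<in> Rest" for i using infK RI that by blast
    qed
    have t': "t f \<subseteq> \<Union>(a ` I)" if "f \<in> PiE Rest K" for f using t(2) that RI by blast
    show ?thesis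
    proof (cases "Big = {}")
      case True
      then have RestI: "Rest = I" by (simp add: Rest_def)
      from t show ?thesis unfolding RestI by blast
    next
      case False
      have BI: "Big \<subseteq> I" by (auto simp: Big_def)
      obtain u where u: "indep X D u (PiE Big K)" "\<forall>f\<in>PiE Big K. u f \<subseteq> \<Union>(a ` Big)"
        using IH[OF BI Big False] by blast
      have u': "u f \<subseteq> \<Union>(a ` I)" if "f \<in> PiE Big K" for f using u(2) that BI by blast
      obtain i where i: "i \<in> Rest" using infR by fastforce
      obtain j where j: "j \<in> Big" using False by blast
      have "I = Rest \<union> Big" by (auto simp: Rest_def Big_def)
      obtain v where "indep X D v (PiE I K)" "\<forall>f\<in>PiE I K. v f \<subseteq> \<Union>(a ` I)"
      proof (rule indep_Times[OF t(1) t' _ u(1) u' _ PiE_split_lepoll[OF \<open>I = Rest \<union> Big\<close>, of K]])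
        show "infinite (PiE Rest K)" by (rule infinite_PiE[OF i]) (use infK RI in blast)
        show "infinite (PiE Big K)" by (rule infinite_PiE[OF j]) (use infK BI in blast)
      qed
      then show ?thesis by blast
    qed
  qed
qed

subsection \<open>Regular open sets\<close>

text \<open>On open sets this is the pseudocomplement of the lattice of open sets; the regular open
  sets are the fixed points of its square.\<close>

definition perp :: "'a topology \<Rightarrow> 'a set \<Rightarrow> 'a set" where
  "perp X U = topspace X - X closure_of U"

lemma openin_perp [simp]: "openin X (perp X U)"
  by (simp add: perp_def openin_diff)

lemma subset_perp_iff: "openin X V \<Longrightarrow> V \<subseteq> perp X U \<longleftrightarrow> V \<inter> U = {}"
  using openin_Int_closure_of_eq_empty[of X V U] openin_subset[of X V] by (auto simp: perp_def)

lemma perp_Int_self: "perp X U \<inter> U = {}"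
  using subset_perp_iff[of X "perp X U" U] by simp

lemma perp_antimono: "U \<subseteq> V \<Longrightarrow> perp X V \<subseteq> perp X U"
  using closure_of_mono[of U V X] by (auto simp: perp_def)

lemma regular_opens_iff: "U \<in> regular_opens X \<longleftrightarrow> perp X (perp X U) = U"
proof -
  have "X interior_of (X closure_of U) = perp X (perp X U)"
    by (simp add: perp_def interior_of_closure_of)
  moreover have "perp X (perp X U) \<subseteq> topspace X" by (simp add: openin_subset)
  ultimately show ?thesis by (auto simp: regular_opens_def)
qed

lemma regular_opens_openin: "U \<in> regular_opens X \<Longrightarrow> openin X U"
  by (metis openin_perp regular_opens_iff)

lemma subset_perp_perp: "openin X U \<Longrightarrow> U \<subseteq> perp X (perp X U)"
  using perp_Int_self[of X U] by (simp add: subset_perp_iff Int_commute)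

lemma perp_regular [simp]: "openin X U \<Longrightarrow> perp X U \<in> regular_opens X"
  unfolding regular_opens_iff
  by (intro subset_antisym perp_antimono subset_perp_perp) auto

lemma perp_perp_disjoint:
  assumes "openin X V" "openin X U" "V \<inter> U = {}" shows "V \<inter> perp X (perp X U) = {}"
proof -
  have "V \<subseteq> perp X U" using assms by (simp add: subset_perp_iff)
  then show ?thesis using perp_Int_self[of X "perp X U"] by blast
qed

lemma subset_perp_Union_iff: "openin X V \<Longrightarrow> V \<subseteq> perp X (\<Union>E) \<longleftrightarrow> (\<forall>U\<in>E. V \<inter> U = {})"
  by (auto simp: subset_perp_iff)

text \<open>De Morgan, by which a set of regular open sets closed under the single operation
  \<open>\<lambda>E. perp X (\<Union>E)\<close> is also closed under intersections.\<close>

lemma perp_perp_Int: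
  assumes "U \<in> regular_opens X" "V \<in> regular_opens X"
  shows "perp X (\<Union>{perp X U, perp X V}) = U \<inter> V"
proof
  let ?W = "perp X (\<Union>{perp X U, perp X V})"
  have "?W \<inter> perp X U = {}" "?W \<inter> perp X V = {}"
    using subset_perp_Union_iff[of X ?W "{perp X U, perp X V}"] by auto
  then have "?W \<subseteq> perp X (perp X U)" "?W \<subseteq> perp X (perp X V)" by (simp_all add: subset_perp_iff)
  then show "?W \<subseteq> U \<inter> V" using assms by (simp add: regular_opens_iff)
  have "openin X (U \<inter> V)" using assms by (intro openin_Int regular_opens_openin)
  then show "U \<inter> V \<subseteq> ?W"
    using perp_Int_self[of X U] perp_Int_self[of X V] by (subst subset_perp_Union_iff) auto
qed

lemma regular_opens_Int:
  assumes "U \<in> regular_opens X" "V \<in> regular_opens X" shows "U \<inter> V \<in> regular_opens X"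
proof -
  have "openin X (\<Union>{perp X U, perp X V})" by (rule openin_Union) auto
  then show ?thesis using perp_perp_Int[OF assms] perp_regular by metis
qed

text \<open>If every nonempty open set contains a member of \<open>\<G>\<close>, the union of
  \<open>\<V>\<close> is dense. Local constructions are glued along such a
  \<open>\<V>\<close>.\<close>

lemma exists_maximal_disjoint:
  assumes "{} \<notin> \<G>"
  obtains \<V> where "\<V> \<subseteq> \<G>" "disjoint \<V>" "\<forall>g\<in>\<G>. \<exists>v\<in>\<V>. g \<inter> v \<noteq> {}"
proof -
  let ?S = "{\<V>. \<V> \<subseteq> \<G> \<and> disjoint \<V>}"
  have "\<Union>\<C> \<in> ?S" if C: "subset.chain ?S \<C>" for \<C>
  proof -
    have CS: "\<C> \<subseteq> ?S" using C by (simp add: subset.chain_def)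
    have "u \<inter> v = {}" if uv: "u \<in> \<Union>\<C>" "v \<in> \<Union>\<C>" "u \<noteq> v" for u v
    proof -
      obtain A B where AB: "A \<in> \<C>" "B \<in> \<C>" "u \<in> A" "v \<in> B" using uv by blast
      then have "A \<subseteq> B \<or> B \<subseteq> A" using C unfolding subset.chain_def by blast
      then obtain E where "E \<in> \<C>" "u \<in> E" "v \<in> E" using AB by blast
      moreover have "disjoint E" using CS \<open>E \<in> \<C>\<close> by blast
      ultimately show ?thesis using uv(3) by (simp add: disjoint_def)
    qed
    then show ?thesis using CS by (auto simp: disjoint_def)
  qed
  then obtain \<V> where V: "\<V> \<in> ?S" "\<forall>\<W>\<in>?S. \<V> \<subseteq> \<W> \<longrightarrow> \<W> = \<V>" using subset_Zorn'[of ?S] by blast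
  have "\<exists>v\<in>\<V>. g \<inter> v \<noteq> {}" if g: "g \<in> \<G>" for g
  proof (rule ccontr)
    assume c: "\<not> ?thesis"
    then have "insert g \<V> \<in> ?S" using V(1) g by (auto simp: disjoint_def)
    then have "g \<in> \<V>" using V(2) by blast
    then show False using c g assms by auto
  qed
  then show ?thesis using that V(1) by blast
qed

text \<open>Complete subalgebras are the sets of regular open sets closed under \<open>\<lambda>E. perp X (\<Union>E)\<close>.
  This is Vladimirov's lemma: below each \<open>a\<close> take some \<open>b\<close> outside \<open>A\<close>; it splits everything in \<open>A\<close>
  between its lower and upper projections to \<open>A\<close>, and these pieces are glued along a maximal
  disjoint family.\<close>
lemma exists_splitting:
  assumes A: "A \<subseteq> regular_opens X" and cl: "\<And>E. E \<subseteq> A \<Longrightarrow> perp X (\<Union>E) \<in> A"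
    and no: "\<And>a. a \<in> A \<Longrightarrow> a \<noteq> {} \<Longrightarrow> \<exists>b\<in>regular_opens X. b \<subseteq> a \<and> b \<notin> A"
  obtains u where "u \<in> regular_opens X"
    "\<And>a. a \<in> A \<Longrightarrow> a \<noteq> {} \<Longrightarrow> a \<inter> u \<noteq> {} \<and> a \<inter> perp X u \<noteq> {}"
proof -
  have opA: "openin X a" if "a \<in> A" for a using that A regular_opens_openin by blast
  have clP: "perp X a \<in> A" if "a \<in> A" for a using cl[of "{a}"] that by simp
  have clI: "a \<inter> b \<in> A" if "a \<in> A" "b \<in> A" for a b
  proof -
    have "perp X (\<Union>{perp X a, perp X b}) \<in> A" using clP that by (intro cl) auto
    moreover have "a \<in> regular_opens X" "b \<in> regular_opens X" using that A by auto
    ultimately show ?thesis by (simp only: perp_perp_Int)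
  qed
  have pp: "perp X (perp X a) = a" if "a \<in> A" for a using that A by (auto simp: regular_opens_iff)
  define spl where "spl b c \<longleftrightarrow> b \<in> regular_opens X \<and> b \<subseteq> c \<and>
    (\<forall>a\<in>A. a \<noteq> {} \<longrightarrow> a \<subseteq> c \<longrightarrow> a \<inter> b \<noteq> {} \<and> a \<inter> perp X b \<noteq> {})" for b c
  define C where "C = {c \<in> A. c \<noteq> {} \<and> (\<exists>b. spl b c)}"
  have dense: "\<exists>c\<in>C. c \<subseteq> a" if a: "a \<in> A" "a \<noteq> {}" for a
  proof -
    obtain b where b: "b \<in> regular_opens X" "b \<subseteq> a" "b \<notin> A" using no[OF a] by blast
    have opb: "openin X b" and ppb: "perp X (perp X b) = b"
      using b(1) by (simp_all add: regular_opens_openin regular_opens_iff)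
    \<comment> \<open>\<open>p\<close> is the least member of \<open>A\<close> above
      \<open>b\<close>, and \<open>perp X l\<close> is the greatest one below it. On their
      difference, the set \<open>c\<close> below, every nonempty member of \<open>A\<close> is cut
      by \<open>b\<close>.\<close>
    define l where "l = perp X (\<Union>{a'\<in>A. a' \<subseteq> b})"
    define p where "p = perp X (\<Union>{a'\<in>A. a' \<inter> b = {}})"
    have lA: "l \<in> A" and pA: "p \<in> A" unfolding l_def p_def by (auto intro: cl)
    have bp: "b \<subseteq> p" unfolding p_def using opb by (auto simp: subset_perp_Union_iff)
    have "perp X b \<inter> \<Union>{a'\<in>A. a' \<subseteq> b} = {}" using perp_Int_self[of X b] by blast
    then have "perp X b \<subseteq> l" unfolding l_def by (simp add: subset_perp_iff)
    then have lb: "perp X l \<subseteq> b" using perp_antimono[of "perp X b" l X] ppb by simp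
    define c where "c = p \<inter> l"
    have cA: "c \<in> A" unfolding c_def by (rule clI[OF pA lA])
    have "c \<noteq> {}"
    proof
      assume "c = {}"
      then have "p \<subseteq> perp X l" using subset_perp_iff[OF opA[OF pA]] by (simp add: c_def)
      then have "b = p" using bp lb by blast
      then show False using pA b(3) by simp
    qed
    have "p \<subseteq> a"
    proof -
      have "perp X a \<inter> b = {}" using perp_Int_self[of X a] b(2) by blast
      then have "perp X a \<in> {a'\<in>A. a' \<inter> b = {}}" using clP[OF a(1)] by simp
      then have "perp X (perp X a) \<supseteq> p" unfolding p_def by (intro perp_antimono) blast
      then show ?thesis using pp[OF a(1)] by simp
    qed
    moreover have "spl (b \<inter> c) c"
      unfolding spl_def
    proof (intro conjI ballI impI)
      show "b \<inter> c \<in> regular_opens X" using b(1) cA A regular_opens_Int by blast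
      fix a' assume a': "a' \<in> A" "a' \<noteq> {}" "a' \<subseteq> c"
      show "a' \<inter> (b \<inter> c) \<noteq> {}"
      proof
        assume "a' \<inter> (b \<inter> c) = {}"
        then have "a' \<inter> b = {}" using a'(3) by blast
        then have "p \<inter> a' = {}"
          using a'(1) subset_perp_Union_iff[of X p "{a'\<in>A. a' \<inter> b = {}}"] unfolding p_def by auto
        then show False using a'(2,3) by (auto simp: c_def)
      qed
      show "a' \<inter> perp X (b \<inter> c) \<noteq> {}"
      proof
        assume "a' \<inter> perp X (b \<inter> c) = {}"
        then have "a' \<subseteq> perp X (perp X (b \<inter> c))" using subset_perp_iff[OF opA[OF a'(1)]] by blast
        also have "\<dots> \<subseteq> perp X (perp X b)" by (intro perp_antimono) blast
        finally have "a' \<subseteq> b" using ppb by simp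
        then have "l \<inter> a' = {}"
          using a'(1) subset_perp_Union_iff[of X l "{a'\<in>A. a' \<subseteq> b}"] unfolding l_def by auto
        then show False using a'(2,3) by (auto simp: c_def)
      qed
    qed auto
    ultimately show ?thesis using cA \<open>c \<noteq> {}\<close> unfolding C_def by (intro bexI[of _ c]) (auto simp: c_def)
  qed
  have "{} \<notin> C" by (simp add: C_def)
  then obtain \<V> where \<V>: "\<V> \<subseteq> C" "disjoint \<V>" "\<forall>g\<in>C. \<exists>v\<in>\<V>. g \<inter> v \<noteq> {}"
    by (rule exists_maximal_disjoint)
  have "\<exists>b. spl b c" if "c \<in> \<V>" for c using that \<V>(1) by (auto simp: C_def)
  then obtain \<beta> where \<beta>: "\<And>c. c \<in> \<V> \<Longrightarrow> spl (\<beta> c) c" by metis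
  have op\<beta>: "openin X (\<beta> c)" "\<beta> c \<subseteq> c" if "c \<in> \<V>" for c
    using \<beta>[OF that] regular_opens_openin by (auto simp: spl_def)
  define u0 where "u0 = \<Union>(\<beta> ` \<V>)"
  have opu: "openin X u0" unfolding u0_def using op\<beta>(1) by (intro openin_Union) auto
  define u where "u = perp X (perp X u0)"
  have "a \<inter> u \<noteq> {} \<and> a \<inter> perp X u \<noteq> {}" if a: "a \<in> A" "a \<noteq> {}" for a
  proof -
    obtain c' where c': "c' \<in> C" "c' \<subseteq> a" using dense[OF a] by blast
    obtain c where c: "c \<in> \<V>" "c' \<inter> c \<noteq> {}" using \<V>(3) c'(1) by blast
    have cA: "c \<in> A" using c(1) \<V>(1) by (auto simp: C_def)
    have "a \<inter> c \<noteq> {}" "a \<inter> c \<in> A" using c(2) c'(2) clI[OF a(1) cA] by auto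
    then have split: "(a \<inter> c) \<inter> \<beta> c \<noteq> {}" "(a \<inter> c) \<inter> perp X (\<beta> c) \<noteq> {}"
      using \<beta>[OF c(1)] by (auto simp: spl_def)
    have "\<beta> c \<subseteq> u" using c(1) subset_perp_perp[OF opu] by (auto simp: u_def u0_def)
    define W where "W = (a \<inter> c) \<inter> perp X (\<beta> c)"
    have opW: "openin X W" unfolding W_def using opA[OF a(1)] opA[OF cA] by (intro openin_Int) auto
    have "W \<inter> \<beta> d = {}" if d: "d \<in> \<V>" for d
    proof (cases "d = c")
      case True
      then show ?thesis using perp_Int_self[of X "\<beta> c"] by (auto simp: W_def)
    next
      case False
      then have "d \<inter> c = {}" using \<V>(2) d c(1) by (auto simp: disjoint_def)
      then show ?thesis using op\<beta>(2)[OF d] by (auto simp: W_def)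
    qed
    then have "W \<inter> u0 = {}" by (auto simp: u0_def)
    then have "W \<inter> u = {}" unfolding u_def by (rule perp_perp_disjoint[OF opW opu])
    then have "W \<subseteq> perp X u" using opW by (simp add: subset_perp_iff)
    moreover have "W \<noteq> {}" "W \<subseteq> a" using split(2) by (auto simp: W_def)
    ultimately show ?thesis using split(1) \<open>\<beta> c \<subseteq> u\<close> by blast
  qed
  moreover have "u \<in> regular_opens X" by (simp add: u_def)
  ultimately show ?thesis using that by blast
qed

subsection \<open>Disjoint refinements and infinitary closures\<close>

text \<open>A block \<open>v\<close> is a union of many disjoint pieces such that every \<open>d q\<close> either misses \<open>v\<close> or meets
  at least \<open>|Q|\<close> of the pieces. Blocks are dense, so one can distribute the \<open>d q\<close> over the blocks of
  a maximal disjoint family and choose distinct pieces within each block.\<close>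
lemma disjoint_refinement:
  fixes d :: "'q \<Rightarrow> 'a set" and P :: "'p set"
  assumes Q: "infinite Q" and d: "\<And>q. q \<in> Q \<Longrightarrow> openin X (d q) \<and> d q \<noteq> {}"
    and P: "\<not> P \<lesssim> Q"
    and cel: "\<And>c. openin X c \<Longrightarrow> c \<noteq> {} \<Longrightarrow> \<exists>a. cellular X a P \<and> (\<forall>p\<in>P. a p \<subseteq> c)"
  obtains e where "cellular X e Q" "\<forall>q\<in>Q. e q \<subseteq> d q"
proof -
  define pieces where "pieces v c P' \<longleftrightarrow> cellular X c P' \<and> P' \<noteq> {} \<and> v = \<Union>(c ` P') \<and>
    (\<forall>q\<in>Q. d q \<inter> v = {} \<or> Q \<lesssim> {p\<in>P'. d q \<inter> c p \<noteq> {}})" for v c and P' :: "'p set"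
  define \<G> where "\<G> = {v. \<exists>c P'. pieces v c P'}"
  have block: "\<exists>v\<in>\<G>. v \<subseteq> g" if g: "openin X g" "g \<noteq> {}" for g
  proof -
    obtain a where a: "cellular X a P" "\<forall>p\<in>P. a p \<subseteq> g" using cel[OF g] by blast
    define H where "H q = {p\<in>P. d q \<inter> a p \<noteq> {}}" for q
    \<comment> \<open>\<open>R\<close> collects the pieces met by some \<open>d q\<close> that meets
      at most \<open>|Q|\<close> of them. There are at most \<open>|Q|\<close> such pieces, so after
      their removal every \<open>d q\<close> meets either no piece or more than \<open>|Q|\<close>
      of them.\<close>
    define R where "R = (\<Union>q\<in>{q\<in>Q. H q \<lesssim> Q}. H q)"
    have RQ: "R \<lesssim> Q"
      unfolding R_def by (rule UN_lepoll_infinite[OF Q]) (auto intro: subset_imp_lepoll)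
    have big: "\<not> B - R \<lesssim> Q" if "\<not> B \<lesssim> Q" for B
    proof
      assume "B - R \<lesssim> Q"
      then have "(B - R) \<union> R \<lesssim> Q" by (rule Un_lepoll_infinite[OF Q _ RQ])
      moreover have "B \<subseteq> (B - R) \<union> R" by blast
      ultimately show False using that subset_imp_lepoll lepoll_trans by blast
    qed
    define v where "v = \<Union>(a ` (P - R))"
    have "pieces v a (P - R)"
      unfolding pieces_def
    proof (intro conjI ballI)
      show "cellular X a (P - R)" by (rule cellular_subset[OF a(1)]) blast
      show "P - R \<noteq> {}" using big[OF P] empty_lepoll by metis
      fix q assume q: "q \<in> Q"
      show "d q \<inter> v = {} \<or> Q \<lesssim> {p\<in>P - R. d q \<inter> a p \<noteq> {}}"
      proof (cases "H q \<lesssim> Q")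
        case True
        then have "H q \<subseteq> R" using q by (auto simp: R_def)
        then show ?thesis by (auto simp: H_def v_def)
      next
        case False
        have "{p\<in>P - R. d q \<inter> a p \<noteq> {}} = H q - R" by (auto simp: H_def)
        then show ?thesis using big[OF False] lepoll_total by metis
      qed
    qed (simp add: v_def)
    moreover have "v \<subseteq> g" using a(2) by (auto simp: v_def)
    ultimately show ?thesis by (auto simp: \<G>_def)
  qed
  have "{} \<notin> \<G>" using cellularD(2) by (fastforce simp: \<G>_def pieces_def)
  then obtain \<V> where \<V>: "\<V> \<subseteq> \<G>" "disjoint \<V>" "\<forall>g\<in>\<G>. \<exists>v\<in>\<V>. g \<inter> v \<noteq> {}"
    by (rule exists_maximal_disjoint)
  have "\<exists>v\<in>\<V>. d q \<inter> v \<noteq> {}" if q: "q \<in> Q" for q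
  proof -
    obtain g where g: "g \<in> \<G>" "g \<subseteq> d q" using block d[OF q] by blast
    then show ?thesis using \<V>(3) by blast
  qed
  then obtain w where w: "\<And>q. q \<in> Q \<Longrightarrow> w q \<in> \<V>" "\<And>q. q \<in> Q \<Longrightarrow> d q \<inter> w q \<noteq> {}" by metis
  have "\<forall>v\<in>\<V>. \<exists>c P'. pieces v c P'" using \<V>(1) by (auto simp: \<G>_def)
  then obtain c P' where cP: "\<And>v. v \<in> \<V> \<Longrightarrow> pieces v (c v) (P' v)" by metis
  have "\<forall>v\<in>\<V>. \<exists>\<pi>. inj_on \<pi> {q\<in>Q. w q = v} \<and> (\<forall>q\<in>Q. w q = v \<longrightarrow> \<pi> q \<in> P' v \<and> d q \<inter> c v (\<pi> q) \<noteq> {})"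
  proof
    fix v assume v: "v \<in> \<V>"
    have "{q\<in>Q. w q = v} \<lesssim> {p\<in>P' v. d q \<inter> c v p \<noteq> {}}" if q: "q \<in> {q\<in>Q. w q = v}" for q
    proof -
      have "Q \<lesssim> {p\<in>P' v. d q \<inter> c v p \<noteq> {}}" using cP[OF v] q w(2) by (auto simp: pieces_def)
      moreover have "{q\<in>Q. w q = v} \<lesssim> Q" by (auto intro: subset_imp_lepoll)
      ultimately show ?thesis using lepoll_trans by blast
    qed
    then obtain \<pi> where "inj_on \<pi> {q\<in>Q. w q = v}"
      "\<forall>q\<in>{q\<in>Q. w q = v}. \<pi> q \<in> {p\<in>P' v. d q \<inter> c v p \<noteq> {}}"
      by (rule injective_choice)
    then show "\<exists>\<pi>. inj_on \<pi> {q\<in>Q. w q = v} \<and> (\<forall>q\<in>Q. w q = v \<longrightarrow> \<pi> q \<in> P' v \<and> d q \<inter> c v (\<pi> q) \<noteq> {})"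
      by (intro exI[of _ \<pi>]) auto
  qed
  from bchoice[OF this] obtain \<pi> where
    \<pi>0: "\<forall>v\<in>\<V>. inj_on (\<pi> v) {q\<in>Q. w q = v} \<and> (\<forall>q\<in>Q. w q = v \<longrightarrow> \<pi> v q \<in> P' v \<and> d q \<inter> c v (\<pi> v q) \<noteq> {})" ..
  then have \<pi>: "\<And>v. v \<in> \<V> \<Longrightarrow> inj_on (\<pi> v) {q\<in>Q. w q = v}"
    "\<And>v q. v \<in> \<V> \<Longrightarrow> q \<in> Q \<Longrightarrow> w q = v \<Longrightarrow> \<pi> v q \<in> P' v \<and> d q \<inter> c v (\<pi> v q) \<noteq> {}"
    by simp_all
  define e where "e q = d q \<inter> c (w q) (\<pi> (w q) q)" for q
  have mem: "\<pi> (w q) q \<in> P' (w q)" if "q \<in> Q" for q using \<pi>(2)[OF w(1)[OF that] that] by blast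
  have cellc: "cellular X (c (w q)) (P' (w q))" if "q \<in> Q" for q
    using cP[OF w(1)[OF that]] by (simp add: pieces_def)
  have "cellular X e Q"
  proof (rule cellularI)
    fix q assume q: "q \<in> Q"
    show "openin X (e q)"
      unfolding e_def using d[OF q] cellularD(1)[OF cellc[OF q] mem[OF q]] by auto
    show "e q \<noteq> {}" unfolding e_def using \<pi>(2)[OF w(1)[OF q] q] by blast
  next
    fix q q' assume q: "q \<in> Q" "q' \<in> Q" "q \<noteq> q'"
    show "e q \<inter> e q' = {}"
    proof (cases "w q = w q'")
      case True
      have "\<pi> (w q) q \<noteq> \<pi> (w q) q'"
        using inj_onD[OF \<pi>(1)[OF w(1)[OF q(1)]], of q q'] q True by auto
      then have "c (w q) (\<pi> (w q) q) \<inter> c (w q) (\<pi> (w q) q') = {}"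
        using cellularD(3)[OF cellc[OF q(1)]] mem[OF q(1)] mem[OF q(2)] True by simp
      then show ?thesis using True by (auto simp: e_def)
    next
      case False
      then have "w q \<inter> w q' = {}" using \<V>(2) w(1) q by (auto simp: disjoint_def)
      moreover have "e r \<subseteq> w r" if "r \<in> Q" for r
        using cP[OF w(1)[OF that]] mem[OF that] by (auto simp: e_def pieces_def)
      ultimately show ?thesis using q by blast
    qed
  qed
  then show ?thesis by (rule that) (auto simp: e_def)
qed

text \<open>The \<open>i\<close>-th stage of closing \<open>G\<close> under \<open>f\<close>, where
  a step may use only elements of strictly earlier stages; the inductive predicate takes the place
  of a transfinite recursion along \<open>r\<close>.\<close>

inductive level :: "'t rel \<Rightarrow> 'b set \<Rightarrow> ('b set \<Rightarrow> bool) \<Rightarrow> ('b set \<Rightarrow> 'b) \<Rightarrow> 't \<Rightarrow> 'b \<Rightarrow> bool"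
  for r G S f where
  base: "x \<in> G \<Longrightarrow> level r G S f i x"
| step: "S E \<Longrightarrow> (\<And>x. x \<in> E \<Longrightarrow> \<exists>j\<in>underS r i. level r G S f j x) \<Longrightarrow> level r G S f i (f E)"

text \<open>The closure ends after \<open>|\<Theta>|\<close> stages: by regularity
  (\<open>reg\<close>) a subset of fewer than \<open>|\<Theta>|\<close> elements is contained in the
  stages before some \<open>i\<close>, so its value appears at stage \<open>i\<close>. A stage stays
  within \<open>|C|\<close> because \<open>count\<close> bounds the number of sets to which
  \<open>f\<close> is applied.\<close>

lemma closure_lepoll:
  fixes \<Theta> :: "'t set" and G :: "'b set" and C :: "'c set" and f :: "'b set \<Rightarrow> 'b"
  assumes C: "infinite C" "G \<lesssim> C" "\<Theta> \<lesssim> C" and \<Theta>: "infinite \<Theta>"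
    and reg: "\<And>J (A :: 't \<Rightarrow> 't set). \<not> \<Theta> \<lesssim> J \<Longrightarrow> J \<subseteq> \<Theta> \<Longrightarrow> (\<And>j. j \<in> J \<Longrightarrow> \<not> \<Theta> \<lesssim> A j) \<Longrightarrow> \<not> \<Theta> \<lesssim> \<Union>(A ` J)"
    and count: "\<And>Z::'b set. Z \<lesssim> C \<Longrightarrow> {E. E \<subseteq> Z \<and> \<not> \<Theta> \<lesssim> E} \<lesssim> C"
  obtains A where "G \<subseteq> A" "A \<lesssim> C" "\<forall>E. E \<subseteq> A \<longrightarrow> \<not> \<Theta> \<lesssim> E \<longrightarrow> f E \<in> A"
proof -
  let ?r = "|\<Theta>|"
  let ?S = "\<lambda>E::'b set. \<not> \<Theta> \<lesssim> E"
  have wo: "Well_order ?r" by (rule card_of_Well_order)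
  have wf: "wf (?r - Id)" using wo by (simp add: well_order_on_def)
  have tot: "Total ?r" using wo by (simp add: well_order_on_def linear_order_on_def)
  define L where "L i = {x. level ?r G ?S f i x}" for i
  have uS: "underS ?r i \<subseteq> \<Theta>" for i
    using FieldI1 unfolding underS_def by (metis (no_types, lifting) Field_card_of mem_Collect_eq subsetI)
  have L: "L i \<lesssim> C" for i
  proof (induction i rule: wf_induct_rule[OF wf])
    case (1 i)
    let ?Z = "\<Union>j\<in>underS ?r i. L j"
    have "underS ?r i \<lesssim> C" by (rule lepoll_trans[OF subset_imp_lepoll[OF uS] C(3)])
    moreover have "L j \<lesssim> C" if "j \<in> underS ?r i" for j
      by (rule 1) (use that in \<open>simp add: underS_def\<close>)
    ultimately have "?Z \<lesssim> C" by (rule UN_lepoll_infinite[OF C(1)])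
    then have *: "{E. E \<subseteq> ?Z \<and> ?S E} \<lesssim> C" by (rule count)
    have "L i \<subseteq> G \<union> f ` {E. E \<subseteq> ?Z \<and> ?S E}"
    proof
      fix x assume "x \<in> L i"
      then have "level ?r G ?S f i x" by (simp add: L_def)
      then show "x \<in> G \<union> f ` {E. E \<subseteq> ?Z \<and> ?S E}"
      proof cases
        case (step E)
        have "E \<subseteq> ?Z" using step(3) by (auto simp: L_def)
        then show ?thesis using step(1,2) by auto
      qed auto
    qed
    then have "L i \<lesssim> G \<union> f ` {E. E \<subseteq> ?Z \<and> ?S E}" by (rule subset_imp_lepoll)
    also have "\<dots> \<lesssim> C"
      by (rule Un_lepoll_infinite[OF C(1,2) lepoll_trans[OF image_lepoll *]])
    finally show ?case .
  qed
  define A where "A = (\<Union>i\<in>\<Theta>. L i)"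
  have small_under: "\<not> \<Theta> \<lesssim> under ?r j" if j: "j \<in> \<Theta>" for j
  proof -
    have "|underS ?r j| <o ?r" using card_of_underS[OF card_of_Card_order, of j \<Theta>] j by (simp add: Field_card_of)
    then have "\<not> \<Theta> \<lesssim> underS ?r j" by (simp add: not_lepoll_iff_ordLess)
    moreover have "\<not> \<Theta> \<lesssim> {j}" using \<Theta> lepoll_finite by blast
    ultimately have "\<not> \<Theta> \<lesssim> underS ?r j \<union> {j}" by (rule Un_not_lepoll[OF \<Theta>])
    moreover have "under ?r j \<subseteq> underS ?r j \<union> {j}" by (auto simp: under_def underS_def)
    ultimately show ?thesis using subset_imp_lepoll lepoll_trans by blast
  qed
  have closed: "f E \<in> A" if E: "E \<subseteq> A" "?S E" for E
  proof -
    have "\<exists>i\<in>\<Theta>. x \<in> L i" if "x \<in> E" for x using that E(1) by (auto simp: A_def)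
    then obtain l where l: "\<And>x. x \<in> E \<Longrightarrow> l x \<in> \<Theta> \<and> x \<in> L (l x)" by metis
    have J: "\<not> \<Theta> \<lesssim> l ` E" "l ` E \<subseteq> \<Theta>" 
      using E(2) lepoll_trans[OF _ image_lepoll[of l E]] l by blast+
    have "\<not> \<Theta> \<lesssim> \<Union>(under ?r ` (l ` E))"
      by (rule reg[OF J]) (use J(2) small_under in blast)
    then have "\<not> \<Theta> \<subseteq> \<Union>(under ?r ` (l ` E))" using subset_imp_lepoll by blast
    then obtain i where i: "i \<in> \<Theta>" "\<forall>x\<in>E. i \<notin> under ?r (l x)" by blast
    have "l x \<in> underS ?r i" if "x \<in> E" for x
    proof -
      have "(i, l x) \<notin> ?r" using i(2) that by (auto simp: under_def)
      moreover have "refl_on \<Theta> ?r" using wo card_of_well_order_on[of \<Theta>] by (simp add: order_on_defs)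
      then have "(i, i) \<in> ?r" using i(1) by (auto dest: refl_onD)
      ultimately show ?thesis
        using tot l[OF that] i(1) unfolding total_on_def Field_card_of underS_def by fastforce
    qed
    then have "level ?r G ?S f i (f E)"
      using l E(2) by (intro level.step) (auto simp: L_def)
    then show ?thesis using i(1) by (auto simp: A_def L_def)
  qed
  moreover have "A \<lesssim> C" unfolding A_def by (rule UN_lepoll_infinite[OF C(1,3) L])
  moreover have "G \<subseteq> A"
  proof -
    obtain i where "i \<in> \<Theta>" using \<Theta> by fastforce
    then show ?thesis by (auto simp: A_def L_def intro: level.base)
  qed
  ultimately show ?thesis using that by blast
qed

subsection \<open>Homogeneous spaces\<close>

lemma underS_card_of_subset: "underS |A| i \<subseteq> A"
  using FieldI1 unfolding underS_def by (metis (no_types, lifting) Field_card_of mem_Collect_eq subsetI)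

lemma lepoll_underS:
  assumes "\<not> A \<lesssim> N" obtains a where "a \<in> A" "N \<lesssim> underS |A| a"
proof -
  have "|N| <o |A|" using assms by (simp add: not_lepoll_iff_ordLess)
  then obtain a where a: "a \<in> A" "|N| =o Restr |A| (underS |A| a)"
    using ordLess_iff_ordIso_Restr[OF card_of_Well_order card_of_Well_order, of N A]
    by (auto simp: Field_card_of)
  have "|Field |N| | =o |Field (Restr |A| (underS |A| a))|" by (rule card_of_cong[OF a(2)])
  then have "N \<lesssim> Field (Restr |A| (underS |A| a))"
    by (simp add: Field_card_of eqpoll_iff_card_of_ordIso[symmetric] eqpoll_imp_lepoll)
  also have "\<dots> \<lesssim> underS |A| a" by (intro subset_imp_lepoll) (auto simp: Field_def)
  finally show ?thesis using a(1) that by blast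
qed

text \<open>\<open>\<Theta>\<close> stands for the saturation of \<open>X\<close>, a cardinal
  represented by a set of arbitrary type. Neither it nor the number of regular open sets gets
  smaller in a part of the space. Throughout, \<open>\<not> \<Theta> \<lesssim> E\<close> reads as
  smallness of \<open>E\<close>.\<close>

locale homogeneous_space =
  fixes X :: "'a topology" and \<Theta> :: "'t set"
  assumes infinite_regular_opens: "infinite (regular_opens X)"
    and regular_opens_lepoll: "\<And>c. c \<in> regular_opens X \<Longrightarrow> c \<noteq> {} \<Longrightarrow> regular_opens X \<lesssim> {U \<in> regular_opens X. U \<subseteq> c}"
    and cellular_below': "\<And>c J. openin X c \<Longrightarrow> c \<noteq> {} \<Longrightarrow> J \<subseteq> \<Theta> \<Longrightarrow> \<not> \<Theta> \<lesssim> J \<Longrightarrow>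
          \<exists>a. cellular X a J \<and> (\<forall>j\<in>J. a j \<subseteq> c)"
    and not_cellular: "\<not> cellular X a \<Theta>"
begin

lemma cellular_small: 
  assumes "cellular X a E" shows "\<not> \<Theta> \<lesssim> E"
proof
  assume "\<Theta> \<lesssim> E"
  then obtain f where "inj_on f \<Theta>" "f ` \<Theta> \<subseteq> E" by (rule lepollE)
  from cellular_comp[OF assms this] show False using not_cellular by blast
qed

lemma cellular_below:
  assumes E: "\<not> \<Theta> \<lesssim> E" and c: "openin X c" "c \<noteq> {}"
  obtains a where "cellular X a E" "\<forall>e\<in>E. a e \<subseteq> c"
proof -
  have "E \<lesssim> \<Theta>" using E lepoll_total by blast
  then obtain f where f: "inj_on f E" "f ` E \<subseteq> \<Theta>" by (rule lepollE)
  have "\<not> \<Theta> \<lesssim> f ` E" using E lepoll_trans[OF _ image_lepoll[of f E]] by blast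
  then obtain a where a: "cellular X a (f ` E)" "\<forall>j\<in>f ` E. a j \<subseteq> c"
    using cellular_below'[OF c f(2)] by blast
  show ?thesis
    by (rule that[OF cellular_comp[OF a(1) f(1)]]) (use a(2) in auto)
qed

lemma topspace_nonempty: "topspace X \<noteq> {}"
proof
  assume "topspace X = {}"
  then have "regular_opens X \<subseteq> {{}}" by (auto simp: regular_opens_def)
  then show False using infinite_regular_opens finite_subset by blast
qed

lemma topspace_regular: "topspace X \<in> regular_opens X"
  using perp_regular[of X "{}"] by (simp add: perp_def)

text \<open>Regularity of the saturation: an antichain indexed by \<open>A j\<close> placed inside
  the \<open>j\<close>-th member of an antichain indexed by \<open>J\<close>, for all
  \<open>j\<close>, makes an antichain indexed by \<open>Sigma J A\<close>.\<close>

lemma small_Sigma: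
  assumes J: "\<not> \<Theta> \<lesssim> J" and A: "\<And>j. j \<in> J \<Longrightarrow> \<not> \<Theta> \<lesssim> A j"
  shows "\<not> \<Theta> \<lesssim> Sigma J A"
proof -
  obtain a where a: "cellular X a J" "\<forall>j\<in>J. a j \<subseteq> topspace X"
    by (rule cellular_below[OF J openin_topspace topspace_nonempty])
  note a = a(1)
  have "\<forall>j\<in>J. \<exists>b. cellular X b (A j) \<and> (\<forall>x\<in>A j. b x \<subseteq> a j)"
  proof
    fix j assume j: "j \<in> J"
    obtain b where "cellular X b (A j)" "\<forall>x\<in>A j. b x \<subseteq> a j"
      by (rule cellular_below[OF A[OF j] cellularD(1,2)[OF a j]])
    then show "\<exists>b. cellular X b (A j) \<and> (\<forall>x\<in>A j. b x \<subseteq> a j)" by blast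
  qed
  from bchoice[OF this] obtain b where
    b: "\<forall>j\<in>J. cellular X (b j) (A j) \<and> (\<forall>x\<in>A j. b j x \<subseteq> a j)" ..
  have bj: "cellular X (b j) (A j)" "\<And>x. x \<in> A j \<Longrightarrow> b j x \<subseteq> a j" if "j \<in> J" for j
    using b that by auto
  have "cellular X (\<lambda>(j,x). b j x) (Sigma J A)"
  proof (rule cellularI)
    fix p q assume p: "p \<in> Sigma J A" "q \<in> Sigma J A" "p \<noteq> q"
    obtain j x where jx: "p = (j, x)" "j \<in> J" "x \<in> A j" using p(1) by blast
    obtain k y where ky: "q = (k, y)" "k \<in> J" "y \<in> A k" using p(2) by blast
    have "b j x \<inter> b k y = {}"
    proof (cases "j = k")
      case True
      then show ?thesis using cellularD(3)[OF bj(1)[OF jx(2)], of x y] jx ky p(3) by auto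
    next
      case False
      then have "a j \<inter> a k = {}" by (rule cellularD(3)[OF a jx(2) ky(2)])
      then show ?thesis using bj(2)[OF jx(2,3)] bj(2)[OF ky(2,3)] by blast
    qed
    then show "(case p of (j,x) \<Rightarrow> b j x) \<inter> (case q of (j,x) \<Rightarrow> b j x) = {}" by (simp add: jx(1) ky(1))
  qed (use bj(1) cellularD(1,2) in fastforce)+
  then show ?thesis by (rule cellular_small)
qed

lemma small_UN:
  assumes "\<not> \<Theta> \<lesssim> J" "\<And>j. j \<in> J \<Longrightarrow> \<not> \<Theta> \<lesssim> A j"
  shows "\<not> \<Theta> \<lesssim> \<Union>(A ` J)"
proof
  assume "\<Theta> \<lesssim> \<Union>(A ` J)"
  also have "\<Union>(A ` J) \<lesssim> Sigma J A" by (rule subset_image_lepoll[of _ snd]) force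
  finally show False using small_Sigma[of J A] assms by blast
qed

lemma small_lepoll: "E \<lesssim> F \<Longrightarrow> \<not> \<Theta> \<lesssim> F \<Longrightarrow> \<not> \<Theta> \<lesssim> E"
  using lepoll_trans by blast

lemma split_regular:
  assumes c: "c \<in> regular_opens X" "c \<noteq> {}"
  shows "\<exists>U\<in>regular_opens X. U \<noteq> {} \<and> U \<subseteq> c \<and> c \<inter> perp X U \<noteq> {}"
proof -
  have "infinite {U \<in> regular_opens X. U \<subseteq> c}"
    using regular_opens_lepoll[OF c] infinite_regular_opens lepoll_finite by blast
  then have "\<not> {U \<in> regular_opens X. U \<subseteq> c} \<subseteq> {{}, c}" using finite_subset by blast
  then obtain U where U: "U \<in> regular_opens X" "U \<subseteq> c" "U \<noteq> {}" "U \<noteq> c" by blast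
  have "c \<inter> perp X U \<noteq> {}"
  proof
    assume "c \<inter> perp X U = {}"
    then have "c \<subseteq> perp X (perp X U)" using subset_perp_iff[OF regular_opens_openin[OF c(1)]] by blast
    then show False using U by (simp add: regular_opens_iff)
  qed
  then show ?thesis using U by blast
qed

text \<open>The saturation is uncountable: from the remainder \<open>s n\<close> a nonempty part
  \<open>f (s n)\<close> is cut off in such a way that something remains, and the parts form an
  infinite antichain.\<close>

lemma small_nat: "\<not> \<Theta> \<lesssim> (UNIV :: nat set)"
proof -
  have "\<forall>c\<in>{c\<in>regular_opens X. c \<noteq> {}}. \<exists>U. U \<in> regular_opens X \<and> U \<noteq> {} \<and> U \<subseteq> c \<and> c \<inter> perp X U \<noteq> {}"
    using split_regular by (simp add: Bex_def)
  from bchoice[OF this] obtain f where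
    f: "\<forall>c\<in>{c\<in>regular_opens X. c \<noteq> {}}. f c \<in> regular_opens X \<and> f c \<noteq> {} \<and> f c \<subseteq> c \<and> c \<inter> perp X (f c) \<noteq> {}" ..
  define s where "s n = ((\<lambda>c. c \<inter> perp X (f c)) ^^ n) (topspace X)" for n
  have sS: "s (Suc n) = s n \<inter> perp X (f (s n))" for n by (simp add: s_def)
  have s: "s n \<in> {c\<in>regular_opens X. c \<noteq> {}}" for n
  proof (induction n)
    case 0
    then show ?case using topspace_regular topspace_nonempty by (simp add: s_def)
  next
    case (Suc n)
    have 1: "f (s n) \<in> regular_opens X" "s n \<inter> perp X (f (s n)) \<noteq> {}" using f Suc by auto
    have "s n \<in> regular_opens X" using Suc by simp
    then have "s n \<inter> perp X (f (s n)) \<in> regular_opens X"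
      by (intro regular_opens_Int perp_regular regular_opens_openin 1)
    then show ?case using 1 unfolding sS by simp
  qed
  have anti: "s n \<subseteq> s m" if "m \<le> n" for m n
    using that by (induction rule: dec_induct) (auto simp: sS)
  have fs: "f (s n) \<in> regular_opens X" "f (s n) \<noteq> {}" "f (s n) \<subseteq> s n" for n using f s[of n] by auto
  have disj: "f (s m) \<inter> f (s n) = {}" if "m < n" for m n
  proof -
    have "f (s n) \<subseteq> s (Suc m)" using fs(3)[of n] anti[of "Suc m" n] that by auto
    then show ?thesis using perp_Int_self[of X "f (s m)"] by (auto simp: sS)
  qed
  have "cellular X (\<lambda>n. f (s n)) UNIV"
  proof (rule cellularI)
    show "f (s m) \<inter> f (s n) = {}" if "m \<noteq> n" for m n
    proof (cases "m < n")
      case False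
      then have "n < m" using that by simp
      then show ?thesis using disj[of n m] by blast
    qed (rule disj)
  qed (simp_all add: fs regular_opens_openin[OF fs(1)])
  then show ?thesis by (rule cellular_small)
qed

lemma infinite_\<Theta>: "infinite \<Theta>"
  using small_nat finite_lepoll_infinite[OF infinite_UNIV_nat] by blast

lemma small_finite: "finite E \<Longrightarrow> \<not> \<Theta> \<lesssim> E"
  using infinite_\<Theta> lepoll_finite by blast

lemma small_Un: "\<not> \<Theta> \<lesssim> A \<Longrightarrow> \<not> \<Theta> \<lesssim> B \<Longrightarrow> \<not> \<Theta> \<lesssim> A \<union> B"
  by (rule Un_not_lepoll[OF infinite_\<Theta>])

lemma small_Fpow:
  assumes "\<not> \<Theta> \<lesssim> A" shows "\<not> \<Theta> \<lesssim> Fpow A"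
proof (cases "finite A")
  case True
  then have "finite (Fpow A)" by (simp add: Fpow_Pow_finite)
  then show ?thesis by (rule small_finite)
next
  case False
  then show ?thesis using Fpow_lepoll_infinite[OF False lepoll_refl] assms lepoll_trans by blast
qed

lemma small_underS: "j \<in> \<Theta> \<Longrightarrow> \<not> \<Theta> \<lesssim> underS |\<Theta>| j"
  using card_of_underS[OF card_of_Card_order, of j \<Theta>]
  by (simp add: Field_card_of not_lepoll_iff_ordLess)

lemma underS_\<Theta>:
  shows "wf ( |\<Theta>| - Id)" and "Total |\<Theta>|" and "trans |\<Theta>|" and "antisym |\<Theta>|"
  using card_of_Well_order[of \<Theta>] by (simp_all add: well_order_on_def linear_order_on_def partial_order_on_def preorder_on_def)

text \<open>Regularity in terms of the well-ordering: the initial segments ending in a small set of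
  elements cannot cover \<open>\<Theta>\<close>.\<close>

lemma small_bounded:
  assumes L: "L \<subseteq> \<Theta>" "\<not> \<Theta> \<lesssim> L" obtains j where "j \<in> \<Theta>" "L \<subseteq> underS |\<Theta>| j"
proof -
  have "\<not> \<Theta> \<lesssim> \<Union>((\<lambda>i. underS |\<Theta>| i \<union> {i}) ` L)"
    by (rule small_UN[OF L(2)], rule small_Un[OF small_underS small_finite]) (use L(1) in auto)
  then have "\<not> \<Theta> \<subseteq> \<Union>((\<lambda>i. underS |\<Theta>| i \<union> {i}) ` L)" using subset_imp_lepoll by blast
  then obtain j where j: "j \<in> \<Theta>" "\<forall>i\<in>L. j \<notin> underS |\<Theta>| i \<union> {i}" by blast
  have "i \<in> underS |\<Theta>| j" if "i \<in> L" for i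
    using j underS_\<Theta>(2) L(1) that unfolding total_on_def Field_card_of underS_def by blast
  then show ?thesis using that j(1) by blast
qed

end

lemma exists_max_in_well_order:
  assumes "Total r" "trans r" "antisym r" "finite F" "F \<noteq> {}" "F \<subseteq> Field r"
  shows "\<exists>m\<in>F. \<forall>i\<in>F - {m}. i \<in> underS r m"
  using assms(4-6)
proof (induction F rule: finite_ne_induct)
  case (insert x F)
  then obtain m where m: "m \<in> F" "\<forall>i\<in>F - {m}. i \<in> underS r m" by auto
  have "x \<noteq> m" using m(1) insert by auto
  then consider "(x, m) \<in> r" | "(m, x) \<in> r"
    using assms(1) m(1) insert.prems unfolding total_on_def by blast
  then show ?case
  proof cases
    case 1
    then have "x \<in> underS r m" using \<open>x \<noteq> m\<close> by (simp add: underS_def)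
    then show ?thesis using m by blast
  next
    case 2
    have "i \<in> underS r x" if i: "i \<in> insert x F - {x}" for i
    proof (cases "i = m")
      case True
      then show ?thesis using 2 \<open>x \<noteq> m\<close> by (simp add: underS_def)
    next
      case False
      then have im: "(i, m) \<in> r" using m(2) i by (auto simp: underS_def)
      then have "(i, x) \<in> r" using 2 assms(2) by (blast dest: transD)
      moreover have "i \<noteq> x" using i by simp
      ultimately show ?thesis by (simp add: underS_def)
    qed
    then show ?thesis by blast
  qed
qed simp

lemma cellular_perp_perp:
  assumes "cellular X a I" shows "cellular X (\<lambda>i. perp X (perp X (a i))) I"
proof (rule cellularI)
  show "perp X (perp X (a i)) \<noteq> {}" if "i \<in> I" for i
    using subset_perp_perp[OF cellularD(1)[OF assms that]] cellularD(2)[OF assms that] by blast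
  fix i j assume ij: "i \<in> I" "j \<in> I" "i \<noteq> j"
  have "perp X (perp X (a i)) \<inter> a j = {}"
    using perp_perp_disjoint[OF cellularD(1)[OF assms ij(2)] cellularD(1)[OF assms ij(1)]]
      cellularD(3)[OF assms ij] by blast
  then show "perp X (perp X (a i)) \<inter> perp X (perp X (a j)) = {}"
    by (intro perp_perp_disjoint) (use cellularD(1)[OF assms ij(2)] in auto)
qed simp

section \<open>Independent systems of antichains\<close>

context homogeneous_space
begin

text \<open>Each \<open>m\<close> owns countably many members: \<open>(m, 0)\<close> later carries
  the traces of the maximal independent family, and the \<open>(m, Suc n)\<close> are spare disjoint
  sets that keep the number of choices at \<open>m\<close> infinite however small that family
  is.\<close>

definition index :: "'m set \<Rightarrow> ('m \<times> nat) option set" where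
  "index M = insert None (Some ` (M \<times> UNIV))"

lemma small_index:
  assumes "\<not> \<Theta> \<lesssim> M" shows "\<not> \<Theta> \<lesssim> index M"
proof -
  have "\<not> \<Theta> \<lesssim> M \<times> (UNIV :: nat set)" by (rule small_Sigma[OF assms small_nat])
  then have "\<not> \<Theta> \<lesssim> Some ` (M \<times> (UNIV :: nat set))" by (rule small_lepoll[OF image_lepoll])
  then have "\<not> \<Theta> \<lesssim> {None} \<union> Some ` (M \<times> (UNIV :: nat set))"
    by (rule small_Un[OF small_finite, rotated]) simp
  then show ?thesis by (simp add: index_def)
qed

text \<open>A family of antichains \<open>z j\<close> whose members are independent across different \<open>j\<close>; every small
  cardinality is dominated by some \<open>M j\<close>. The member \<open>z j None\<close> is kept apart: sets built from the
  other members of \<open>z j\<close> are avoided by intersecting with it.\<close>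
definition antichain_system :: "'j set \<Rightarrow> ('j \<Rightarrow> 'm set) \<Rightarrow> ('j \<Rightarrow> 'j set) \<Rightarrow> ('j \<Rightarrow> ('m \<times> nat) option \<Rightarrow> 'a set) \<Rightarrow> bool" where
  "antichain_system J M Q z \<longleftrightarrow>
     (\<forall>j\<in>J. infinite (M j) \<and> cellular X (z j) (index (M j)) \<and> z j ` index (M j) \<subseteq> regular_opens X) \<and>
     (\<forall>F x. finite F \<longrightarrow> F \<subseteq> J \<longrightarrow> (\<forall>j\<in>F. x j \<in> index (M j)) \<longrightarrow> topspace X \<inter> (\<Inter>j\<in>F. z j (x j)) \<noteq> {}) \<and>
     (\<forall>j\<in>J. Q j \<lesssim> M j \<and> (\<forall>i\<in>Q j. M i \<lesssim> M j)) \<and>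
     (\<forall>L N. L \<subseteq> J \<longrightarrow> \<not> \<Theta> \<lesssim> L \<longrightarrow> N \<subseteq> \<Theta> \<longrightarrow> \<not> \<Theta> \<lesssim> N \<longrightarrow> (\<exists>j\<in>J. N \<lesssim> M j \<and> L \<subseteq> Q j))"

text \<open>With a largest small size \<open>N\<close> one antichain suffices, and its index
  dominates everything that the last clause of the definition asks for.\<close>

lemma antichain_system_attained:
  fixes t :: 't
  assumes N: "\<not> \<Theta> \<lesssim> N" and max: "\<And>N'. N' \<subseteq> \<Theta> \<Longrightarrow> \<not> \<Theta> \<lesssim> N' \<Longrightarrow> N' \<lesssim> N"
  shows "\<exists>z. antichain_system {t} (\<lambda>_. N) (\<lambda>_. {t}) z"
proof -
  have "(UNIV :: nat set) \<lesssim> \<Theta>" using small_nat lepoll_total by blast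
  then obtain f :: "nat \<Rightarrow> 't" where f: "inj_on f UNIV" "f ` UNIV \<subseteq> \<Theta>" by (rule lepollE)
  have "f ` UNIV \<lesssim> N" by (rule max[OF f(2)]) (rule small_lepoll[OF image_lepoll small_nat])
  then have inf: "infinite N" using lepoll_finite f(1) finite_imageD infinite_UNIV_nat by blast
  obtain a where a: "cellular X a (index N)" "\<forall>j\<in>index N. a j \<subseteq> topspace X"
    by (rule cellular_below[OF small_index[OF N] openin_topspace topspace_nonempty])
  note a = a(1)
  let ?z = "\<lambda>i. perp X (perp X (a i))"
  have z: "cellular X ?z (index N)" by (rule cellular_perp_perp[OF a])
  have "antichain_system {t} (\<lambda>_. N) (\<lambda>_. {t}) (\<lambda>_. ?z)"
    unfolding antichain_system_def
  proof (intro conjI allI impI ballI)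
    fix F and x :: "'t \<Rightarrow> _" assume F: "finite F" "F \<subseteq> {t}" "\<forall>j\<in>F. x j \<in> index N"
    show "topspace X \<inter> (\<Inter>j\<in>F. ?z (x j)) \<noteq> {}"
    proof (cases "F = {}")
      case False
      then have "F = {t}" using F(2) by blast
      then have "?z (x t) \<noteq> {}" "?z (x t) \<subseteq> topspace X"
        using F(3) cellularD(2)[OF z] openin_subset[OF cellularD(1)[OF z]] by simp_all
      then show ?thesis using \<open>F = {t}\<close> by auto
    qed (use topspace_nonempty in simp)
  next
    show "{t} \<lesssim> N" by (rule finite_lepoll_infinite[OF inf]) simp
  next
    show "?z ` index N \<subseteq> regular_opens X" by auto
  qed (use inf z max in auto)
  then show ?thesis by blast
qed

text \<open>Every small size is exceeded by another one, and this gives the recursion along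
  \<open>\<Theta>\<close> its room: the members of the earlier antichains have only a small family
  \<open>D\<close> of nonempty finite intersections, and \<open>z j\<close> comes from a disjoint
  refinement of many copies of \<open>D\<close>. The initial segments of \<open>\<Theta>\<close>
  supply the sizes \<open>M j\<close>.\<close>

lemma antichain_system_unattained:
  assumes un: "\<And>N. N \<subseteq> \<Theta> \<Longrightarrow> \<not> \<Theta> \<lesssim> N \<Longrightarrow> \<exists>N'\<subseteq>\<Theta>. \<not> \<Theta> \<lesssim> N' \<and> \<not> N' \<lesssim> N"
  shows "\<exists>z. antichain_system \<Theta> (\<lambda>j. (UNIV::nat set) <+> underS |\<Theta>| j) (\<lambda>j. underS |\<Theta>| j) z"
proof -
  define U where "U j = underS |\<Theta>| j" for j
  define M where "M j = (UNIV::nat set) <+> U j" for j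
  have smM: "\<not> \<Theta> \<lesssim> index (M j)" if "j \<in> \<Theta>" for j
    unfolding M_def U_def Plus_def
    by (intro small_index small_Un small_lepoll[OF image_lepoll] small_nat small_underS that)
  have U\<Theta>: "U j \<subseteq> \<Theta>" for j unfolding U_def by (rule underS_card_of_subset)
  define good where "good S j g \<longleftrightarrow> cellular X g (index (M j)) \<and> g ` index (M j) \<subseteq> regular_opens X \<and>
    (\<forall>\<F>\<subseteq>S. finite \<F> \<longrightarrow> topspace X \<inter> \<Inter>\<F> \<noteq> {} \<longrightarrow> (\<forall>x\<in>index (M j). g x \<inter> \<Inter>\<F> \<noteq> {}))" for S j g
  define prev where "prev f j = (\<Union>i\<in>U j. f i ` index (M i))" for f :: "'t \<Rightarrow> _ \<Rightarrow> 'a set" and j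
  have "\<exists>z. \<forall>j. j \<in> \<Theta> \<longrightarrow> good (prev z j) j (z j)"
  proof (rule dependent_wf_choice[OF underS_\<Theta>(1), where P = "\<lambda>z j g. j \<in> \<Theta> \<longrightarrow> good (prev z j) j g"])
    fix f g :: "'t \<Rightarrow> ((nat + 't) \<times> nat) option \<Rightarrow> 'a set" and j r
    assume "\<And>i. (i, j) \<in> |\<Theta>| - Id \<Longrightarrow> f i = g i"
    then have "prev f j = prev g j" unfolding prev_def by (intro SUP_cong) (auto simp: U_def underS_def)
    then show "(j \<in> \<Theta> \<longrightarrow> good (prev f j) j r) = (j \<in> \<Theta> \<longrightarrow> good (prev g j) j r)" by simp
  next
    fix j and f :: "'t \<Rightarrow> ((nat + 't) \<times> nat) option \<Rightarrow> 'a set"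
    assume IH: "\<And>i. (i, j) \<in> |\<Theta>| - Id \<Longrightarrow> i \<in> \<Theta> \<longrightarrow> good (prev f i) i (f i)"
    show "\<exists>g. j \<in> \<Theta> \<longrightarrow> good (prev f j) j g"
    proof (cases "j \<in> \<Theta>")
      case j: True
      have fi: "cellular X (f i) (index (M i))" if "i \<in> U j" for i
      proof -
        have "i \<in> \<Theta>" "(i, j) \<in> |\<Theta>| - Id" using that U\<Theta>[of j] by (auto simp: U_def underS_def)
        then show ?thesis using IH[of i] by (simp add: good_def)
      qed
      have op: "openin X s" if s: "s \<in> prev f j" for s
      proof -
        obtain i x where ix: "i \<in> U j" "x \<in> index (M i)" "s = f i x" using s unfolding prev_def by blast
        show ?thesis unfolding ix(3) by (rule cellularD(1)[OF fi[OF ix(1)] ix(2)])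
      qed
      have smS: "\<not> \<Theta> \<lesssim> prev f j"
        unfolding prev_def
      proof (rule small_UN)
        show "\<not> \<Theta> \<lesssim> U j" unfolding U_def by (rule small_underS[OF j])
        show "\<not> \<Theta> \<lesssim> f i ` index (M i)" if "i \<in> U j" for i
          using that U\<Theta>[of j] by (intro small_lepoll[OF image_lepoll smM]) blast
      qed
      define D where "D = (\<lambda>\<F>. topspace X \<inter> \<Inter>\<F>) ` Fpow (prev f j) - {{}}"
      have opD: "openin X d \<and> d \<noteq> {}" if "d \<in> D" for d
        using that op unfolding D_def Fpow_def by (auto intro!: openin_Int_Inter)
      have topD: "topspace X \<in> D"
        using topspace_nonempty unfolding D_def Fpow_def by (auto intro: image_eqI[of _ _ "{}"])
      have smD: "\<not> \<Theta> \<lesssim> D"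
        unfolding D_def
        by (rule small_lepoll[OF subset_imp_lepoll[OF Diff_subset]], rule small_lepoll[OF image_lepoll small_Fpow[OF smS]])
      \<comment> \<open>A pair \<open>(d, x)\<close> is the demand that the \<open>x\<close>-th
        member meet \<open>d\<close>. A disjoint refinement serves all demands by disjoint sets, and
        \<open>g x\<close> unites those that belong to \<open>x\<close>.\<close>
      define Q where "Q = D \<times> index (M j)"
      have smQ: "\<not> \<Theta> \<lesssim> Q" unfolding Q_def by (rule small_Sigma[OF smD smM[OF j]])
      have infQ: "infinite Q"
      proof
        assume "finite Q"
        then have "finite (index (M j))" using topD unfolding Q_def
          by (metis empty_iff finite_cartesian_productD2)
        then have "finite (M j \<times> (UNIV::nat set))" by (simp add: index_def finite_image_iff)
        moreover have "Inl 0 \<in> M j" by (simp add: M_def InlI)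
        ultimately show False by (metis empty_iff finite_cartesian_productD2 infinite_UNIV_nat)
      qed
      \<comment> \<open>The refinement asks for antichains strictly larger than \<open>Q\<close>
        below every nonempty open set; a small size \<open>N\<close> of this kind exists because
        small sizes have no maximum.\<close>
      obtain N where N: "N \<subseteq> \<Theta>" "\<not> \<Theta> \<lesssim> N" "\<not> N \<lesssim> Q"
      proof -
        have "Q \<lesssim> \<Theta>" using smQ lepoll_total by blast
        then obtain h where h: "inj_on h Q" "h ` Q \<subseteq> \<Theta>" by (rule lepollE)
        obtain N where "N \<subseteq> \<Theta>" "\<not> \<Theta> \<lesssim> N" "\<not> N \<lesssim> h ` Q"
          using un[OF h(2) small_lepoll[OF image_lepoll smQ]] by blast
        then show ?thesis using that h(1) by simp
      qed
      obtain e where e: "cellular X e Q" "\<forall>q\<in>Q. e q \<subseteq> fst q"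
      proof (rule disjoint_refinement[OF infQ _ N(3), where X = X and d = fst])
        show "openin X (fst q) \<and> fst q \<noteq> {}" if "q \<in> Q" for q using that opD by (auto simp: Q_def)
        show "\<exists>a. cellular X a N \<and> (\<forall>p\<in>N. a p \<subseteq> c)" if "openin X c" "c \<noteq> {}" for c
          by (rule cellular_below'[OF that N(1,2)])
      qed
      define g where "g x = (\<Union>d\<in>D. e (d, x))" for x
      have eg: "e (d, x) \<subseteq> g x" if "d \<in> D" for d x using that by (auto simp: g_def)
      have eQ: "e (d, x) \<noteq> {}" "e (d, x) \<subseteq> d" "openin X (e (d, x))" if "d \<in> D" "x \<in> index (M j)" for d x
        using that e cellularD(1,2)[OF e(1), of "(d, x)"] by (auto simp: Q_def)
      have g: "cellular X g (index (M j))"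
      proof (rule cellularI)
        fix x assume x: "x \<in> index (M j)"
        show "openin X (g x)" unfolding g_def using eQ(3) x by (intro openin_Union) auto
        show "g x \<noteq> {}" using eQ(1)[OF topD x] eg[OF topD] by blast
      next
        fix x y assume xy: "x \<in> index (M j)" "y \<in> index (M j)" "x \<noteq> y"
        have "e (d, x) \<inter> e (d', y) = {}" if "d \<in> D" "d' \<in> D" for d d'
          by (rule cellularD(3)[OF e(1)]) (use xy that in \<open>auto simp: Q_def\<close>)
        then show "g x \<inter> g y = {}" by (auto simp: g_def)
      qed
      have "good (prev f j) j (\<lambda>x. perp X (perp X (g x)))"
        unfolding good_def
      proof (intro conjI allI impI ballI)
        show "cellular X (\<lambda>x. perp X (perp X (g x))) (index (M j))" by (rule cellular_perp_perp[OF g])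
        fix \<F> x assume \<F>: "\<F> \<subseteq> prev f j" "finite \<F>" "topspace X \<inter> \<Inter>\<F> \<noteq> {}" and x: "x \<in> index (M j)"
        have d: "topspace X \<inter> \<Inter>\<F> \<in> D" using \<F> by (auto simp: D_def Fpow_def)
        show "perp X (perp X (g x)) \<inter> \<Inter>\<F> \<noteq> {}"
          using eQ(1,2)[OF d x] eg[OF d, of x] subset_perp_perp[OF cellularD(1)[OF g x]] by blast
      qed auto
      then show ?thesis by blast
    qed simp
  qed
  then obtain z where z: "\<And>j. j \<in> \<Theta> \<Longrightarrow> good (prev z j) j (z j)" by blast
  \<comment> \<open>Splitting off the largest index suffices, since each antichain meets the
    nonempty finite intersections of the earlier ones.\<close>
  have meet: "topspace X \<inter> (\<Inter>j\<in>F. z j (x j)) \<noteq> {}"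
    if "finite F" "F \<subseteq> \<Theta>" "\<forall>j\<in>F. x j \<in> index (M j)" for F x
    using that
  proof (induction "card F" arbitrary: F)
    case 0
    then show ?case using topspace_nonempty by simp
  next
    case (Suc n)
    then have "F \<noteq> {}" by auto
    then obtain m where m: "m \<in> F" "\<forall>i\<in>F - {m}. i \<in> underS |\<Theta>| m"
      using exists_max_in_well_order[OF underS_\<Theta>(2,3,4) Suc(3)] Suc(4) by (auto simp: Field_card_of)
    have IH: "topspace X \<inter> (\<Inter>j\<in>F - {m}. z j (x j)) \<noteq> {}"
      using Suc m(1) by (intro Suc(1)) auto
    have m\<Theta>: "m \<in> \<Theta>" using m(1) Suc(4) by blast
    let ?\<F> = "(\<lambda>j. z j (x j)) ` (F - {m})"
    have "?\<F> \<subseteq> prev z m" using m(2) Suc(5) by (auto simp: prev_def U_def)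
    moreover have "finite ?\<F>" using Suc(3) by simp
    moreover have "x m \<in> index (M m)" using Suc(5) m(1) by blast
    moreover have "topspace X \<inter> \<Inter>?\<F> \<noteq> {}" using IH by simp
    ultimately have "z m (x m) \<inter> \<Inter>?\<F> \<noteq> {}"
      using z[OF m\<Theta>, unfolded good_def, THEN conjunct2, THEN conjunct2, rule_format, of ?\<F> "x m"] by simp
    moreover have "z m (x m) \<subseteq> topspace X"
      using z[OF m\<Theta>] openin_subset[OF cellularD(1)] \<open>x m \<in> index (M m)\<close> unfolding good_def by metis
    moreover have "(\<Inter>j\<in>F. z j (x j)) = z m (x m) \<inter> \<Inter>?\<F>" using m(1) by auto
    ultimately show ?case by auto
  qed
  have "antichain_system \<Theta> M U z"
    unfolding antichain_system_def
  proof (intro conjI allI impI ballI)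
    fix j assume j: "j \<in> \<Theta>"
    show "infinite (M j)" by (simp add: M_def)
    show "cellular X (z j) (index (M j))" "z j ` index (M j) \<subseteq> regular_opens X"
      using z[OF j] by (simp_all add: good_def)
    show "U j \<lesssim> M j" unfolding M_def using card_of_Plus2 by (simp add: lepoll_iff_ordLeq)
    fix i assume i: "i \<in> U j"
    have "U i \<subseteq> U j"
    proof
      fix k assume "k \<in> U i"
      then have "(k, i) \<in> |\<Theta>|" "(i, j) \<in> |\<Theta>|" "k \<noteq> i" "i \<noteq> j" using i by (auto simp: U_def underS_def)
      then have "(k, j) \<in> |\<Theta>|" "k \<noteq> j" using underS_\<Theta>(3,4) by (blast dest: transD antisymD)+
      then show "k \<in> U j" by (simp add: U_def underS_def)
    qed
    then have "M i \<subseteq> M j" by (auto simp: M_def)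
    then show "M i \<lesssim> M j" by (rule subset_imp_lepoll)
  next
    fix F and x :: "'t \<Rightarrow> _" assume "finite F" "F \<subseteq> \<Theta>" "\<forall>j\<in>F. x j \<in> index (M j)"
    then show "topspace X \<inter> (\<Inter>j\<in>F. z j (x j)) \<noteq> {}" by (rule meet)
  next
    fix L N assume LN: "L \<subseteq> \<Theta>" "\<not> \<Theta> \<lesssim> L" "N \<subseteq> \<Theta>" "\<not> \<Theta> \<lesssim> N"
    obtain i where i: "i \<in> \<Theta>" "N \<lesssim> underS |\<Theta>| i" by (rule lepoll_underS[OF LN(4)])
    \<comment> \<open>\<open>i\<close> takes care of the size of \<open>N\<close>, so a common bound
      of \<open>L\<close> and \<open>i\<close> serves both requirements.\<close>
    have "\<not> \<Theta> \<lesssim> L \<union> {i}" by (rule small_Un[OF LN(2) small_finite]) simp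
    moreover have "L \<union> {i} \<subseteq> \<Theta>" using LN(1) i(1) by simp
    ultimately obtain j where j: "j \<in> \<Theta>" "L \<union> {i} \<subseteq> underS |\<Theta>| j" using small_bounded by metis
    have "underS |\<Theta>| i \<subseteq> underS |\<Theta>| j"
    proof
      fix k assume "k \<in> underS |\<Theta>| i"
      then have "(k, i) \<in> |\<Theta>|" "(i, j) \<in> |\<Theta>|" "k \<noteq> i" "i \<noteq> j" using j by (auto simp: underS_def)
      then have "(k, j) \<in> |\<Theta>|" "k \<noteq> j" using underS_\<Theta>(3,4) by (blast dest: transD antisymD)+
      then show "k \<in> underS |\<Theta>| j" by (simp add: underS_def)
    qed
    then have "N \<lesssim> U j" using i(2) subset_imp_lepoll lepoll_trans unfolding U_def by blast
    moreover have "U j \<lesssim> M j" unfolding M_def using card_of_Plus2 by (simp add: lepoll_iff_ordLeq)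
    ultimately have "N \<lesssim> M j" by (rule lepoll_trans)
    then show "\<exists>j\<in>\<Theta>. N \<lesssim> M j \<and> L \<subseteq> U j" using j by (auto simp: U_def)
  qed
  then show ?thesis unfolding M_def[abs_def] U_def[abs_def] by blast
qed

end

section \<open>Counting small subsets of a sum of powers\<close>

lemma Pow_lepoll_funcset:
  assumes "a \<in> K" "b \<in> K" "a \<noteq> b" shows "Pow M \<lesssim> M \<rightarrow>\<^sub>E K"
proof -
  let ?f = "\<lambda>A. \<lambda>m\<in>M. if m \<in> A then a else b"
  have "A \<subseteq> B" if "A \<in> Pow M" "?f A = ?f B" for A B
  proof
    fix m assume m: "m \<in> A"
    then have "?f A m = a" using that(1) by auto
    then have "?f B m = a" using that(2) by simp
    then show "m \<in> B" using assms(3) m that(1) by (auto split: if_splits)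
  qed
  then have "inj_on ?f (Pow M)" by (metis (no_types, lifting) inj_onI subset_antisym)
  moreover have "?f ` Pow M \<subseteq> M \<rightarrow>\<^sub>E K" using assms by auto
  ultimately show ?thesis by (auto simp: lepoll_def)
qed

lemma lepoll_funcset_const:
  assumes "m \<in> M" shows "K \<lesssim> M \<rightarrow>\<^sub>E K"
proof -
  have "K \<subseteq> (\<lambda>f. f m) ` (M \<rightarrow>\<^sub>E K)"
  proof
    fix k assume "k \<in> K"
    then show "k \<in> (\<lambda>f. f m) ` (M \<rightarrow>\<^sub>E K)"
      by (intro image_eqI[of _ _ "\<lambda>_\<in>M. k"]) (use assms in auto)
  qed
  then show ?thesis by (rule subset_image_lepoll)
qed

lemma funcset_power_lepoll:
  assumes "infinite M" "K \<noteq> {}" shows "M \<rightarrow>\<^sub>E (M \<rightarrow>\<^sub>E K) \<lesssim> M \<rightarrow>\<^sub>E K"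
proof -
  have "M \<rightarrow>\<^sub>E (M \<rightarrow>\<^sub>E K) \<lesssim> M \<times> M \<rightarrow>\<^sub>E K"
    by (rule eqpoll_imp_lepoll[OF eqpoll_sym[OF funcset_times_eqpoll]])
  also have "\<dots> \<lesssim> M \<rightarrow>\<^sub>E K"
    by (rule lepoll_funcset_left[OF assms(2) times_lepoll_infinite[OF assms(1) lepoll_refl lepoll_refl]])
  finally show ?thesis .
qed

text \<open>A subset of \<open>\<Sigma> j\<in>J. K^(M j)\<close> that is bounded by some \<open>j\<close> and of size at most \<open>|M j|\<close> is the
  range of a map from \<open>M j\<close> to \<open>K^(M j)\<close>.\<close>
lemma bounded_subsets_lepoll:
  fixes M :: "'j \<Rightarrow> 'm set" and K :: "'k set"
  assumes ab: "a \<in> K" "b \<in> K" "a \<noteq> b" and J: "J \<noteq> {}"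
    and M: "\<And>j. j \<in> J \<Longrightarrow> infinite (M j)"
    and Q: "\<And>j. j \<in> J \<Longrightarrow> Q j \<lesssim> M j" "\<And>i j. j \<in> J \<Longrightarrow> i \<in> Q j \<Longrightarrow> M i \<lesssim> M j"
    and S: "\<And>E. E \<in> S \<Longrightarrow> \<exists>j\<in>J. E \<lesssim> M j \<and> E \<subseteq> (SIGMA i:Q j. M i \<rightarrow>\<^sub>E K)"
  shows "S \<lesssim> (SIGMA j:J. M j \<rightarrow>\<^sub>E K)"
proof -
  let ?C = "SIGMA j:J. M j \<rightarrow>\<^sub>E K"
  have MK: "M j \<rightarrow>\<^sub>E K \<lesssim> ?C" if "j \<in> J" for j
    unfolding lepoll_def using that by (intro exI[of _ "Pair j"]) (auto simp: inj_on_def)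
  have infMK: "infinite (M j \<rightarrow>\<^sub>E K)" if "j \<in> J" for j
    using lepoll_funcset_self[OF ab, of "M j"] M[OF that] lepoll_finite by blast
  obtain j0 where j0: "j0 \<in> J" using J by blast
  have infC: "infinite ?C" using MK[OF j0] infMK[OF j0] lepoll_finite by blast
  define R where "R j = {E. E \<subseteq> (SIGMA i:Q j. M i \<rightarrow>\<^sub>E K) \<and> E \<noteq> {} \<and> E \<lesssim> M j}" for j
  have R: "R j \<lesssim> M j \<rightarrow>\<^sub>E K" if j: "j \<in> J" for j
  proof -
    have "(SIGMA i:Q j. M i \<rightarrow>\<^sub>E K) \<lesssim> M j \<rightarrow>\<^sub>E K"
    proof (rule Sigma_lepoll_infinite[OF infMK[OF j]])
      show "Q j \<lesssim> M j \<rightarrow>\<^sub>E K" by (rule lepoll_trans[OF Q(1)[OF j] lepoll_funcset_self[OF ab]])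
      show "M i \<rightarrow>\<^sub>E K \<lesssim> M j \<rightarrow>\<^sub>E K" if "i \<in> Q j" for i
        by (rule lepoll_funcset_left[OF _ Q(2)[OF j that]]) (use ab in blast)
    qed
    then have "R j \<lesssim> M j \<rightarrow>\<^sub>E (M j \<rightarrow>\<^sub>E K)"
      unfolding R_def by (rule lepoll_trans[OF nonempty_subsets_lepoll lepoll_funcset_right])
    also have "\<dots> \<lesssim> M j \<rightarrow>\<^sub>E K"
      by (rule funcset_power_lepoll[OF M[OF j]]) (use ab in blast)
    finally show ?thesis .
  qed
  have "S \<subseteq> {{}} \<union> (\<Union>j\<in>J. R j)"
  proof
    fix E assume "E \<in> S"
    from S[OF this] show "E \<in> {{}} \<union> (\<Union>j\<in>J. R j)" by (auto simp: R_def)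
  qed
  then have "S \<lesssim> {{}} \<union> (\<Union>j\<in>J. R j)" by (rule subset_imp_lepoll)
  also have "\<dots> \<lesssim> ?C"
  proof (rule Un_lepoll_infinite[OF infC])
    show "{{}} \<lesssim> ?C" by (rule finite_lepoll_infinite[OF infC]) simp
    have "(\<Union>j\<in>J. R j) \<lesssim> (SIGMA j:J. R j)" by (rule subset_image_lepoll[of _ snd]) force
    also have "\<dots> \<lesssim> ?C" by (rule Sigma_lepoll_mono[OF subset_refl R])
    finally show "(\<Union>j\<in>J. R j) \<lesssim> ?C" .
  qed
  finally show ?thesis .
qed

section \<open>The maximal independent family and the algebra it generates\<close>

context homogeneous_space
begin

text \<open>Chain condition: a maximal disjoint family of open sets refining \<open>E\<close> is
  small, and choosing a member of \<open>E\<close> above each of its sets gives a subfamily with the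
  same \<open>perp\<close>. So closure under small suprema already amounts to completeness.\<close>

lemma small_subfamily:
  assumes E: "\<And>e. e \<in> E \<Longrightarrow> openin X e"
  obtains E0 where "E0 \<subseteq> E" "\<not> \<Theta> \<lesssim> E0" "perp X (\<Union>E0) = perp X (\<Union>E)"
proof -
  define \<G> where "\<G> = {v. openin X v \<and> v \<noteq> {} \<and> (\<exists>e\<in>E. v \<subseteq> e)}"
  have "{} \<notin> \<G>" by (simp add: \<G>_def)
  then obtain \<V> where \<V>: "\<V> \<subseteq> \<G>" "disjoint \<V>" "\<forall>g\<in>\<G>. \<exists>v\<in>\<V>. g \<inter> v \<noteq> {}"
    by (rule exists_maximal_disjoint)
  have "\<forall>v\<in>\<V>. \<exists>e. e \<in> E \<and> v \<subseteq> e" using \<V>(1) by (auto simp: \<G>_def)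
  from bchoice[OF this] obtain \<epsilon> where \<epsilon>: "\<forall>v\<in>\<V>. \<epsilon> v \<in> E \<and> v \<subseteq> \<epsilon> v" ..
  have "cellular X (\<lambda>v. v) \<V>"
    by (rule cellularI) (use \<V>(1,2) in \<open>auto simp: \<G>_def disjoint_def\<close>)
  then have small: "\<not> \<Theta> \<lesssim> \<epsilon> ` \<V>" by (rule small_lepoll[OF image_lepoll cellular_small])
  have sub: "\<epsilon> ` \<V> \<subseteq> E" using \<epsilon> by auto
  have "perp X (\<Union>(\<epsilon> ` \<V>)) = perp X (\<Union>E)"
  proof
    show "perp X (\<Union>E) \<subseteq> perp X (\<Union>(\<epsilon> ` \<V>))" by (intro perp_antimono Union_mono sub)
    let ?W = "perp X (\<Union>(\<epsilon> ` \<V>))"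
    have W: "?W \<inter> \<epsilon> v = {}" if "v \<in> \<V>" for v
      using perp_Int_self[of X "\<Union>(\<epsilon> ` \<V>)"] that by blast
    have "?W \<inter> e = {}" if e: "e \<in> E" for e
    proof (rule ccontr)
      assume "?W \<inter> e \<noteq> {}"
      then have "?W \<inter> e \<in> \<G>" using e E[OF e] by (auto simp: \<G>_def)
      then obtain v where v: "v \<in> \<V>" "?W \<inter> e \<inter> v \<noteq> {}" using \<V>(3) by blast
      then show False using W[OF v(1)] \<epsilon> by blast
    qed
    then show "?W \<subseteq> perp X (\<Union>E)" by (subst subset_perp_Union_iff) auto
  qed
  then show ?thesis by (rule that[OF sub small])
qed

text \<open>The sum \<open>?C\<close> is made to bound the algebra and to index the family at once:
  its elements choose an antichain \<open>z j\<close> and a member of \<open>K\<close> for each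
  \<open>m\<close> in \<open>M j\<close>, and its small subsets are no more numerous than its
  elements.\<close>

lemma indep_regular_opens_of_system:
  fixes J :: "'j set" and M :: "'j \<Rightarrow> 'm set"
  assumes sys: "antichain_system J M Q z"
  shows "\<exists>s. indep X {topspace X} s (regular_opens X)"
proof -
  have infM: "\<And>j. j \<in> J \<Longrightarrow> infinite (M j)"
    and cz: "\<And>j. j \<in> J \<Longrightarrow> cellular X (z j) (index (M j))"
    and zR: "\<And>j. j \<in> J \<Longrightarrow> z j ` index (M j) \<subseteq> regular_opens X"
    and QM: "\<And>j. j \<in> J \<Longrightarrow> Q j \<lesssim> M j" "\<And>j i. j \<in> J \<Longrightarrow> i \<in> Q j \<Longrightarrow> M i \<lesssim> M j"
    using sys[unfolded antichain_system_def] by simp_all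
  have meet: "topspace X \<inter> (\<Inter>j\<in>F. z j (x j)) \<noteq> {}"
    if "finite F" "F \<subseteq> J" "\<forall>j\<in>F. x j \<in> index (M j)" for F x
    using sys[unfolded antichain_system_def, THEN conjunct2, THEN conjunct1, THEN spec, THEN spec,
        THEN mp, THEN mp, THEN mp, OF that] .
  have dom': "\<exists>j\<in>J. N \<lesssim> M j \<and> L \<subseteq> Q j" if "L \<subseteq> J" "\<not> \<Theta> \<lesssim> L" "N \<subseteq> \<Theta>" "\<not> \<Theta> \<lesssim> N" for L N
    using sys[unfolded antichain_system_def, THEN conjunct2, THEN conjunct2, THEN conjunct2, THEN spec,
        THEN spec, THEN mp, THEN mp, THEN mp, THEN mp, OF that] .
  have dom: "\<exists>j\<in>J. E \<lesssim> M j \<and> L \<subseteq> Q j" if L: "L \<subseteq> J" "\<not> \<Theta> \<lesssim> L" and E: "\<not> \<Theta> \<lesssim> E" for L and E :: "'e set"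
  proof -
    have "E \<lesssim> \<Theta>" using E lepoll_total by blast
    then obtain f where f: "inj_on f E" "f ` E \<subseteq> \<Theta>" by (rule lepollE)
    obtain j where "j \<in> J" "f ` E \<lesssim> M j" "L \<subseteq> Q j"
      using dom'[OF L f(2) small_lepoll[OF image_lepoll E]] by blast
    then show ?thesis using f(1) by auto
  qed
  define \<D> where "\<D> = {d. \<exists>F x. finite F \<and> F \<subseteq> J \<and> (\<forall>j\<in>F. x j \<in> index (M j)) \<and> d = topspace X \<inter> (\<Inter>j\<in>F. z j (x j))}"
  \<comment> \<open>Two-sided independence over the antichains. It is of finite character, so Zorn's
    lemma yields a maximal \<open>U\<close>; a set that splits every nonempty member of the
    generated algebra could be added to it.\<close>
  define \<Phi> where "\<Phi> U \<longleftrightarrow> U \<subseteq> regular_opens X \<and> (\<forall>d\<in>\<D>. \<forall>P N. finite P \<longrightarrow> finite N \<longrightarrow> P \<subseteq> U \<longrightarrow> N \<subseteq> U \<longrightarrow> P \<inter> N = {} \<longrightarrow>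
      d \<inter> \<Inter>P \<inter> \<Inter>(perp X ` N) \<noteq> {})" for U
  have \<Phi>I: "\<Phi> U" if "U \<subseteq> regular_opens X"
    "\<And>d P N. d \<in> \<D> \<Longrightarrow> finite P \<Longrightarrow> finite N \<Longrightarrow> P \<subseteq> U \<Longrightarrow> N \<subseteq> U \<Longrightarrow> P \<inter> N = {} \<Longrightarrow> d \<inter> \<Inter>P \<inter> \<Inter>(perp X ` N) \<noteq> {}" for U
    using that unfolding \<Phi>_def by simp
  have \<Phi>D: "d \<inter> \<Inter>P \<inter> \<Inter>(perp X ` N) \<noteq> {}"
    if "\<Phi> U" "d \<in> \<D>" "finite P" "finite N" "P \<subseteq> U" "N \<subseteq> U" "P \<inter> N = {}" for U d P N
    using that unfolding \<Phi>_def by simp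
  have \<D>ne: "d \<noteq> {}" if "d \<in> \<D>" for d
    using that meet unfolding \<D>_def by blast
  obtain U where U: "\<Phi> U" "\<And>V. \<Phi> V \<Longrightarrow> U \<subseteq> V \<Longrightarrow> V = U"
  proof -
    have "\<Union>\<C> \<in> Collect \<Phi>" if C: "subset.chain (Collect \<Phi>) \<C>" for \<C>
    proof -
      have C\<Phi>: "\<Phi> V" if "V \<in> \<C>" for V using C that by (auto simp: subset.chain_def)
      have "\<Phi> (\<Union>\<C>)"
      proof (rule \<Phi>I)
        show "\<Union>\<C> \<subseteq> regular_opens X" using C\<Phi> unfolding \<Phi>_def by blast
        fix d P N assume d: "d \<in> \<D>" and PN: "finite P" "finite N" "P \<subseteq> \<Union>\<C>" "N \<subseteq> \<Union>\<C>" "P \<inter> N = {}"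
        show "d \<inter> \<Inter>P \<inter> \<Inter>(perp X ` N) \<noteq> {}"
        proof (cases "\<C> = {}")
          case True
          then show ?thesis using PN \<D>ne[OF d] by simp
        next
          case False
          obtain V where V: "V \<in> \<C>" "P \<union> N \<subseteq> V"
            by (rule finite_subset_Union_chain[of "P \<union> N" \<C>, OF _ _ False C]) (use PN in auto)
          show ?thesis by (rule \<Phi>D[OF C\<Phi>[OF V(1)] d PN(1,2) _ _ PN(5)]) (use V(2) in auto)
        qed
      qed
      then show ?thesis by simp
    qed
    then obtain U where "U \<in> Collect \<Phi>" "\<forall>V\<in>Collect \<Phi>. U \<subseteq> V \<longrightarrow> V = U"
      using subset_Zorn'[of "Collect \<Phi>"] by blast
    then show ?thesis using that by simp
  qed
  have UR: "U \<subseteq> regular_opens X" using U(1) by (simp add: \<Phi>_def)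
  define G where "G = U \<union> (\<Union>j\<in>J. z j ` index (M j))"
  define K where "K = (UNIV :: nat set) <+> U"
  have K01: "Inl 0 \<in> K" "Inl 1 \<in> K" "(Inl 0 :: nat + 'a set) \<noteq> Inl 1" by (auto simp: K_def)
  have infK: "infinite K" by (simp add: K_def)
  let ?C = "SIGMA j:J. M j \<rightarrow>\<^sub>E K"
  have MK: "M j \<rightarrow>\<^sub>E K \<lesssim> ?C" if "j \<in> J" for j
    unfolding lepoll_def using that by (intro exI[of _ "Pair j"]) (auto simp: inj_on_def)
  have "\<not> \<Theta> \<lesssim> ({} :: nat set)" by (rule small_finite) simp
  from dom[OF empty_subsetI small_finite[OF finite.emptyI] this] obtain j0 where j0: "j0 \<in> J" by blast
  have infC: "infinite ?C"
    using lepoll_trans[OF lepoll_funcset_self[OF K01] MK[OF j0]] infM[OF j0] lepoll_finite by blast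
  \<comment> \<open>Cantor: a small \<open>?C\<close> would be dominated by some \<open>M j\<close>,
    although it contains a copy of \<open>M j \<rightarrow>\<^sub>E K\<close>.\<close>
  have \<Theta>C: "\<Theta> \<lesssim> ?C"
  proof (rule ccontr)
    assume "\<not> \<Theta> \<lesssim> ?C"
    from dom[OF empty_subsetI small_finite[OF finite.emptyI] this]
    obtain j where j: "j \<in> J" "?C \<lesssim> M j" by blast
    have "Pow (M j) \<lesssim> M j" by (rule lepoll_trans[OF lepoll_trans[OF Pow_lepoll_funcset[OF K01] MK[OF j(1)]] j(2)])
    moreover have "M j \<prec> Pow (M j)" by (rule lesspoll_Pow_self)
    ultimately show False by (meson lesspoll_not_refl lesspoll_trans2)
  qed
  have GC: "G \<lesssim> ?C"
    unfolding G_def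
  proof (rule Un_lepoll_infinite[OF infC])
    obtain m where "m \<in> M j0" using infM[OF j0] by fastforce
    have "U \<lesssim> K" unfolding K_def using card_of_Plus2 by (simp add: lepoll_iff_ordLeq)
    then show "U \<lesssim> ?C"
      by (rule lepoll_trans[OF _ lepoll_trans[OF lepoll_funcset_const[OF \<open>m \<in> M j0\<close>] MK[OF j0]]])
    have "(\<Union>j\<in>J. z j ` index (M j)) \<lesssim> (SIGMA j:J. index (M j))"
      by (rule subset_image_lepoll[of _ "\<lambda>(j,x). z j x"]) force
    also have "\<dots> \<lesssim> ?C"
    proof (rule Sigma_lepoll_mono[OF subset_refl])
      fix j assume j: "j \<in> J"
      have "Some ` (M j \<times> (UNIV::nat set)) \<lesssim> M j"
        by (rule lepoll_trans[OF image_lepoll times_lepoll_infinite[OF infM[OF j] lepoll_refl]])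
          (use infM[OF j] infinite_le_lepoll in blast)
      moreover have "{None} \<lesssim> M j" by (rule finite_lepoll_infinite[OF infM[OF j]]) simp
      ultimately have "{None} \<union> Some ` (M j \<times> (UNIV::nat set)) \<lesssim> M j"
        by (intro Un_lepoll_infinite[OF infM[OF j]])
      then have "index (M j) \<lesssim> M j" by (simp add: index_def)
      then show "index (M j) \<lesssim> M j \<rightarrow>\<^sub>E K" by (rule lepoll_trans[OF _ lepoll_funcset_self[OF K01]])
    qed
    finally show "(\<Union>j\<in>J. z j ` index (M j)) \<lesssim> ?C" .
  qed
  \<comment> \<open>A small part of the sum has a small projection to \<open>J\<close>, so by the
    last clause of the system one index dominates both its size and its projection.\<close>
  have countC: "{E. E \<subseteq> ?C \<and> \<not> \<Theta> \<lesssim> E} \<lesssim> ?C"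
  proof (rule bounded_subsets_lepoll[OF K01 _ infM QM])
    show "J \<noteq> {}" using j0 by blast
    fix E assume "E \<in> {E. E \<subseteq> ?C \<and> \<not> \<Theta> \<lesssim> E}"
    then have E: "E \<subseteq> ?C" "\<not> \<Theta> \<lesssim> E" by auto
    have "fst ` E \<subseteq> J" using E(1) by auto
    moreover have "\<not> \<Theta> \<lesssim> fst ` E" by (rule small_lepoll[OF image_lepoll E(2)])
    ultimately obtain j where j: "j \<in> J" "E \<lesssim> M j" "fst ` E \<subseteq> Q j" using dom[OF _ _ E(2)] by blast
    have "E \<subseteq> (SIGMA i:Q j. M i \<rightarrow>\<^sub>E K)"
    proof
      fix p assume p: "p \<in> E"
      then have "p \<in> ?C" "fst p \<in> Q j" using E(1) j(3) by auto
      then show "p \<in> (SIGMA i:Q j. M i \<rightarrow>\<^sub>E K)" by auto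
    qed
    then show "\<exists>j\<in>J. E \<lesssim> M j \<and> E \<subseteq> (SIGMA i:Q j. M i \<rightarrow>\<^sub>E K)" using j by blast
  qed
  have count: "{E. E \<subseteq> Z \<and> \<not> \<Theta> \<lesssim> E} \<lesssim> ?C" if Z: "Z \<lesssim> ?C" for Z :: "'a set set"
  proof -
    obtain f where f: "inj_on f Z" "f ` Z \<subseteq> ?C" using Z by (rule lepollE)
    have "inj_on (image f) {E. E \<subseteq> Z \<and> \<not> \<Theta> \<lesssim> E}"
    proof (rule inj_onI)
      fix A B assume "A \<in> {E. E \<subseteq> Z \<and> \<not> \<Theta> \<lesssim> E}" "B \<in> {E. E \<subseteq> Z \<and> \<not> \<Theta> \<lesssim> E}" "f ` A = f ` B"
      then show "A = B" using inj_on_image_eq_iff[OF f(1)] by simp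
    qed
    moreover have "image f ` {E. E \<subseteq> Z \<and> \<not> \<Theta> \<lesssim> E} \<subseteq> {E. E \<subseteq> ?C \<and> \<not> \<Theta> \<lesssim> E}"
    proof (rule image_subsetI)
      fix E assume "E \<in> {E. E \<subseteq> Z \<and> \<not> \<Theta> \<lesssim> E}"
      then have E: "E \<subseteq> Z" "\<not> \<Theta> \<lesssim> E" by auto
      have "f ` E \<subseteq> ?C" using E(1) f(2) by blast
      then show "f ` E \<in> {E. E \<subseteq> ?C \<and> \<not> \<Theta> \<lesssim> E}" using small_lepoll[OF image_lepoll E(2)] by blast
    qed
    ultimately have "{E. E \<subseteq> Z \<and> \<not> \<Theta> \<lesssim> E} \<lesssim> {E. E \<subseteq> ?C \<and> \<not> \<Theta> \<lesssim> E}"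
      unfolding lepoll_def by blast
    then show ?thesis using countC by (rule lepoll_trans)
  qed
  obtain A0 where A0: "G \<subseteq> A0" "A0 \<lesssim> ?C" "\<forall>E. E \<subseteq> A0 \<longrightarrow> \<not> \<Theta> \<lesssim> E \<longrightarrow> perp X (\<Union>E) \<in> A0"
  proof (rule closure_lepoll[OF infC GC \<Theta>C infinite_\<Theta> _ count])
    show "\<not> \<Theta> \<lesssim> \<Union>(B ` L)" if "\<not> \<Theta> \<lesssim> L" "\<And>j. j \<in> L \<Longrightarrow> \<not> \<Theta> \<lesssim> B j" for L and B :: "'t \<Rightarrow> 't set"
      by (rule small_UN[OF that])
  qed
  define A where "A = A0 \<inter> regular_opens X"
  have AR: "A \<subseteq> regular_opens X" and opA: "\<And>a. a \<in> A \<Longrightarrow> openin X a"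
    using regular_opens_openin by (auto simp: A_def)
  have GA: "G \<subseteq> A" using A0(1) UR zR by (auto simp: A_def G_def)
  have cl: "perp X (\<Union>E) \<in> A" if E: "E \<subseteq> A" for E
  proof -
    have op: "openin X e" if "e \<in> E" for e using opA that E by blast
    obtain E0 where E0: "E0 \<subseteq> E" "\<not> \<Theta> \<lesssim> E0" "perp X (\<Union>E0) = perp X (\<Union>E)"
      by (rule small_subfamily[of E]) (use op in auto)
    have "perp X (\<Union>E0) \<in> A0" using A0(3) E0(1,2) E by (auto simp: A_def)
    moreover have "perp X (\<Union>E) \<in> regular_opens X" by (rule perp_regular) (use op in blast)
    ultimately show ?thesis using E0(3) by (simp add: A_def)
  qed
  have clP: "perp X a \<in> A" if "a \<in> A" for a using cl[of "{a}"] that by simp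
  have topA: "topspace X \<in> A" using cl[of "{}"] by (simp add: perp_def)
  have clI: "a \<inter> b \<in> A" if "a \<in> A" "b \<in> A" for a b
  proof -
    have "perp X (\<Union>{perp X a, perp X b}) \<in> A" using clP that by (intro cl) auto
    moreover have "a \<in> regular_opens X" "b \<in> regular_opens X" using that AR by auto
    ultimately show ?thesis by (simp only: perp_perp_Int)
  qed
  have clF: "topspace X \<inter> \<Inter>\<F> \<in> A" if "finite \<F>" "\<F> \<subseteq> A" for \<F>
    using that
  proof (induction \<F>)
    case (insert a \<F>)
    have "a \<inter> (topspace X \<inter> \<Inter>\<F>) \<in> A" by (rule clI) (use insert in auto)
    then show ?case by (simp add: Int_left_commute)
  qed (simp add: topA)
  \<comment> \<open>Otherwise \<open>exists_splitting\<close> provides a \<open>u\<close> that cuts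
    every nonempty member of \<open>A\<close>, in particular every finite combination of antichain
    members and members of \<open>U\<close>, and \<open>insert u U\<close> contradicts
    maximality.\<close>
  have "\<exists>a\<in>A. a \<noteq> {} \<and> (\<forall>b\<in>regular_opens X. b \<subseteq> a \<longrightarrow> b \<in> A)"
  proof (rule ccontr)
    assume "\<not> ?thesis"
    then have no: "\<exists>b\<in>regular_opens X. b \<subseteq> a \<and> b \<notin> A" if "a \<in> A" "a \<noteq> {}" for a using that by blast
    obtain u where u: "u \<in> regular_opens X" "\<And>a. a \<in> A \<Longrightarrow> a \<noteq> {} \<Longrightarrow> a \<inter> u \<noteq> {} \<and> a \<inter> perp X u \<noteq> {}"
      using exists_splitting[OF AR cl no] by metis
    have uU: "u \<notin> U"
    proof
      assume "u \<in> U"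
      then have "u \<in> A" using GA by (auto simp: G_def)
      moreover have "u \<noteq> {}" using u(2)[OF topA topspace_nonempty] by blast
      ultimately show False using u(2)[of u] perp_Int_self[of X u] by blast
    qed
    have "\<Phi> (insert u U)"
    proof (rule \<Phi>I)
      show "insert u U \<subseteq> regular_opens X" using u(1) UR by simp
      fix d P N assume d: "d \<in> \<D>" and PN: "finite P" "finite N" "P \<subseteq> insert u U" "N \<subseteq> insert u U" "P \<inter> N = {}"
      define e where "e = d \<inter> \<Inter>(P - {u}) \<inter> \<Inter>(perp X ` (N - {u}))"
      have "e \<noteq> {}" unfolding e_def by (rule \<Phi>D[OF U(1) d]) (use PN in auto)
      have "e \<in> A"
      proof -
        obtain F x where F: "finite F" "F \<subseteq> J" "\<forall>j\<in>F. x j \<in> index (M j)" "d = topspace X \<inter> (\<Inter>j\<in>F. z j (x j))"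
          using d unfolding \<D>_def by blast
        let ?\<F> = "(\<lambda>j. z j (x j)) ` F \<union> (P - {u}) \<union> perp X ` (N - {u})"
        have UA: "v \<in> A" if "v \<in> U" for v using that GA by (auto simp: G_def)
        have zA: "z j (x j) \<in> A" if j: "j \<in> F" for j
        proof -
          have "j \<in> J" "x j \<in> index (M j)" using j F(2,3) by auto
          then have "z j (x j) \<in> G" unfolding G_def by blast
          then show ?thesis using GA by blast
        qed
        have "?\<F> \<subseteq> A" using PN UA zA clP by auto
        moreover have "finite ?\<F>" using F(1) PN by simp
        ultimately have "topspace X \<inter> \<Inter>?\<F> \<in> A" by (rule clF[rotated])
        moreover have "topspace X \<inter> \<Inter>?\<F> = e" unfolding e_def F(4) by (auto simp del: INT_simps)
        ultimately show ?thesis by simp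
      qed
      then have eu: "e \<inter> u \<noteq> {}" "e \<inter> perp X u \<noteq> {}" using u(2)[of e] \<open>e \<noteq> {}\<close> by auto
      consider "u \<in> P" "u \<notin> N" | "u \<in> N" "u \<notin> P" | "u \<notin> P" "u \<notin> N" using PN(5) by blast
      then show "d \<inter> \<Inter>P \<inter> \<Inter>(perp X ` N) \<noteq> {}"
      proof cases
        case 1
        then have "e \<inter> u \<subseteq> d \<inter> \<Inter>P \<inter> \<Inter>(perp X ` N)" by (auto simp: e_def)
        then show ?thesis using eu(1) by blast
      next
        case 2
        then have "e \<inter> perp X u \<subseteq> d \<inter> \<Inter>P \<inter> \<Inter>(perp X ` N)" by (auto simp: e_def)
        then show ?thesis using eu(2) by blast
      next
        case 3
        then have "e = d \<inter> \<Inter>P \<inter> \<Inter>(perp X ` N)" by (simp add: e_def)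
        then show ?thesis using \<open>e \<noteq> {}\<close> by simp
      qed
    qed
    then have "insert u U = U" by (rule U(2)) blast
    then show False using uU by blast
  qed
  then obtain a where a: "a \<in> A" "a \<noteq> {}" "\<forall>b\<in>regular_opens X. b \<subseteq> a \<longrightarrow> b \<in> A" by blast
  \<comment> \<open>Homogeneity: the part \<open>a\<close>, all of whose regular open subsets lie in
    \<open>A\<close>, has as many of them as the whole space.\<close>
  have ROC: "regular_opens X \<lesssim> ?C"
  proof -
    have "regular_opens X \<lesssim> {V \<in> regular_opens X. V \<subseteq> a}"
      by (rule regular_opens_lepoll[OF _ a(2)]) (use a(1) AR in blast)
    also have "\<dots> \<lesssim> A0" by (rule subset_imp_lepoll) (use a(3) in \<open>auto simp: A_def\<close>)
    also have "A0 \<lesssim> ?C" by (rule A0(2))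
    finally show ?thesis .
  qed
  \<comment> \<open>Within such a set the families built for finitely many other indices are
    avoided.\<close>
  define D where "D j = {d. \<exists>F. finite F \<and> F \<subseteq> J - {j} \<and> d = topspace X \<inter> (\<Inter>i\<in>F. z i None)}" for j
  have opz: "openin X (z j x)" if "j \<in> J" "x \<in> index (M j)" for j x by (rule cellularD(1)[OF cz[OF that(1)] that(2)])
  have idx: "None \<in> index (M j)" "m \<in> M j \<Longrightarrow> Some (m, n) \<in> index (M j)" for j m n by (auto simp: index_def)
  have opD: "openin X d" if j: "j \<in> J" and d: "d \<in> D j" for j d
  proof -
    obtain F where F: "finite F" "F \<subseteq> J - {j}" "d = topspace X \<inter> (\<Inter>i\<in>F. z i None)" using d unfolding D_def by blast
    show ?thesis unfolding F(3) using F(1,2) opz idx(1) by (intro openin_Int_Inter) auto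
  qed
  have Dz: "d \<inter> z j x \<in> \<D>" if j: "j \<in> J" and d: "d \<in> D j" and x: "x \<in> index (M j)" for j d x
  proof -
    obtain F where F: "finite F" "F \<subseteq> J - {j}" "d = topspace X \<inter> (\<Inter>i\<in>F. z i None)" using d unfolding D_def by blast
    let ?x = "\<lambda>i. if i = j then x else None"
    have "(\<Inter>i\<in>insert j F. z i (?x i)) = z j x \<inter> (\<Inter>i\<in>F. z i None)"
    proof -
      have "(\<Inter>i\<in>F. z i (?x i)) = (\<Inter>i\<in>F. z i None)" by (rule INF_cong) (use F(2) in auto)
      then show ?thesis by simp
    qed
    then have eq: "d \<inter> z j x = topspace X \<inter> (\<Inter>i\<in>insert j F. z i (?x i))"
      unfolding F(3) by (simp only: Int_assoc Int_commute[of "z j x"])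
    have "finite (insert j F)" "insert j F \<subseteq> J" "\<forall>i\<in>insert j F. ?x i \<in> index (M i)"
      using F(1,2) j x idx(1) by auto
    with eq show ?thesis unfolding \<D>_def mem_Collect_eq by (intro exI[of _ "insert j F"] exI[of _ ?x] conjI)
  qed
  have "\<exists>t. indep X (D j) t (M j \<rightarrow>\<^sub>E K) \<and> (\<forall>f\<in>M j \<rightarrow>\<^sub>E K. t f \<inter> z j None = {})" if j: "j \<in> J" for j
  proof -
    define b where "b m = (\<Union>n. z j (Some (m, n)))" for m
    \<comment> \<open>In the block of \<open>m\<close>, a natural number \<open>n\<close> is coded
      by the whole member \<open>Suc n\<close> and a set \<open>u\<close> by its trace on member
      \<open>0\<close>, so that the two kinds are disjoint.\<close>
    define s where "s m k = (case k of Inl n \<Rightarrow> z j (Some (m, Suc n)) | Inr u \<Rightarrow> u \<inter> z j (Some (m, 0)))" for m and k :: "nat + 'a set"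
    have dz: "z j x \<inter> z j y = {}" if "x \<in> index (M j)" "y \<in> index (M j)" "x \<noteq> y" for x y
      by (rule cellularD(3)[OF cz[OF j] that])
    have cb: "cellular X b (M j)"
    proof (rule cellularI)
      fix m assume m: "m \<in> M j"
      show "openin X (b m)" unfolding b_def using opz[OF j] idx(2)[OF m] by (intro openin_Union) auto
      show "b m \<noteq> {}" using cellularD(2)[OF cz[OF j] idx(2)[OF m]] unfolding b_def by blast
    next
      fix m m' assume m: "m \<in> M j" "m' \<in> M j" "m \<noteq> m'"
      have "z j (Some (m, n)) \<inter> z j (Some (m', n')) = {}" for n n'
        by (rule dz) (use m idx(2) in auto)
      then show "b m \<inter> b m' = {}" by (auto simp: b_def)
    qed
    have sb: "s m k \<subseteq> b m" for m k unfolding s_def b_def by (cases k) auto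
    have ind: "indep X (D j) (s m) K" if m: "m \<in> M j" for m
    proof (rule indepI)
      fix k assume k: "k \<in> K"
      show "openin X (s m k)"
      proof (cases k)
        case (Inl n)
        then show ?thesis using opz[OF j idx(2)[OF m]] by (simp add: s_def)
      next
        case (Inr u)
        then have "openin X u" using k UR regular_opens_openin by (auto simp: K_def)
        then show ?thesis using opz[OF j idx(2)[OF m]] Inr by (simp add: s_def openin_Int)
      qed
    next
      fix k F d assume k: "k \<in> K" and F: "finite F" "F \<subseteq> K - {k}" and d: "d \<in> D j"
      show "\<exists>W. openin X W \<and> W \<noteq> {} \<and> W \<subseteq> d \<inter> s m k \<and> (\<forall>l\<in>F. W \<inter> s m l = {})"
      proof (cases k)
        case (Inl n)
        define W where "W = d \<inter> z j (Some (m, Suc n))"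
        have "openin X W" unfolding W_def by (intro openin_Int opD[OF j d] opz[OF j idx(2)[OF m]])
        moreover have "W \<noteq> {}" unfolding W_def by (rule \<D>ne[OF Dz[OF j d idx(2)[OF m]]])
        moreover have "W \<subseteq> d \<inter> s m k" by (simp add: W_def s_def Inl)
        moreover have "W \<inter> s m l = {}" if l: "l \<in> F" for l
        proof (cases l)
          case (Inl n')
          then have "n' \<noteq> n" using l F(2) \<open>k = Inl n\<close> by auto
          then have "z j (Some (m, Suc n)) \<inter> z j (Some (m, Suc n')) = {}"
            by (intro dz idx(2)[OF m]) simp
          then show ?thesis by (auto simp: W_def s_def Inl)
        next
          case (Inr u)
          have "z j (Some (m, Suc n)) \<inter> z j (Some (m, 0)) = {}" by (intro dz idx(2)[OF m]) simp
          then show ?thesis by (auto simp: W_def s_def Inr)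
        qed
        ultimately show ?thesis by blast
      next
        case (Inr u)
        have uU: "u \<in> U" using k Inr by (auto simp: K_def)
        define N where "N = {v. Inr v \<in> F}"
        have N: "finite N" "N \<subseteq> U" "u \<notin> N"
        proof -
          have "N = Inr -` F" by (auto simp: N_def)
          then show "finite N" using F(1) by (simp add: finite_vimageI)
          show "N \<subseteq> U" "u \<notin> N" using F(2) Inr by (auto simp: N_def K_def)
        qed
        define W where "W = (d \<inter> z j (Some (m, 0)) \<inter> u) \<inter> \<Inter>(perp X ` N)"
        have "openin X (d \<inter> z j (Some (m, 0)) \<inter> u)"
          by (intro openin_Int opD[OF j d] opz[OF j idx(2)[OF m]] regular_opens_openin) (use uU UR in blast)
        then have "openin X W" unfolding W_def by (rule openin_Int_Inter[rotated]) (use N(1) in auto)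
        moreover have "W \<noteq> {}"
          using \<Phi>D[OF U(1) Dz[OF j d idx(2)[OF m, of 0]], of "{u}" N] N uU by (simp add: W_def)
        moreover have "W \<subseteq> d \<inter> s m k" by (auto simp: W_def s_def Inr)
        moreover have "W \<inter> s m l = {}" if l: "l \<in> F" for l
        proof (cases l)
          case (Inl n')
          have "z j (Some (m, 0)) \<inter> z j (Some (m, Suc n')) = {}" by (intro dz idx(2)[OF m]) simp
          then show ?thesis by (auto simp: W_def s_def Inl)
        next
          case (Inr v)
          then have "v \<in> N" using l by (simp add: N_def)
          then have "W \<inter> v = {}" using perp_Int_self[of X v] by (auto simp: W_def)
          then show ?thesis by (auto simp: s_def Inr)
        qed
        ultimately show ?thesis by blast
      qed
    qed
    obtain t where t: "indep X (D j) t (M j \<rightarrow>\<^sub>E K)" "\<forall>f\<in>M j \<rightarrow>\<^sub>E K. t f \<subseteq> \<Union>(b ` M j)"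
    proof (rule indep_PiE_uniform[OF cb infM[OF j] ind sb infK])
      show "M j \<lesssim> {i \<in> M j. K \<lesssim> K}" by simp
    qed
    have "b m \<inter> z j None = {}" if m: "m \<in> M j" for m
    proof -
      have "z j (Some (m, n)) \<inter> z j None = {}" for n by (intro dz idx m) simp
      then show ?thesis by (auto simp: b_def)
    qed
    then have bz: "\<Union>(b ` M j) \<inter> z j None = {}" by blast
    have "\<forall>f\<in>M j \<rightarrow>\<^sub>E K. t f \<inter> z j None = {}"
    proof
      fix f assume "f \<in> M j \<rightarrow>\<^sub>E K"
      then have "t f \<subseteq> \<Union>(b ` M j)" using t(2) by simp
      then show "t f \<inter> z j None = {}" using bz by blast
    qed
    with t(1) show ?thesis by (intro exI[of _ t] conjI)
  qed
  then have "\<forall>j\<in>J. \<exists>t. indep X (D j) t (M j \<rightarrow>\<^sub>E K) \<and> (\<forall>f\<in>M j \<rightarrow>\<^sub>E K. t f \<inter> z j None = {})" ..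
  from bchoice[OF this] obtain t where t0: "\<forall>j\<in>J. indep X (D j) (t j) (M j \<rightarrow>\<^sub>E K) \<and> (\<forall>f\<in>M j \<rightarrow>\<^sub>E K. t j f \<inter> z j None = {})" ..
  have t: "indep X (D j) (t j) (M j \<rightarrow>\<^sub>E K)" "f \<in> M j \<rightarrow>\<^sub>E K \<Longrightarrow> t j f \<inter> z j None = {}" if "j \<in> J" for j f
    using t0 that by simp_all
  have "indep X {topspace X} (\<lambda>(j, f). t j f) ?C"
  proof (rule indepI)
    fix p assume "p \<in> ?C"
    then show "openin X (case p of (j, f) \<Rightarrow> t j f)" using indep_openin[OF t(1)] by auto
  next
    fix p \<F> d assume p: "p \<in> ?C" and \<F>: "finite \<F>" "\<F> \<subseteq> ?C - {p}" and d: "d \<in> {topspace X}"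
    obtain j f where jf: "p = (j, f)" "j \<in> J" "f \<in> M j \<rightarrow>\<^sub>E K" using p by blast
    define I where "I = fst ` \<F> - {j}"
    define F where "F = Pair j -` \<F>"
    have I: "finite I" "I \<subseteq> J - {j}" using \<F> by (auto simp: I_def)
    have F: "finite F" "F \<subseteq> (M j \<rightarrow>\<^sub>E K) - {f}"
    proof -
      show "finite F" unfolding F_def by (rule finite_vimageI[OF \<F>(1)]) (simp add: inj_def)
      show "F \<subseteq> (M j \<rightarrow>\<^sub>E K) - {f}" using \<F>(2) jf by (auto simp: F_def)
    qed
    have dD: "topspace X \<inter> (\<Inter>i\<in>I. z i None) \<in> D j" using I unfolding D_def by blast
    obtain W where W: "openin X W" "W \<noteq> {}" "W \<subseteq> topspace X \<inter> (\<Inter>i\<in>I. z i None)" "W \<subseteq> t j f" "\<forall>g\<in>F. W \<inter> t j g = {}"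
      by (rule indepE[OF t(1)[OF jf(2)] jf(3) F dD])
    have "W \<inter> t i g = {}" if ig: "(i, g) \<in> \<F>" for i g
    proof (cases "i = j")
      case True
      then show ?thesis using W(5) ig by (auto simp: F_def)
    next
      case False
      then have "i \<in> I" using ig by (force simp: I_def)
      then have "W \<subseteq> z i None" using W(3) by blast
      moreover have "i \<in> J" "g \<in> M i \<rightarrow>\<^sub>E K" using ig \<F>(2) by auto
      ultimately show ?thesis using t(2)[of i g] by blast
    qed
    then show "\<exists>W. openin X W \<and> W \<noteq> {} \<and> W \<subseteq> d \<inter> (case p of (j, f) \<Rightarrow> t j f) \<and> (\<forall>q\<in>\<F>. W \<inter> (case q of (j, f) \<Rightarrow> t j f) = {})"
      using W(1-4) d jf(1) by (intro exI[of _ W]) auto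
  qed
  from indep_lepoll[OF this _ ROC, of UNIV] show ?thesis by blast
qed

text \<open>The cases are whether the small sizes have a maximum; \<open>undefined\<close> merely
  names the single index of the first case.\<close>

lemma indep_regular_opens: "\<exists>s. indep X {topspace X} s (regular_opens X)"
proof (cases "\<exists>N\<subseteq>\<Theta>. \<not> \<Theta> \<lesssim> N \<and> (\<forall>N'\<subseteq>\<Theta>. \<not> \<Theta> \<lesssim> N' \<longrightarrow> N' \<lesssim> N)")
  case True
  then obtain N where "N \<subseteq> \<Theta> \<and> \<not> \<Theta> \<lesssim> N \<and> (\<forall>N'\<subseteq>\<Theta>. \<not> \<Theta> \<lesssim> N' \<longrightarrow> N' \<lesssim> N)" ..
  then have N: "\<not> \<Theta> \<lesssim> N" "\<forall>N'\<subseteq>\<Theta>. \<not> \<Theta> \<lesssim> N' \<longrightarrow> N' \<lesssim> N" by simp_all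
  have "N' \<lesssim> N" if "N' \<subseteq> \<Theta>" "\<not> \<Theta> \<lesssim> N'" for N' using N(2) that by simp
  from antichain_system_attained[OF N(1) this, of undefined]
  obtain z where "antichain_system {undefined :: 't} (\<lambda>_. N) (\<lambda>_. {undefined}) z" ..
  then show ?thesis by (rule indep_regular_opens_of_system)
next
  case False
  then have "\<exists>N'\<subseteq>\<Theta>. \<not> \<Theta> \<lesssim> N' \<and> \<not> N' \<lesssim> N" if "N \<subseteq> \<Theta>" "\<not> \<Theta> \<lesssim> N" for N using that by blast
  from antichain_system_unattained[OF this]
  obtain z where "antichain_system \<Theta> (\<lambda>j. (UNIV::nat set) <+> underS |\<Theta>| j) (\<lambda>j. underS |\<Theta>| j) z" ..
  then show ?thesis by (rule indep_regular_opens_of_system)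
qed

end

subsection \<open>Decomposition into homogeneous pieces\<close>

definition regular_below :: "'a topology \<Rightarrow> 'a set \<Rightarrow> 'a set set" where
  "regular_below X b = {U \<in> regular_opens X. U \<subseteq> b}"

lemma perp_subtopology: "U \<subseteq> b \<Longrightarrow> b \<subseteq> topspace X \<Longrightarrow> perp (subtopology X b) U = b \<inter> perp X U"
  by (auto simp: perp_def closure_of_subtopology Int_absorb1)

lemma regular_opens_subtopology:
  assumes b: "b \<in> regular_opens X"
  shows "regular_opens (subtopology X b) = regular_below X b"
proof -
  have opb: "openin X b" by (rule regular_opens_openin[OF b])
  have bT: "b \<subseteq> topspace X" by (rule openin_subset[OF opb])
  have pp: "perp (subtopology X b) (perp (subtopology X b) U) = b \<inter> perp X (b \<inter> perp X U)" if "U \<subseteq> b" for U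
    by (simp add: perp_subtopology that bT)
  have "U \<in> regular_opens (subtopology X b) \<longleftrightarrow> U \<in> regular_below X b" for U
  proof
    assume U: "U \<in> regular_opens (subtopology X b)"
    then have Ub: "U \<subseteq> b" by (auto simp: regular_opens_def)
    then have "U = b \<inter> perp X (b \<inter> perp X U)" using U pp[OF Ub] by (simp add: regular_opens_iff)
    moreover have "b \<inter> perp X (b \<inter> perp X U) \<in> regular_opens X"
      by (intro regular_opens_Int b perp_regular openin_Int opb openin_perp)
    ultimately show "U \<in> regular_below X b" using Ub by (simp add: regular_below_def)
  next
    assume U: "U \<in> regular_below X b"
    then have Ub: "U \<subseteq> b" and opU: "openin X U" and ppU: "perp X (perp X U) = U"
      by (auto simp: regular_below_def regular_opens_openin regular_opens_iff)
    let ?W = "b \<inter> perp X (b \<inter> perp X U)"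
    have "U \<inter> (b \<inter> perp X U) = {}" using perp_Int_self[of X U] by blast
    then have "U \<subseteq> ?W" using Ub subset_perp_iff[OF opU] by blast
    moreover have "?W \<inter> perp X U = {}" using perp_Int_self[of X "b \<inter> perp X U"] by blast
    then have "?W \<subseteq> U" using subset_perp_iff[of X ?W "perp X U"] opb ppU by (simp add: openin_Int)
    ultimately have "?W = U" by blast
    then show "U \<in> regular_opens (subtopology X b)" using pp[OF Ub] by (simp add: regular_opens_iff)
  qed
  then show ?thesis by blast
qed

lemma cellular_subtopology:
  assumes "openin X b"
  shows "cellular (subtopology X b) a I \<longleftrightarrow> cellular X a I \<and> (\<forall>i\<in>I. a i \<subseteq> b)"
  unfolding cellular_def by (auto simp: openin_open_subtopology[OF assms])

lemma indep_subtopology: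
  assumes b: "openin X b" and s: "indep (subtopology X b) {b} s K"
  shows "indep X {topspace X} s K" "\<forall>k\<in>K. s k \<subseteq> b"
proof -
  have op: "openin X (s k) \<and> s k \<subseteq> b" if "k \<in> K" for k
    using indep_openin[OF s that] by (simp add: openin_open_subtopology[OF b])
  then show "\<forall>k\<in>K. s k \<subseteq> b" by blast
  show "indep X {topspace X} s K"
  proof (rule indepI)
    fix k F d assume k: "k \<in> K" and F: "finite F" "F \<subseteq> K - {k}" and d: "d \<in> {topspace X}"
    obtain W where W: "openin (subtopology X b) W" "W \<noteq> {}" "W \<subseteq> b" "W \<subseteq> s k" "\<forall>l\<in>F. W \<inter> s l = {}"
      by (rule indepE[OF s k F singletonI])
    then have "openin X W" by (simp add: openin_open_subtopology[OF b])
    then show "\<exists>W. openin X W \<and> W \<noteq> {} \<and> W \<subseteq> d \<inter> s k \<and> (\<forall>l\<in>F. W \<inter> s l = {})"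
      using W d openin_subset[of X W] by (intro exI[of _ W]) auto
  qed (use op in blast)
qed

lemma cellular_indep: "cellular X a I \<Longrightarrow> indep X {topspace X} a I"
proof (rule indepI)
  fix k F d assume a: "cellular X a I" and k: "k \<in> I" and F: "F \<subseteq> I - {k}" and d: "d \<in> {topspace X}"
  have "a k \<inter> a l = {}" if "l \<in> F" for l by (rule cellularD(3)[OF a k]) (use that F in auto)
  then show "\<exists>W. openin X W \<and> W \<noteq> {} \<and> W \<subseteq> d \<inter> a k \<and> (\<forall>l\<in>F. W \<inter> a l = {})"
    using cellularD(1,2)[OF a k] openin_subset[OF cellularD(1)[OF a k]] d by (intro exI[of _ "a k"]) auto
qed (rule cellularD(1))

text \<open>Two minimizations: \<open>b1\<close> minimizes the number of regular open subsets, and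
  \<open>\<Theta>\<close> the sizes of antichains that are missing below some part of
  \<open>b1\<close>. Smaller parts inherit the first minimum, and every size below
  \<open>|\<Theta>|\<close> occurs in each of them.\<close>

lemma exists_homogeneous_piece:
  assumes c: "c \<in> regular_opens X" "c \<noteq> {}"
  shows "\<exists>b\<in>regular_opens X. b \<noteq> {} \<and> b \<subseteq> c \<and> (finite (regular_below X b) \<or>
    (\<exists>s. indep X {topspace X} s (regular_below X b) \<and> (\<forall>k\<in>regular_below X b. s k \<subseteq> b)))"
proof -
  let ?B = "\<lambda>c. {b \<in> regular_opens X. b \<noteq> {} \<and> b \<subseteq> c}"
  have "regular_below X c \<in> regular_below X ` ?B c" using c by blast
  then obtain R where R: "R \<in> regular_below X ` ?B c" "\<forall>C\<in>regular_below X ` ?B c. R \<lesssim> C"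
    by (rule exists_minimal_lepoll)
  then obtain b1 where b1: "b1 \<in> ?B c" "R = regular_below X b1" by blast
  have min: "regular_below X b1 \<lesssim> regular_below X b" if "b \<in> ?B b1" for b
    unfolding b1(2)[symmetric] by (rule bspec[OF R(2) imageI]) (use that b1(1) in auto)
  show ?thesis
  proof (cases "finite (regular_below X b1)")
    case True
    then show ?thesis using b1(1) by blast
  next
    case inf: False
    \<comment> \<open>The index type \<open>'a set set\<close> is large enough: an antichain indexed
      by all of it would inject it into \<open>'a set\<close>, against Cantor. So some size fails,
      and there is a least one.\<close>
    define cel where "cel \<Theta> b \<longleftrightarrow> (\<exists>a. cellular X a \<Theta> \<and> (\<forall>j\<in>\<Theta>. a j \<subseteq> b))" for \<Theta> :: "'a set set set" and b
    let ?S = "{\<Theta>. \<exists>b\<in>?B b1. \<not> cel \<Theta> b}"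
    have "\<not> cel UNIV b1"
    proof
      assume "cel UNIV b1"
      then obtain a :: "'a set set \<Rightarrow> 'a set" where a: "cellular X a UNIV" unfolding cel_def by blast
      have "inj a"
      proof (rule injI)
        fix i j assume "a i = a j"
        then show "i = j" using cellularD(3)[OF a, of i j] cellularD(2)[OF a, of i] by auto
      qed
      then have "Pow (UNIV :: 'a set set) \<lesssim> (UNIV :: 'a set set)" by (auto simp: lepoll_def)
      then show False using lesspoll_Pow_self[of "UNIV :: 'a set set"] lesspoll_trans2 lesspoll_not_refl by blast
    qed
    then have "UNIV \<in> ?S" using b1(1) by blast
    then obtain \<Theta> where \<Theta>: "\<Theta> \<in> ?S" "\<forall>C\<in>?S. \<Theta> \<lesssim> C" by (rule exists_minimal_lepoll)
    then obtain b where b: "b \<in> ?B b1" "\<not> cel \<Theta> b" by blast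
    have bR: "b \<in> regular_opens X" and opb: "openin X b" and bne: "b \<noteq> {}" and bc: "b \<subseteq> c"
      using b(1) b1(1) regular_opens_openin by auto
    note sub = regular_opens_subtopology[OF bR]
    interpret S: homogeneous_space "subtopology X b" \<Theta>
    proof
      show "infinite (regular_opens (subtopology X b))"
        unfolding sub using min[OF b(1)] inf lepoll_finite by blast
    next
      fix c' assume c': "c' \<in> regular_opens (subtopology X b)" "c' \<noteq> {}"
      then have c'R: "c' \<in> regular_opens X" "c' \<subseteq> b" unfolding sub by (auto simp: regular_below_def)
      have "regular_below X b \<subseteq> regular_below X b1" using b(1) by (auto simp: regular_below_def)
      then have "regular_below X b \<lesssim> regular_below X b1" by (rule subset_imp_lepoll)
      also have "\<dots> \<lesssim> regular_below X c'" by (rule min) (use c'(2) c'R b(1) in auto)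
      also have "\<dots> = {U \<in> regular_opens (subtopology X b). U \<subseteq> c'}"
        unfolding sub using c'R(2) by (auto simp: regular_below_def)
      finally show "regular_opens (subtopology X b) \<lesssim> {U \<in> regular_opens (subtopology X b). U \<subseteq> c'}"
        unfolding sub .
    next
      fix c' and L :: "'a set set set"
      assume c': "openin (subtopology X b) c'" "c' \<noteq> {}" and L: "L \<subseteq> \<Theta>" "\<not> \<Theta> \<lesssim> L"
      have opc: "openin X c'" "c' \<subseteq> b" using c'(1) by (simp_all add: openin_open_subtopology[OF opb])
      \<comment> \<open>Minimality of \<open>\<Theta>\<close> speaks about regular open sets, so
        \<open>c'\<close> is replaced by its regularization \<open>d\<close>. Every nonempty open
        subset of \<open>d\<close> meets \<open>c'\<close>, and thus the antichain can be cut down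
        to \<open>c'\<close>.\<close>
      define d where "d = perp X (perp X c')"
      have "d \<subseteq> perp X (perp X b)" unfolding d_def by (intro perp_antimono opc(2))
      then have "d \<subseteq> b" using bR by (simp add: regular_opens_iff)
      moreover have cd: "c' \<subseteq> d" unfolding d_def by (rule subset_perp_perp[OF opc(1)])
      moreover have "d \<in> regular_opens X" by (simp add: d_def)
      ultimately have dB: "d \<in> ?B b1" using c'(2) b(1) by auto
      have "cel L d"
      proof (rule ccontr)
        assume "\<not> cel L d"
        then have "L \<in> ?S" using dB by blast
        from bspec[OF \<Theta>(2) this] show False using L(2) by simp
      qed
      then obtain a where a: "cellular X a L" "\<forall>j\<in>L. a j \<subseteq> d" unfolding cel_def by blast
      have "cellular X (\<lambda>j. a j \<inter> c') L"
      proof (rule cellularI)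
        fix j assume j: "j \<in> L"
        show "openin X (a j \<inter> c')" by (rule openin_Int[OF cellularD(1)[OF a(1) j] opc(1)])
        show "a j \<inter> c' \<noteq> {}"
        proof
          assume "a j \<inter> c' = {}"
          then have "a j \<inter> d = {}" unfolding d_def by (rule perp_perp_disjoint[OF cellularD(1)[OF a(1) j] opc(1)])
          then show False using a(2) j cellularD(2)[OF a(1) j] by blast
        qed
      next
        fix i j assume "i \<in> L" "j \<in> L" "i \<noteq> j"
        then have "a i \<inter> a j = {}" by (rule cellularD(3)[OF a(1)])
        then show "(a i \<inter> c') \<inter> (a j \<inter> c') = {}" by blast
      qed
      then have "cellular (subtopology X b) (\<lambda>j. a j \<inter> c') L"
        unfolding cellular_subtopology[OF opb] using opc(2) by blast
      then show "\<exists>a. cellular (subtopology X b) a L \<and> (\<forall>j\<in>L. a j \<subseteq> c')"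
        by (intro exI[of _ "\<lambda>j. a j \<inter> c'"]) simp
    next
      fix a show "\<not> cellular (subtopology X b) a \<Theta>"
        using b(2) unfolding cel_def cellular_subtopology[OF opb] by blast
    qed
    have "topspace (subtopology X b) = b" using openin_subset[OF opb] by auto
    then obtain s where "indep (subtopology X b) {b} s (regular_below X b)"
      using S.indep_regular_opens unfolding sub by auto
    from indep_subtopology[OF opb this] show ?thesis using bR bne bc by blast
  qed
qed

text \<open>Its traces on a maximal disjoint family of pieces determine a regular open set, so the
  algebra embeds in a product over the pieces. Pieces with an infinite algebra are glued by
  \<open>indep_PiE\<close>; those with a finite one are too poor by themselves and, if infinitely
  many, are regrouped into blocks of countably many.\<close>

theorem exists_indep_regular_opens:
  assumes inf: "infinite (regular_opens X)"
  shows "\<exists>s. indep X {topspace X} s (regular_opens X)"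
proof -
  let ?R = "regular_below X"
  define \<G> where "\<G> = {b \<in> regular_opens X. b \<noteq> {} \<and> (finite (?R b) \<or>
    (\<exists>s. indep X {topspace X} s (?R b) \<and> (\<forall>k\<in>?R b. s k \<subseteq> b)))}"
  have "{} \<notin> \<G>" by (simp add: \<G>_def)
  then obtain \<V> where \<V>: "\<V> \<subseteq> \<G>" "disjoint \<V>" "\<forall>g\<in>\<G>. \<exists>v\<in>\<V>. g \<inter> v \<noteq> {}"
    by (rule exists_maximal_disjoint)
  have \<V>R: "v \<in> regular_opens X" "v \<noteq> {}" if "v \<in> \<V>" for v using that \<V>(1) by (auto simp: \<G>_def)
  have dense: "\<exists>v\<in>\<V>. c \<inter> v \<noteq> {}" if c: "c \<in> regular_opens X" "c \<noteq> {}" for c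
  proof -
    obtain b where b: "b \<in> \<G>" "b \<subseteq> c" using exists_homogeneous_piece[OF c] by (auto simp: \<G>_def)
    then show ?thesis using \<V>(3) by blast
  qed
  have cellV: "cellular X (\<lambda>v. v) \<V>"
  proof (rule cellularI)
    show "openin X v" if "v \<in> \<V>" for v by (rule regular_opens_openin[OF \<V>R(1)[OF that]])
  qed (use \<V>R \<V>(2) in \<open>auto simp: disjoint_def\<close>)
  define \<V>0 where "\<V>0 = {v \<in> \<V>. finite (?R v)}"
  define \<V>1 where "\<V>1 = {v \<in> \<V>. infinite (?R v)}"
  have "regular_opens X \<lesssim> PiE \<V> ?R"
    unfolding lepoll_def
  proof (intro exI conjI)
    have le: "U \<subseteq> V" if U: "U \<in> regular_opens X" "V \<in> regular_opens X"
      and eq: "(\<lambda>v\<in>\<V>. U \<inter> v) = (\<lambda>v\<in>\<V>. V \<inter> v)" for U V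
    proof (rule ccontr)
      assume "\<not> U \<subseteq> V"
      then have "U \<inter> perp X V \<noteq> {}"
        using subset_perp_iff[OF regular_opens_openin[OF U(1)], of "perp X V"] U(2) by (simp add: regular_opens_iff)
      moreover have "U \<inter> perp X V \<in> regular_opens X"
        by (intro regular_opens_Int U(1) perp_regular regular_opens_openin U(2))
      ultimately obtain v where v: "v \<in> \<V>" "U \<inter> perp X V \<inter> v \<noteq> {}" using dense by blast
      have "U \<inter> v = V \<inter> v" using fun_cong[OF eq, of v] v(1) by simp
      then show False using v(2) perp_Int_self[of X V] by blast
    qed
    show "inj_on (\<lambda>U. \<lambda>v\<in>\<V>. U \<inter> v) (regular_opens X)"
    proof (rule inj_onI)
      fix U V assume "U \<in> regular_opens X" "V \<in> regular_opens X" "(\<lambda>v\<in>\<V>. U \<inter> v) = (\<lambda>v\<in>\<V>. V \<inter> v)"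
      then show "U = V" using le[of U V] le[of V U] by auto
    qed
    show "(\<lambda>U. \<lambda>v\<in>\<V>. U \<inter> v) ` regular_opens X \<subseteq> PiE \<V> ?R"
    proof (rule image_subsetI)
      fix U assume U: "U \<in> regular_opens X"
      have "U \<inter> v \<in> ?R v" if "v \<in> \<V>" for v
        using regular_opens_Int[OF U \<V>R(1)[OF that]] by (simp add: regular_below_def)
      then show "(\<lambda>v\<in>\<V>. U \<inter> v) \<in> PiE \<V> ?R" by auto
    qed
  qed
  also have "PiE \<V> ?R \<lesssim> PiE \<V>0 ?R \<times> PiE \<V>1 ?R"
    by (rule PiE_split_lepoll) (auto simp: \<V>0_def \<V>1_def)
  finally have RO: "regular_opens X \<lesssim> PiE \<V>0 ?R \<times> PiE \<V>1 ?R" .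
  have one: "\<exists>t. indep X {topspace X} t (PiE \<V>1 ?R)" if ne: "\<V>1 \<noteq> {}"
  proof -
    have "\<forall>v\<in>\<V>1. \<exists>s. indep X {topspace X} s (?R v) \<and> (\<forall>k\<in>?R v. s k \<subseteq> v)"
      using \<V>(1) by (auto simp: \<V>1_def \<G>_def)
    from bchoice[OF this] obtain s where s: "\<forall>v\<in>\<V>1. indep X {topspace X} (s v) (?R v) \<and> (\<forall>k\<in>?R v. s v k \<subseteq> v)" ..
    have "\<exists>t. indep X {topspace X} t (PiE \<V>1 ?R) \<and> (\<forall>f\<in>PiE \<V>1 ?R. t f \<subseteq> \<Union>((\<lambda>v. v) ` \<V>1))"
    proof (rule indep_PiE[OF cellular_subset[OF cellV] ne])
      show "\<V>1 \<subseteq> \<V>" by (auto simp: \<V>1_def)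
      show "infinite (?R v)" if "v \<in> \<V>1" for v using that by (simp add: \<V>1_def)
      show "indep X {topspace X} (s v) (?R v)" if "v \<in> \<V>1" for v using s that by simp
      show "s v k \<subseteq> v" if "v \<in> \<V>1" "k \<in> ?R v" for v k using s that by simp
    qed
    then show ?thesis by blast
  qed
  have inf1: "infinite (PiE \<V>1 ?R)" if "\<V>1 \<noteq> {}"
  proof -
    obtain v where "v \<in> \<V>1" using \<open>\<V>1 \<noteq> {}\<close> by blast
    then show ?thesis by (rule infinite_PiE) (simp add: \<V>1_def)
  qed
  let ?N = "\<V>0 \<rightarrow>\<^sub>E (UNIV :: nat set)"
  have zero: "\<exists>t. indep X {topspace X} t ?N" if inf0: "infinite \<V>0"
  proof -
    \<comment> \<open>As \<open>\<V>0\<close> is as large as its product with the naturals, it can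
      be split into \<open>|\<V>0|\<close> blocks of countably many cells; the cells of a block are
      a countable independent family, being disjoint.\<close>
    have "\<V>0 \<times> (UNIV :: nat set) \<lesssim> \<V>0"
      by (rule times_lepoll_infinite[OF inf0 lepoll_refl]) (use inf0 infinite_le_lepoll in blast)
    then obtain h where h: "inj_on h (\<V>0 \<times> (UNIV :: nat set))" "h ` (\<V>0 \<times> UNIV) \<subseteq> \<V>0"
      by (rule lepollE)
    have "h ` (\<V>0 \<times> UNIV) \<subseteq> \<V>" using h(2) by (auto simp: \<V>0_def)
    from cellular_comp[OF cellV h(1) this] have ch: "cellular X h (\<V>0 \<times> UNIV)" .
    let ?b = "\<lambda>v. \<Union>n. h (v, n)"
    have cb: "cellular X ?b \<V>0"
    proof (rule cellularI)
      fix v assume v: "v \<in> \<V>0"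
      show "openin X (?b v)" using cellularD(1)[OF ch] v by (intro openin_Union) auto
      show "?b v \<noteq> {}" using cellularD(2)[OF ch, of "(v, 0)"] v by blast
    next
      fix v w assume vw: "v \<in> \<V>0" "w \<in> \<V>0" "v \<noteq> w"
      have "h (v, n) \<inter> h (w, m) = {}" for n m by (rule cellularD(3)[OF ch]) (use vw in auto)
      then show "?b v \<inter> ?b w = {}" by auto
    qed
    obtain t where "indep X {topspace X} t ?N" "\<forall>f\<in>?N. t f \<subseteq> \<Union>(?b ` \<V>0)"
    proof (rule indep_PiE_uniform[OF cb inf0, where s = "\<lambda>v n. h (v, n)"])
      fix v assume v: "v \<in> \<V>0"
      have "cellular X (\<lambda>n. h (v, n)) UNIV"
        by (rule cellular_comp[OF ch]) (use v in \<open>auto simp: inj_on_def\<close>)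
      then show "indep X {topspace X} (\<lambda>n. h (v, n)) UNIV" by (rule cellular_indep)
    qed auto
    then show ?thesis by blast
  qed
  have zero_le: "PiE \<V>0 ?R \<lesssim> ?N"
    by (rule lepoll_PiE) (auto simp: \<V>0_def intro: finite_lepoll_infinite)
  have sT: "t k \<subseteq> topspace X" if "indep X {topspace X} t K" "k \<in> K" for t :: "'k \<Rightarrow> 'a set" and K k
    using indep_openin[OF that] by (rule openin_subset)
  have use_single: ?thesis if t: "indep X {topspace X} t K" and K: "regular_opens X \<lesssim> K" for t :: "'k \<Rightarrow> 'a set" and K
    using indep_lepoll[OF t _ K, of UNIV] by blast
  show ?thesis
  proof (cases "\<V>1 = {}")
    case True
    have "PiE \<V>0 ?R \<times> PiE \<V>1 ?R \<lesssim> PiE \<V>0 ?R"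
      unfolding True by (rule subset_image_lepoll[of _ "\<lambda>f. (f, \<lambda>_. undefined)"]) auto
    then have RO0: "regular_opens X \<lesssim> PiE \<V>0 ?R" using RO lepoll_trans by blast
    have "infinite \<V>0"
    proof
      assume "finite \<V>0"
      then have "finite (PiE \<V>0 ?R)" by (rule finite_PiE) (simp add: \<V>0_def)
      then show False using RO0 inf lepoll_finite by blast
    qed
    from zero[OF this] show ?thesis using indep_lepoll[OF _ _ lepoll_trans[OF RO0 zero_le], of X _ _ UNIV] by blast
  next
    case ne: False
    obtain t1 where t1: "indep X {topspace X} t1 (PiE \<V>1 ?R)" using one[OF ne] by blast
    show ?thesis
    proof (cases "finite \<V>0")
      case True
      then have "finite (PiE \<V>0 ?R)" by (rule finite_PiE) (simp add: \<V>0_def)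
      then have "PiE \<V>0 ?R \<lesssim> PiE \<V>1 ?R" by (rule finite_lepoll_infinite[OF inf1[OF ne]])
      then have "PiE \<V>0 ?R \<times> PiE \<V>1 ?R \<lesssim> PiE \<V>1 ?R" by (rule times_lepoll_infinite[OF inf1[OF ne] _ lepoll_refl])
      with RO have "regular_opens X \<lesssim> PiE \<V>1 ?R" by (rule lepoll_trans)
      from indep_lepoll[OF t1 _ this, of UNIV] show ?thesis by blast
    next
      case inf0: False
      obtain t0 where t0: "indep X {topspace X} t0 ?N" using zero[OF inf0] by blast
      have "\<not> (UNIV :: nat set) \<subseteq> {n}" for n using finite_subset infinite_UNIV_nat by blast
      then have "infinite ?N" using inf0 by (auto simp: finite_funcset_iff)
      moreover have "regular_opens X \<lesssim> ?N \<times> PiE \<V>1 ?R"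
        by (rule lepoll_trans[OF RO times_lepoll_mono[OF zero_le lepoll_refl]])
      ultimately show ?thesis using indep_Times[OF t0 _ _ t1 _ inf1[OF ne], of UNIV "regular_opens X"] by blast
    qed
  qed
qed

subsection \<open>Topologies of uniform convergence\<close>

lemma Pow_lepoll_mono:
  assumes "A \<lesssim> B" shows "Pow A \<lesssim> Pow B"
proof -
  obtain f where f: "inj_on f A" "f ` A \<subseteq> B" using assms by (rule lepollE)
  have "inj_on (image f) (Pow A)" by (rule inj_on_image_Pow[OF f(1)])
  moreover have "image f ` Pow A \<subseteq> Pow B" using f(2) by blast
  ultimately show ?thesis unfolding lepoll_def by blast
qed

lemma directed_families_imageI:
  assumes ne: "\<A> \<noteq> {}" and sub: "\<And>A. A \<in> \<A> \<Longrightarrow> f A \<subseteq> topspace X"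
    and dir: "\<And>A B. A \<in> \<A> \<Longrightarrow> B \<in> \<A> \<Longrightarrow> \<exists>E\<in>\<A>. f A \<union> f B \<subseteq> f E"
  shows "f ` \<A> \<in> directed_families X"
  unfolding directed_families_def
proof (intro CollectI conjI ballI)
  fix P R assume "P \<in> f ` \<A>" "R \<in> f ` \<A>"
  then obtain A B where AB: "A \<in> \<A>" "B \<in> \<A>" "P = f A" "R = f B" by (elim imageE)
  from dir[OF AB(1,2)] obtain E where "E \<in> \<A>" "f A \<union> f B \<subseteq> f E" ..
  then show "\<exists>E\<in>f ` \<A>. P \<union> R \<subseteq> E" unfolding AB(3,4) by (intro bexI[of _ "f E"] imageI)
qed (use ne sub in auto)

lemma directed_family_Fpow:
  assumes "\<And>F. F \<in> Fpow Y \<Longrightarrow> \<Union>(s ` F) \<subseteq> topspace X"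
  shows "(\<lambda>F. \<Union>(s ` F)) ` Fpow Y \<in> directed_families X"
proof (rule directed_families_imageI[OF Fpow_not_empty assms])
  fix F G assume "F \<in> Fpow Y" "G \<in> Fpow Y"
  then show "\<exists>E\<in>Fpow Y. \<Union>(s ` F) \<union> \<Union>(s ` G) \<subseteq> \<Union>(s ` E)"
    by (intro bexI[of _ "F \<union> G"]) (auto simp: Fpow_def)
qed

text \<open>The set \<open>U\<close> below is a neighbourhood of \<open>0\<close> for \<open>\<alpha>\<close>. If some point of \<open>A\<close> lies outside
  the closure of \<open>B\<close>, a function vanishing on \<open>B\<close> and equal to \<open>1\<close> there leaves \<open>U\<close>.\<close>
lemma C_alpha_eq_imp_subset_closure:
  assumes X: "completely_regular_space X" and \<alpha>: "\<alpha> \<in> directed_families X" and \<beta>: "\<beta> \<in> directed_families X"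
    and eq: "C_alpha X \<alpha> = C_alpha X \<beta>" and A: "A \<in> \<alpha>"
  shows "\<exists>B\<in>\<beta>. A \<subseteq> X closure_of B"
proof -
  \<comment> \<open>The bound \<open>\<delta>\<close> is uniform on \<open>A\<close>: the pointwise
    condition \<open>\<bar>f x\<bar> < 1\<close> would leave no margin \<open>\<epsilon>\<close>
    when the supremum over \<open>A\<close> is \<open>1\<close>.\<close>
  define U where "U = {f \<in> cont_funs X. \<exists>\<delta><1. \<forall>x\<in>A. \<bar>f x\<bar> \<le> \<delta>}"
  have AT: "A \<subseteq> topspace X" using \<alpha> A by (auto simp: directed_families_def)
  have "openin (C_alpha X \<alpha>) U"
    unfolding openin_C_alpha[OF \<alpha>]
  proof (intro conjI ballI)
    fix f assume "f \<in> U"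
    then obtain \<delta> where \<delta>: "f \<in> cont_funs X" "\<delta> < 1" "\<forall>x\<in>A. \<bar>f x\<bar> \<le> \<delta>" by (auto simp: U_def)
    have "{g \<in> cont_funs X. \<forall>x\<in>A. \<bar>f x - g x\<bar> < (1 - \<delta>) / 2} \<subseteq> U"
    proof
      fix g assume g: "g \<in> {g \<in> cont_funs X. \<forall>x\<in>A. \<bar>f x - g x\<bar> < (1 - \<delta>) / 2}"
      have "\<bar>g x\<bar> \<le> (1 + \<delta>) / 2" if "x \<in> A" for x
      proof -
        have "\<bar>f x - g x\<bar> < (1 - \<delta>) / 2" "\<bar>f x\<bar> \<le> \<delta>" using g \<delta>(3) that by auto
        then show ?thesis by (simp add: field_simps abs_if split: if_splits)
      qed
      moreover have "(1 + \<delta>) / 2 < 1" using \<delta>(2) by simp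
      ultimately show "g \<in> U" using g unfolding U_def by blast
    qed
    moreover have "(1 - \<delta>) / 2 > 0" using \<delta>(2) by simp
    ultimately show "\<exists>A\<in>\<alpha>. \<exists>\<epsilon>>0. {g \<in> cont_funs X. \<forall>x\<in>A. \<bar>f x - g x\<bar> < \<epsilon>} \<subseteq> U" using A by blast
  qed (auto simp: U_def)
  then have opU: "openin (C_alpha X \<beta>) U" by (simp add: eq)
  let ?z = "\<lambda>x\<in>topspace X. 0 :: real"
  have cont_restrict: "(\<lambda>x\<in>topspace X. f x) \<in> cont_funs X" if "continuous_map X euclideanreal f" for f
    unfolding cont_funs_def using continuous_map_eq[OF that, of "\<lambda>x\<in>topspace X. f x"] by simp
  have "?z \<in> cont_funs X" by (rule cont_restrict) simp
  moreover have "\<forall>x\<in>A. \<bar>?z x\<bar> \<le> 0" using AT by auto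
  ultimately have "?z \<in> U" unfolding U_def using zero_less_one by blast
  then obtain B \<epsilon> where B: "B \<in> \<beta>" "\<epsilon> > 0" "{g \<in> cont_funs X. \<forall>x\<in>B. \<bar>?z x - g x\<bar> < \<epsilon>} \<subseteq> U"
    using opU unfolding openin_C_alpha[OF \<beta>] by blast
  have BT: "B \<subseteq> topspace X" using \<beta> B(1) by (auto simp: directed_families_def)
  have "x \<in> X closure_of B" if x: "x \<in> A" for x
  proof (rule ccontr)
    assume "x \<notin> X closure_of B"
    then have "closedin X (X closure_of B) \<and> x \<in> topspace X - X closure_of B" using x AT by auto
    then obtain h :: "'a \<Rightarrow> real" where h: "continuous_map X (top_of_set {0..1}) h" "h x = 0" "h ` (X closure_of B) \<subseteq> {1}"
      using X unfolding completely_regular_space_def by blast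
    \<comment> \<open>Complete regularity gives \<open>0\<close> at the point and \<open>1\<close>
      on the closed set; the subtraction exchanges the two values.\<close>
    let ?g = "\<lambda>x\<in>topspace X. 1 - h x"
    have "continuous_map X euclideanreal h" using h(1) by (simp add: continuous_map_in_subtopology)
    then have "continuous_map X euclideanreal (\<lambda>x. 1 - h x)" by (intro continuous_intros) auto
    then have g: "?g \<in> cont_funs X" by (rule cont_restrict)
    have "\<bar>?z y - ?g y\<bar> < \<epsilon>" if "y \<in> B" for y
    proof -
      have "y \<in> X closure_of B" using closure_of_subset[OF BT] that by blast
      then have "h y = 1" using h(3) by blast
      then show ?thesis using that BT B(2) by auto
    qed
    then have "?g \<in> U" using g B(3) by blast
    then obtain \<delta> where "\<delta> < 1" "\<bar>?g x\<bar> \<le> \<delta>" using x by (auto simp: U_def)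
    then show False using h(2) x AT by (auto split: if_splits)
  qed
  then show ?thesis using B(1) by blast
qed

text \<open>For continuous \<open>f\<close> and \<open>g\<close> a bound
  \<open>\<epsilon> / 2\<close> on \<open>A\<close> persists, as a weak inequality, on the closure;
  so the two kinds of neighbourhoods agree up to halving \<open>\<epsilon>\<close>.\<close>

lemma C_alpha_closure:
  assumes \<alpha>: "\<alpha> \<in> directed_families X"
  shows "(\<lambda>A. X closure_of A) ` \<alpha> \<in> directed_families X" "C_alpha X ((\<lambda>A. X closure_of A) ` \<alpha>) = C_alpha X \<alpha>"
proof -
  let ?\<beta> = "(\<lambda>A. X closure_of A) ` \<alpha>"
  have \<alpha>T: "A \<subseteq> topspace X" if "A \<in> \<alpha>" for A using \<alpha> that by (auto simp: directed_families_def)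
  have dir: "\<exists>E\<in>\<alpha>. X closure_of A \<union> X closure_of B \<subseteq> X closure_of E" if "A \<in> \<alpha>" "B \<in> \<alpha>" for A B
  proof -
    have "\<forall>A\<in>\<alpha>. \<forall>B\<in>\<alpha>. \<exists>E\<in>\<alpha>. A \<union> B \<subseteq> E" using \<alpha> by (simp add: directed_families_def)
    from bspec[OF bspec[OF this that(1)] that(2)] obtain E where E: "E \<in> \<alpha>" "A \<union> B \<subseteq> E" ..
    have "X closure_of A \<union> X closure_of B \<subseteq> X closure_of E"
      using closure_of_mono[OF E(2), of X] by (simp add: closure_of_Un)
    then show ?thesis using E(1) by (rule bexI)
  qed
  have "\<alpha> \<noteq> {}" using \<alpha> by (simp add: directed_families_def)
  then show \<beta>: "?\<beta> \<in> directed_families X"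
    by (rule directed_families_imageI) (rule closure_of_subset_topspace, rule dir)
  let ?N = "\<lambda>f A \<epsilon>. {g \<in> cont_funs X. \<forall>x\<in>A. \<bar>f x - g x\<bar> < \<epsilon>}"
  have le: "?N f (X closure_of A) \<epsilon> \<subseteq> ?N f A \<epsilon>" if "A \<in> \<alpha>" for f :: "'a \<Rightarrow> real" and A \<epsilon>
    using closure_of_subset[OF \<alpha>T[OF that]] by auto
  have ge: "?N f A (\<epsilon> / 2) \<subseteq> ?N f (X closure_of A) \<epsilon>" if A: "A \<in> \<alpha>" and f: "f \<in> cont_funs X" and e: "\<epsilon> > 0" for f A \<epsilon>
  proof
    fix g assume g: "g \<in> ?N f A (\<epsilon> / 2)"
    have "continuous_map X euclideanreal (\<lambda>x. \<bar>f x - g x\<bar>)"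
      using f g by (intro continuous_intros) (auto simp: cont_funs_def)
    then have "closedin X {x \<in> topspace X. \<bar>f x - g x\<bar> \<in> {..\<epsilon> / 2}}"
      by (rule closedin_continuous_map_preimage) simp
    moreover have "A \<subseteq> {x \<in> topspace X. \<bar>f x - g x\<bar> \<in> {..\<epsilon> / 2}}" using \<alpha>T[OF A] g by force
    ultimately have "X closure_of A \<subseteq> {x \<in> topspace X. \<bar>f x - g x\<bar> \<in> {..\<epsilon> / 2}}" by (intro closure_of_minimal)
    then have "\<bar>f x - g x\<bar> < \<epsilon>" if "x \<in> X closure_of A" for x using that e by fastforce
    then show "g \<in> ?N f (X closure_of A) \<epsilon>" using g by blast
  qed
  have "openin (C_alpha X ?\<beta>) U \<longleftrightarrow> openin (C_alpha X \<alpha>) U" for U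
  proof (cases "U \<subseteq> cont_funs X")
    case True
    have "(\<exists>B\<in>?\<beta>. \<exists>\<epsilon>>0. ?N f B \<epsilon> \<subseteq> U) \<longleftrightarrow> (\<exists>A\<in>\<alpha>. \<exists>\<epsilon>>0. ?N f A \<epsilon> \<subseteq> U)" if f: "f \<in> U" for f
    proof
      assume "\<exists>B\<in>?\<beta>. \<exists>\<epsilon>>0. ?N f B \<epsilon> \<subseteq> U"
      then obtain A \<epsilon> where A: "A \<in> \<alpha>" "\<epsilon> > 0" "?N f (X closure_of A) \<epsilon> \<subseteq> U" by blast
      have "?N f A (\<epsilon> / 2) \<subseteq> U" using ge[OF A(1) _ A(2), of f] f True A(3) by blast
      then show "\<exists>A\<in>\<alpha>. \<exists>\<epsilon>>0. ?N f A \<epsilon> \<subseteq> U" using A(1,2) half_gt_zero by blast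
    next
      assume "\<exists>A\<in>\<alpha>. \<exists>\<epsilon>>0. ?N f A \<epsilon> \<subseteq> U"
      then obtain A \<epsilon> where A: "A \<in> \<alpha>" "\<epsilon> > 0" "?N f A \<epsilon> \<subseteq> U" by blast
      have "?N f (X closure_of A) \<epsilon> \<subseteq> U" using le[OF A(1)] A(3) by (rule subset_trans)
      then show "\<exists>B\<in>?\<beta>. \<exists>\<epsilon>>0. ?N f B \<epsilon> \<subseteq> U" using A(1,2) by blast
    qed
    then show ?thesis unfolding openin_C_alpha[OF \<alpha>] openin_C_alpha[OF \<beta>] using True by simp
  next
    case False
    then show ?thesis unfolding openin_C_alpha[OF \<alpha>] openin_C_alpha[OF \<beta>] by simp
  qed
  then show "C_alpha X ?\<beta> = C_alpha X \<alpha>" by (simp add: topology_eq)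
qed

text \<open>A subset \<open>Y\<close> of \<open>K\<close> is sent to the finite unions of its sets,
  which are directed. If \<open>Y\<close> and \<open>Z\<close> give the same topology and
  \<open>k\<close> is in \<open>Y\<close>, then \<open>s k\<close> lies in the closure of a finite
  union over \<open>Z\<close>, and \<open>sep\<close> forces \<open>k \<in> Z\<close>.\<close>

lemma Pow_lepoll_uniform_topologies:
  assumes X: "completely_regular_space X"
    and s: "\<And>k. k \<in> K \<Longrightarrow> s k \<subseteq> topspace X"
    and sep: "\<And>k F. k \<in> K \<Longrightarrow> finite F \<Longrightarrow> F \<subseteq> K - {k} \<Longrightarrow> \<not> s k \<subseteq> X closure_of (\<Union>(s ` F))"
  shows "Pow K \<lesssim> uniform_topologies X"
proof -
  let ?\<alpha> = "\<lambda>Y. (\<lambda>F. \<Union>(s ` F)) ` Fpow Y"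
  have dir: "?\<alpha> Y \<in> directed_families X" if "Y \<in> Pow K" for Y
    by (rule directed_family_Fpow) (use s that in \<open>auto simp: Fpow_def\<close>)
  have le: "Y \<subseteq> Z" if YZ: "Y \<in> Pow K" "Z \<in> Pow K" "C_alpha X (?\<alpha> Y) = C_alpha X (?\<alpha> Z)" for Y Z
  proof
    fix k assume k: "k \<in> Y"
    have "\<Union>(s ` {k}) \<in> ?\<alpha> Y" by (rule imageI) (use k in \<open>simp add: Fpow_def\<close>)
    then have "s k \<in> ?\<alpha> Y" by simp
    from C_alpha_eq_imp_subset_closure[OF X dir[OF YZ(1)] dir[OF YZ(2)] YZ(3) this]
    obtain B where "B \<in> ?\<alpha> Z" and B: "s k \<subseteq> X closure_of B" ..
    then obtain F where "F \<in> Fpow Z" and BF: "B = \<Union>(s ` F)" by (elim imageE)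
    then have F: "finite F" "F \<subseteq> Z" "s k \<subseteq> X closure_of (\<Union>(s ` F))"
      using B unfolding BF by (simp_all add: Fpow_def)
    show "k \<in> Z"
    proof (rule ccontr)
      assume "k \<notin> Z"
      then have "F \<subseteq> K - {k}" using F(2) YZ(2) by blast
      then show False using sep[OF _ F(1)] F(3) k YZ(1) by blast
    qed
  qed
  have "inj_on (\<lambda>Y. C_alpha X (?\<alpha> Y)) (Pow K)"
  proof (rule inj_onI)
    fix Y Z assume "Y \<in> Pow K" "Z \<in> Pow K" "C_alpha X (?\<alpha> Y) = C_alpha X (?\<alpha> Z)"
    then show "Y = Z" using le[of Y Z] le[of Z Y] by simp
  qed
  moreover have "(\<lambda>Y. C_alpha X (?\<alpha> Y)) ` Pow K \<subseteq> uniform_topologies X"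
    unfolding uniform_topologies_def by (rule image_subsetI) (rule imageI[OF dir])
  ultimately show ?thesis unfolding lepoll_def by blast
qed

section \<open>The individual cardinal bounds\<close>

lemma Pow_topspace_lepoll_uniform_topologies:
  assumes X: "completely_regular_space X" "Hausdorff_space X"
  shows "Pow (topspace X) \<lesssim> uniform_topologies X"
proof (rule Pow_lepoll_uniform_topologies[OF X(1), where s = "\<lambda>x. {x}"])
  fix k F assume F: "finite F" "F \<subseteq> topspace X - {k}"
  have "closedin X F"
    by (rule closedin_Hausdorff_finite[OF X(2)]) (use F in auto)
  then have "X closure_of F = F" by (rule closure_of_closedin)
  then show "\<not> {k} \<subseteq> X closure_of (\<Union>((\<lambda>x. {x}) ` F))" using F(2) by auto
qed auto

lemma Pow_regular_opens_lepoll_uniform_topologies: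
  assumes X: "completely_regular_space X" and inf: "infinite (regular_opens X)"
  shows "Pow (regular_opens X) \<lesssim> uniform_topologies X"
proof -
  obtain s where s: "indep X {topspace X} s (regular_opens X)" using exists_indep_regular_opens[OF inf] by blast
  show ?thesis
  proof (rule Pow_lepoll_uniform_topologies[OF X, where s = s])
    show "s k \<subseteq> topspace X" if "k \<in> regular_opens X" for k by (rule openin_subset[OF indep_openin[OF s that]])
    fix k F assume k: "k \<in> regular_opens X" and F: "finite F" "F \<subseteq> regular_opens X - {k}"
    obtain W where W: "openin X W" "W \<noteq> {}" "W \<subseteq> topspace X" "W \<subseteq> s k" "\<forall>l\<in>F. W \<inter> s l = {}"
      by (rule indepE[OF s k F singletonI])
    have "W \<inter> \<Union>(s ` F) = {}" using W(5) by auto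
    then have "W \<inter> X closure_of (\<Union>(s ` F)) = {}" using openin_Int_closure_of_eq_empty[OF W(1)] by blast
    then show "\<not> s k \<subseteq> X closure_of (\<Union>(s ` F))" using W(2,4) by blast
  qed
qed

lemma uniform_topologies_lepoll: "uniform_topologies X \<lesssim> Pow {U. openin X U}"
proof -
  have "uniform_topologies X \<subseteq> C_alpha X ` Pow {C. closedin X C}"
  proof
    fix T assume "T \<in> uniform_topologies X"
    then obtain \<alpha> where \<alpha>: "\<alpha> \<in> directed_families X" "T = C_alpha X \<alpha>" by (auto simp: uniform_topologies_def)
    have "(\<lambda>A. X closure_of A) ` \<alpha> \<in> Pow {C. closedin X C}" by auto
    then show "T \<in> C_alpha X ` Pow {C. closedin X C}"
      by (rule rev_image_eqI) (simp add: C_alpha_closure(2)[OF \<alpha>(1)] \<alpha>(2))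
  qed
  then have "uniform_topologies X \<lesssim> Pow {C. closedin X C}" by (rule subset_image_lepoll)
  also have "\<dots> \<lesssim> Pow {U. openin X U}"
  proof (rule Pow_lepoll_mono)
    have "C \<in> (\<lambda>U. topspace X - U) ` {U. openin X U}" if "closedin X C" for C
      by (rule image_eqI[of _ _ "topspace X - C"]) (use that closedin_subset[OF that] in \<open>auto simp: openin_diff\<close>)
    then show "{C. closedin X C} \<lesssim> {U. openin X U}" by (intro subset_image_lepoll[of _ "\<lambda>U. topspace X - U"]) auto
  qed
  finally show ?thesis .
qed

lemma directed_families_eqpoll:
  assumes inf: "infinite (topspace X)"
  shows "directed_families X \<approx> Pow (Pow (topspace X))"
proof (rule lepoll_antisym)
  show "directed_families X \<lesssim> Pow (Pow (topspace X))"
    by (rule subset_imp_lepoll) (auto simp: directed_families_def)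
  \<comment> \<open>Leaving out \<open>topspace X\<close> makes its insertion injective on families,
    and the infinite power set does not shrink by the loss of one element.\<close>
  let ?P = "Pow (topspace X) - {topspace X}"
  have "infinite ?P" using inf by simp
  then have "insert (topspace X) ?P \<lesssim> ?P" by (rule infinite_insert_lepoll)
  moreover have "insert (topspace X) ?P = Pow (topspace X)" by auto
  ultimately have "Pow (Pow (topspace X)) \<lesssim> Pow ?P" by (intro Pow_lepoll_mono) simp
  also have "\<dots> \<lesssim> directed_families X"
    unfolding lepoll_def
  proof (intro exI conjI)
    show "inj_on (insert (topspace X)) (Pow ?P)"
    proof (rule inj_onI)
      fix S T assume "S \<in> Pow ?P" "T \<in> Pow ?P" "insert (topspace X) S = insert (topspace X) T"
      then show "S = T" by (metis Diff_iff PowD insertI1 insert_ident subsetD)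
    qed
    show "insert (topspace X) ` Pow ?P \<subseteq> directed_families X"
      unfolding directed_families_def by auto
  qed
  finally show "Pow (Pow (topspace X)) \<lesssim> directed_families X" .
qed

theorem proposition4p4:
  fixes X :: "'a topology"
  assumes "completely_regular_space X" and "Hausdorff_space X"
    and "infinite (topspace X)"
  shows "|directed_families X| =o ctwo ^c (ctwo ^c |topspace X| ) \<and>
    (ctwo ^c |topspace X| \<le>o |uniform_topologies X| \<and>
     ctwo ^c |regular_opens X| \<le>o |uniform_topologies X| ) \<and>
    |uniform_topologies X| \<le>o ctwo ^c |{U. openin X U}|"
proof -
  have "|directed_families X| =o |Pow (Pow (topspace X))|"
    using directed_families_eqpoll[OF assms(3)] by (simp add: eqpoll_iff_card_of_ordIso)
  also have "|Pow (Pow (topspace X))| =o ctwo ^c |Pow (topspace X)|" by (rule Pow_cexp_ctwo)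
  also have "ctwo ^c |Pow (topspace X)| =o ctwo ^c (ctwo ^c |topspace X| )"
    by (rule cexp_cong2[OF Pow_cexp_ctwo Card_order_ctwo card_of_Card_order])
  finally have 1: "|directed_families X| =o ctwo ^c (ctwo ^c |topspace X| )" .
  have T: "Pow (topspace X) \<lesssim> uniform_topologies X"
    by (rule Pow_topspace_lepoll_uniform_topologies[OF assms(1,2)])
  have R: "Pow (regular_opens X) \<lesssim> uniform_topologies X"
  \<comment> \<open>By \<open>T\<close> there are infinitely many topologies, which settles a finite
    algebra; the independent family is asked for only when the algebra is infinite.\<close>
  proof (cases "finite (regular_opens X)")
    case True
    have "infinite (uniform_topologies X)"
      using lepoll_finite[OF T] assms(3) by auto
    then show ?thesis by (rule finite_lepoll_infinite) (use True in simp)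
  next
    case False
    then show ?thesis by (rule Pow_regular_opens_lepoll_uniform_topologies[OF assms(1)])
  qed
  have "|uniform_topologies X| \<le>o |Pow {U. openin X U}|"
    using uniform_topologies_lepoll[of X] by (simp add: lepoll_iff_ordLeq)
  also have "|Pow {U. openin X U}| =o ctwo ^c |{U. openin X U}|" by (rule Pow_cexp_ctwo)
  finally have 2: "|uniform_topologies X| \<le>o ctwo ^c |{U. openin X U}|" .
  have "ctwo ^c |topspace X| \<le>o |uniform_topologies X|"
    using ordIso_ordLeq_trans[OF ordIso_symmetric[OF Pow_cexp_ctwo]] T by (simp add: lepoll_iff_ordLeq)
  moreover have "ctwo ^c |regular_opens X| \<le>o |uniform_topologies X|"
    using ordIso_ordLeq_trans[OF ordIso_symmetric[OF Pow_cexp_ctwo]] R by (simp add: lepoll_iff_ordLeq)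
  ultimately show ?thesis using 1 2 by blast
qed

end
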